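(* Consider a finite discounted stochastic game that is weakly acyclic under strict better replies. Suppose that each DM$^i$, $i\in\{1,\dots,N\}$, updates its policies by Algorithm 2 (described in the context), with exploration phase lengths $\{T_k\}_{k\ge 0}$ common to all DMs, and let $\pi_k=(\pi_k^1,\dots,\pi_k^N)\in\Pi$ be the resulting joint baseline policy in the $k$-th exploration phase. Assume: (1) for all $(x',x)\in\mathbb{X}\times\mathbb{X}$ there exist a finite integer $H\ge 0$ and joint decisions $\tilde u_0,\dots,\tilde u_H\in\mathbb{U}^1\times\cdots\times\mathbb{U}^N$ such that $P[x_{H+1}=x' \mid (x_0,u_0,\dots,u_H)=(x,\tilde u_0,\dots,\tilde u_H)]>0$; (2) for all $i$, $0<\delta^i<\check\delta$ and $0<\rho^i<\check\rho$, where $\check\delta,\check\rho$ are defined in the context. Then: (i) For any $\epsilon>0$, there exist $\tilde T<\infty$ and $\tilde k<\infty$ such that if $\min_\ell T_\ell\ge\tilde T$, then $P[\pi_k\in\Pi_{\rm eq}]\ge 1-\epsilon$ for all $k\ge\tilde k$. (ii) If $T_k\to\infty$ as $k\to\infty$, then $P[\pi_k\in\Pi_{\rm eq}]\to 1$. (iii) There exist finite integers $\{\tilde T_k\}_{k\ge0}$ such that if $T_k\ge\tilde T_k$ for all $k$, then $P[\pi_k\to\pi^* \text{ for some } \pi^*\in\Pi_{\rm eq}]=1$.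
   Context: **Game.** A finite discounted stochastic game consists of: decision makers DM$^1,\dots,$DM$^N$; a finite state set $\mathbb{X}$; a finite set $\mathbb{U}^i$ of control decisions for each DM$^i$; a cost function $c^i:\mathbb{X}\times\mathbb{U}^1\times\cdots\times\mathbb{U}^N\to\mathbb{R}$ for each $i$; a discount factor $\beta^i\in(0,1)$ for each $i$; a random initial state $x_0\in\mathbb{X}$; and a transition kernel $P[x'|x,u^1,\dots,u^N]$. At each time $t\ge0$ each DM$^i$ chooses $u^i_t\in\mathbb{U}^i$ (possibly randomly), incurs cost $c^i(x_t,u_t^1,\dots,u_t^N)$, and $x_{t+1}$ is drawn from $P[\cdot|x_t,u_t^1,\dots,u_t^N]$. **Policies.** $\Delta^i$ is the set of maps $\mathbb{X}\to\mathcal{P}(\mathbb{U}^i)$ (stationary randomized policies; $\mathcal P(\cdot)$ denotes probability distributions), and $\Pi^i$ is the set of maps $\mathbb{X}\to\mathbb{U}^i$ (deterministic stationary policies, viewed as a subset of $\Delta^i$). $\Pi=\times_j\Pi^j$, $\Delta=\times_j\Delta^j$, $\Pi^{-i}=\times_{j\ne i}\Pi^j$, $\Delta^{-i}=\times_{j\ne i}\Delta^j$; $\pi=(\pi^i,\pi^{-i})$. Under a joint policy the DMs randomize independently, and $J^i_x(\pi)=E[\sum_{t\ge0}(\beta^i)^t c^i(x_t,u_t^1,\dots,u_t^N)\mid x_0=x]$. **Equilibrium.** $\pi^*\in\Delta$ is an equilibrium if $J_x^i(\pi^{*i},\pi^{*-i})=\min_{\pi^i\in\Delta^i}J_x^i(\pi^i,\pi^{*-i})$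 for all $i,x$. $\Pi_{\rm eq}\subset\Pi$ is the set of deterministic equilibrium policies. **Weak acyclicity.** For $\pi=(\pi^i,\pi^{-i})\in\Delta$, the better-reply set is $\Upsilon^i_\pi=\{\hat\pi^i\in\Pi^i: J^i_x(\hat\pi^i,\pi^{-i})\le J^i_x(\pi^i,\pi^{-i})\ \forall x\}$. A better reply $\hat\pi^i\in\Upsilon^i_\pi$ is a strict better reply with respect to $\pi$ if $J_x^i(\hat\pi^i,\pi^{-i})<J_x^i(\pi^i,\pi^{-i})$ for some $x$. A strict better reply path is a (possibly finite) sequence $\pi_0,\pi_1,\dots$ in $\Pi$ such that, for each $k$, $\pi_k$ and $\pi_{k+1}$ differ in exactly one DM position, say DM$^i$, and $\pi_{k+1}^i$ is a strict better reply with respect to $\pi_k$. The game is weakly acyclic under strict better replies if from each element of $\Pi$ there starts a strict better reply path ending at an element of $\Pi_{\rm eq}$. **Q-factors.** For $\pi=(\pi^i,\pi^{-i})\in\Pi^i\times\Delta^{-i}$, $Q^i_{\pi}:\mathbb{X}\times\mathbb{U}^i\to\mathbb{R}$ is the unique solution of $$Q^i_{\pi}(x,u^i)=E_{\pi^{-i}(x)}\Big[c^i(x,u^i,u^{-i})+\beta^i\sum_{x'\in\mathbb{X}}P[x'|x,u^i,u^{-i}]\,Q^i_{\pi}(x',\pi^i(x'))\Big]$$ for all $x,u^i$, where $u^{-i}$ is drawn from the product distribution $\pi^{-i}(x)$. **Algorithm 2 (for DM$^i$).** Parameters: a compact set $\mathbb{Q}^i\subset\mathbb{R}^{|\mathbb{X}\times\mathbb{U}^i|}$;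 integers $T_k\in[1,\infty)$, $k\ge 0$; experimentation probability $\rho^i\in(0,1)$; inertia $\lambda^i\in(0,1)$; tolerance $\delta^i\in(0,\infty)$; step sizes $\alpha^i_n\in[0,1]$ with $\sum_n\alpha^i_n=\infty$, $\sum_n(\alpha^i_n)^2<\infty$. Put $t_0=0$, $t_{k+1}=t_k+T_k$. Initialize $\pi_0^i,\hat\pi_0^i\in\Pi^i$ arbitrarily except $\hat\pi^i_0\neq\pi^i_0$ (so $|\Pi^i|\ge2$), and $Q_0^i,\hat Q_0^i\in\mathbb{Q}^i$ arbitrarily. For $k=0,1,2,\dots$: - ($k$-th exploration phase) For $t=t_k,\dots,t_{k+1}-1$: with probability $1-\rho^i$ set $u_t^i=\pi_k^i(x_t)$, and with probability $\rho^i$ draw $u_t^i$ uniformly from $\mathbb{U}^i$; receive $c^i(x_t,u_t^i,u_t^{-i})$ and $x_{t+1}\sim P[\cdot|x_t,u_t^i,u_t^{-i}]$; let $n_t^i$ be the number of visits to $(x_t,u_t^i)$ in the $k$-th exploration phase up to $t$; set $$Q^i_{t+1}(x_t,u_t^i)=(1-\alpha^i_{n^i_t})Q^i_t(x_t,u^i_t)+\alpha^i_{n^i_t}\big[c^i(x_t,u^i_t,u^{-i}_t)+\beta^iQ^i_t(x_{t+1},\pi^i_k(x_{t+1}))\big],$$ $$\hat Q^i_{t+1}(x_t,u_t^i)=(1-\alpha^i_{n^i_t})\hat Q^i_t(x_t,u^i_t)+\alpha^i_{n^i_t}\big[c^i(x_t,u^i_t,u^{-i}_t)+\beta^i\hat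 Q^i_t(x_{t+1},\hat\pi^i_k(x_{t+1}))\big],$$ and leave all other entries $(x,u^i)\ne(x_t,u^i_t)$ of $Q^i$ and $\hat Q^i$ unchanged. - If $\hat Q^i_{t_{k+1}}(x,\hat\pi^i_k(x))\le Q^i_{t_{k+1}}(x,\pi^i_k(x))+\delta^i$ for all $x$ and $\hat Q^i_{t_{k+1}}(x,\hat\pi^i_k(x))\le Q^i_{t_{k+1}}(x,\pi^i_k(x))-\delta^i$ for some $x$, then set $\pi^i_{k+1}=\pi^i_k$ with probability $\lambda^i$ and $\pi^i_{k+1}=\hat\pi^i_k$ with probability $1-\lambda^i$. Otherwise set $\pi^i_{k+1}=\pi^i_k$. - Draw $\hat\pi^i_{k+1}$ uniformly from $\Pi^i\setminus\{\pi^i_{k+1}\}$. - Reset $Q^i_{t_{k+1}},\hat Q^i_{t_{k+1}}$ to any elements of $\mathbb{Q}^i$. All randomizations are independent across DMs and times. **Constants.** It is assumed (to avoid trivial cases) that $Q^i_{(\pi^i,\pi^{-i})}(x,\pi^i(x))\ne Q^i_{(\tilde\pi^i,\pi^{-i})}(x,\tilde\pi^i(x))$ for some $i,x,\pi^i,\tilde\pi^i\in\Pi^i,\pi^{-i}\in\Pi^{-i}$. Then $\check\delta$ is the minimum of $$|Q^i_{(\pi^i,\pi^{-i})}(x,\pi^i(x))-Q^i_{(\tilde\pi^i,\pi^{-i})}(x,\tilde\pi^i(x))|$$ over all $i,x,\pi^i,\tilde\pi^i\in\Pi^i,\pi^{-i}\in\Pi^{-i}$ for which this quantity is nonzero. For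 $\pi\in\Pi$ let $\bar\pi^j=(1-\rho^j)\pi^j+\rho^j\nu^j$, where $\nu^j\in\Delta^j$ assigns the uniform distribution on $\mathbb{U}^j$ to each $x$, and $\bar\pi^{-i}=(\bar\pi^j)_{j\ne i}$. Given $\delta^i\in(0,\check\delta)$ for all $i$, $\check\rho>0$ is a number (which exists) such that, if $\rho^i\le\check\rho$ for all $i$, then $$\max\big\{|Q^i_{(\pi^i,\pi^{-i})}-Q^i_{(\pi^i,\bar\pi^{-i})}|_\infty,\ |Q^i_{(\hat\pi^i,\pi^{-i})}-Q^i_{(\hat\pi^i,\bar\pi^{-i})}|_\infty\big\}<\tfrac12\min\{\delta^i,\check\delta-\delta^i\}$$ for all $i$, all $\pi\in\Pi$ and all $\hat\pi^i\in\Pi^i$, where $|\cdot|_\infty$ is the maximum norm. *)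

theory Defs
  imports "HOL-Probability.Probability"
begin

section \<open>Discrete Markov chains on path space\<close>

text \<open>
  The law of a (time-inhomogeneous) Markov chain with initial distribution \<open>p\<close>, whose state at
  time \<open>Suc n\<close> is drawn from \<open>K n s\<close> when its state at time \<open>n\<close> is \<open>s\<close>.
\<close>

definition chain_kernel :: "'s pmf \<Rightarrow> (nat \<Rightarrow> 's \<Rightarrow> 's pmf) \<Rightarrow> nat \<Rightarrow> (nat \<Rightarrow> 's) \<Rightarrow> 's measure" where
  "chain_kernel p K n \<omega> = measure_pmf (case n of 0 \<Rightarrow> p | Suc m \<Rightarrow> K m (\<omega> m))"

definition chain_measure :: "'s pmf \<Rightarrow> (nat \<Rightarrow> 's \<Rightarrow> 's pmf) \<Rightarrow> (nat \<Rightarrow> 's) measure" where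
  "chain_measure p K =
     projective_family.lim UNIV
       (Ionescu_Tulcea.CI (chain_kernel p K) (\<lambda>_. count_space UNIV)) (\<lambda>_. count_space UNIV)"

lemma Ionescu_Tulcea_chain_kernel:
  "Ionescu_Tulcea (chain_kernel p K) (\<lambda>_. count_space UNIV)"
proof (rule Ionescu_Tulcea.intro)
  show "chain_kernel p K n \<in>
      measurable (PiM {0..<n} (\<lambda>_. count_space UNIV)) (subprob_algebra (count_space UNIV))" for n
  proof (cases n)
    case 0
    have "measure_pmf p \<in> space (subprob_algebra (count_space UNIV))"
      by (simp add: space_subprob_algebra measure_pmf.subprob_space_axioms)
    then show ?thesis
      by (simp add: chain_kernel_def[abs_def] 0)
  next
    case (Suc m)
    have "(\<lambda>\<omega>. \<omega> m) \<in> measurable (PiM {0..<n} (\<lambda>_. count_space UNIV)) (count_space UNIV)"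
      by (rule measurable_component_singleton) (simp add: Suc)
    moreover have "(\<lambda>s. measure_pmf (K m s)) \<in>
        measurable (count_space UNIV) (subprob_algebra (count_space UNIV))"
      by (auto simp: space_subprob_algebra measure_pmf.subprob_space_axioms)
    ultimately have "(\<lambda>\<omega>. measure_pmf (K m (\<omega> m))) \<in>
        measurable (PiM {0..<n} (\<lambda>_. count_space UNIV)) (subprob_algebra (count_space UNIV))"
      by (rule measurable_compose)
    then show ?thesis
      by (simp add: chain_kernel_def[abs_def] Suc)
  qed
  show "prob_space (chain_kernel p K n \<omega>)" for n \<omega>
    by (simp add: chain_kernel_def measure_pmf.prob_space_axioms)
qed

lemma prob_space_chain_measure: "prob_space (chain_measure p K)"
proof -
  interpret Ionescu_Tulcea "chain_kernel p K" "\<lambda>_. count_space UNIV"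
    by (rule Ionescu_Tulcea_chain_kernel)
  have "prob_space (distr PF.lim (PiM {} (\<lambda>_. count_space UNIV)) (\<lambda>\<omega>. restrict \<omega> {}))"
    unfolding distr_lim[OF finite.emptyI] by (rule PF.prob_space_P) auto
  then show ?thesis
    unfolding chain_measure_def
    by (rule prob_space_distrD[rotated])
       (simp add: measurable_cong_sets[OF PF.sets_lim refl] measurable_restrict)
qed


section \<open>Finite discounted stochastic games\<close>

text \<open>
  Decision makers and states range over finite types. The decision set of decision maker \<open>i\<close> is
  the set \<open>actions G i\<close>; a joint decision is a function assigning a decision to each decision maker.
\<close>

record ('i, 'x, 'u) game =
  actions :: "'i \<Rightarrow> 'u set"
  cost :: "'i \<Rightarrow> 'x \<Rightarrow> ('i \<Rightarrow> 'u) \<Rightarrow> real"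
  discount :: "'i \<Rightarrow> real"
  initial :: "'x pmf"
  transition :: "'x \<Rightarrow> ('i \<Rightarrow> 'u) \<Rightarrow> 'x pmf"

definition discounted_game :: "('i::finite, 'x::finite, 'u) game \<Rightarrow> bool" where
  "discounted_game G \<longleftrightarrow>
     (\<forall>i. finite (actions G i) \<and> actions G i \<noteq> {} \<and> 0 < discount G i \<and> discount G i < 1)"

definition joint_actions :: "('i, 'x, 'u) game \<Rightarrow> ('i \<Rightarrow> 'u) set" where
  "joint_actions G = {u. \<forall>i. u i \<in> actions G i}"

definition det_policies :: "('i, 'x, 'u) game \<Rightarrow> 'i \<Rightarrow> ('x \<Rightarrow> 'u) set" where
  "det_policies G i = {p. \<forall>x. p x \<in> actions G i}"

definition joint_det_policies :: "('i, 'x, 'u) game \<Rightarrow> ('i \<Rightarrow> 'x \<Rightarrow> 'u) set" where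
  "joint_det_policies G = {\<pi>. \<forall>i. \<pi> i \<in> det_policies G i}"

definition rand_policies :: "('i, 'x, 'u) game \<Rightarrow> 'i \<Rightarrow> ('x \<Rightarrow> 'u pmf) set" where
  "rand_policies G i = {\<sigma>. \<forall>x. set_pmf (\<sigma> x) \<subseteq> actions G i}"

definition joint_rand_policies :: "('i, 'x, 'u) game \<Rightarrow> ('i \<Rightarrow> 'x \<Rightarrow> 'u pmf) set" where
  "joint_rand_policies G = {\<sigma>. \<forall>i. \<sigma> i \<in> rand_policies G i}"

definition embed_policy :: "('x \<Rightarrow> 'u) \<Rightarrow> 'x \<Rightarrow> 'u pmf" where
  "embed_policy p x = return_pmf (p x)"

definition embed_joint :: "('i \<Rightarrow> 'x \<Rightarrow> 'u) \<Rightarrow> 'i \<Rightarrow> 'x \<Rightarrow> 'u pmf" where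
  "embed_joint \<pi> i = embed_policy (\<pi> i)"

definition joint_decision :: "('i::finite \<Rightarrow> 'x \<Rightarrow> 'u pmf) \<Rightarrow> 'x \<Rightarrow> ('i \<Rightarrow> 'u) pmf" where
  "joint_decision \<sigma> x = Pi_pmf UNIV undefined (\<lambda>i. \<sigma> i x)"

text \<open>The law of \<open>(x\<^sub>t, u\<^sub>t)\<^sub>t\<close> under the joint policy \<open>\<sigma>\<close> given \<open>x\<^sub>0 = x\<close>.\<close>

definition trajectory_measure ::
  "('i::finite, 'x, 'u) game \<Rightarrow> ('i \<Rightarrow> 'x \<Rightarrow> 'u pmf) \<Rightarrow> 'x \<Rightarrow> (nat \<Rightarrow> 'x \<times> ('i \<Rightarrow> 'u)) measure" where
  "trajectory_measure G \<sigma> x =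
     (let decide = (\<lambda>y. map_pmf (Pair y) (joint_decision \<sigma> y))
      in chain_measure (decide x) (\<lambda>_ (y, u). bind_pmf (transition G y u) decide))"

definition total_cost ::
  "('i::finite, 'x, 'u) game \<Rightarrow> 'i \<Rightarrow> ('i \<Rightarrow> 'x \<Rightarrow> 'u pmf) \<Rightarrow> 'x \<Rightarrow> real" where
  "total_cost G i \<sigma> x =
     (\<integral>\<omega>. (\<Sum>t. discount G i ^ t * cost G i (fst (\<omega> t)) (snd (\<omega> t))) \<partial>trajectory_measure G \<sigma> x)"

definition equilibrium :: "('i::finite, 'x, 'u) game \<Rightarrow> ('i \<Rightarrow> 'x \<Rightarrow> 'u pmf) \<Rightarrow> bool" where
  "equilibrium G \<sigma> \<longleftrightarrow> \<sigma> \<in> joint_rand_policies G \<and>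
     (\<forall>i x. \<forall>\<tau>\<in>rand_policies G i. total_cost G i \<sigma> x \<le> total_cost G i (\<sigma>(i := \<tau>)) x)"

definition det_equilibria :: "('i::finite, 'x, 'u) game \<Rightarrow> ('i \<Rightarrow> 'x \<Rightarrow> 'u) set" where
  "det_equilibria G = {\<pi> \<in> joint_det_policies G. equilibrium G (embed_joint \<pi>)}"

definition better_replies ::
  "('i::finite, 'x, 'u) game \<Rightarrow> 'i \<Rightarrow> ('i \<Rightarrow> 'x \<Rightarrow> 'u pmf) \<Rightarrow> ('x \<Rightarrow> 'u) set" where
  "better_replies G i \<sigma> =
     {q \<in> det_policies G i. \<forall>x. total_cost G i (\<sigma>(i := embed_policy q)) x \<le> total_cost G i \<sigma> x}"

definition strict_better_replies ::
  "('i::finite, 'x, 'u) game \<Rightarrow> 'i \<Rightarrow> ('i \<Rightarrow> 'x \<Rightarrow> 'u pmf) \<Rightarrow> ('x \<Rightarrow> 'u) set" where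
  "strict_better_replies G i \<sigma> =
     {q \<in> better_replies G i \<sigma>. \<exists>x. total_cost G i (\<sigma>(i := embed_policy q)) x < total_cost G i \<sigma> x}"

text \<open>The finite sequence \<open>\<pi> 0, \<dots>, \<pi> n\<close> is a strict better reply path.\<close>

definition strict_better_reply_path ::
  "('i::finite, 'x, 'u) game \<Rightarrow> nat \<Rightarrow> (nat \<Rightarrow> 'i \<Rightarrow> 'x \<Rightarrow> 'u) \<Rightarrow> bool" where
  "strict_better_reply_path G n \<pi> \<longleftrightarrow>
     (\<forall>k\<le>n. \<pi> k \<in> joint_det_policies G) \<and>
     (\<forall>k<n. \<exists>i. \<pi> (Suc k) i \<noteq> \<pi> k i \<and> (\<forall>j. j \<noteq> i \<longrightarrow> \<pi> (Suc k) j = \<pi> k j) \<and>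
        \<pi> (Suc k) i \<in> strict_better_replies G i (embed_joint (\<pi> k)))"

definition weakly_acyclic :: "('i::finite, 'x, 'u) game \<Rightarrow> bool" where
  "weakly_acyclic G \<longleftrightarrow> (\<forall>\<pi>\<^sub>0\<in>joint_det_policies G.
     \<exists>n \<pi>. strict_better_reply_path G n \<pi> \<and> \<pi> 0 = \<pi>\<^sub>0 \<and> \<pi> n \<in> det_equilibria G)"

text \<open>The law of the state reached from \<open>x\<close> after applying a list of joint decisions.\<close>

fun apply_decisions :: "('i, 'x, 'u) game \<Rightarrow> ('i \<Rightarrow> 'u) list \<Rightarrow> 'x \<Rightarrow> 'x pmf" where
  "apply_decisions G [] x = return_pmf x"
| "apply_decisions G (u # us) x = bind_pmf (transition G x u) (apply_decisions G us)"

definition all_states_reachable :: "('i, 'x, 'u) game \<Rightarrow> bool" where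
  "all_states_reachable G \<longleftrightarrow> (\<forall>x' x. \<exists>H us. length us = Suc H \<and> set us \<subseteq> joint_actions G \<and>
     pmf (apply_decisions G us x) x' > 0)"


section \<open>Q-factors\<close>

text \<open>
  Real tables indexed by states and decisions of decision maker \<open>i\<close> are represented by functions
  vanishing outside \<open>actions G i\<close>. The topology on them is the product topology.
\<close>

definition tables :: "('i, 'x, 'u) game \<Rightarrow> 'i \<Rightarrow> ('x \<Rightarrow> 'u \<Rightarrow> real) set" where
  "tables G i = {q. \<forall>x u. u \<notin> actions G i \<longrightarrow> q x u = 0}"

text \<open>
  The Q-factors for the policy \<open>p\<close> of decision maker \<open>i\<close> and the policies \<open>\<sigma> j\<close>, \<open>j \<noteq> i\<close>, of the
  others; the component \<open>\<sigma> i\<close> is ignored.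
\<close>

definition q_factor ::
  "('i::finite, 'x::finite, 'u) game \<Rightarrow> 'i \<Rightarrow> ('x \<Rightarrow> 'u) \<Rightarrow> ('i \<Rightarrow> 'x \<Rightarrow> 'u pmf) \<Rightarrow> 'x \<Rightarrow> 'u \<Rightarrow> real" where
  "q_factor G i p \<sigma> = (THE q. q \<in> tables G i \<and>
     (\<forall>x. \<forall>u\<in>actions G i. q x u =
        measure_pmf.expectation (Pi_pmf (UNIV - {i}) undefined (\<lambda>j. \<sigma> j x))
          (\<lambda>v. cost G i x (v(i := u)) +
            discount G i * (\<Sum>x'\<in>UNIV. pmf (transition G x (v(i := u))) x' * q x' (p x')))))"

definition table_dist ::
  "('i, 'x, 'u) game \<Rightarrow> 'i \<Rightarrow> ('x \<Rightarrow> 'u \<Rightarrow> real) \<Rightarrow> ('x \<Rightarrow> 'u \<Rightarrow> real) \<Rightarrow> real" where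
  "table_dist G i q q' = Max {\<bar>q x u - q' x u\<bar> | x u. u \<in> actions G i}"

definition value_gaps :: "('i::finite, 'x::finite, 'u) game \<Rightarrow> real set" where
  "value_gaps G =
     {\<bar>q_factor G i p (embed_joint \<pi>) x (p x) - q_factor G i p' (embed_joint \<pi>) x (p' x)\<bar> | i x p p' \<pi>.
        p \<in> det_policies G i \<and> p' \<in> det_policies G i \<and> \<pi> \<in> joint_det_policies G} - {0}"

definition delta_check :: "('i::finite, 'x::finite, 'u) game \<Rightarrow> real" where
  "delta_check G = Min (value_gaps G)"

text \<open>\<open>(1 - r) p + r \<nu>\<close>, where \<open>\<nu>\<close> is uniform on the decision set of decision maker \<open>i\<close>.\<close>

definition perturbed_policy ::
  "('i, 'x, 'u) game \<Rightarrow> real \<Rightarrow> 'i \<Rightarrow> ('x \<Rightarrow> 'u) \<Rightarrow> 'x \<Rightarrow> 'u pmf" where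
  "perturbed_policy G r i p x =
     bind_pmf (bernoulli_pmf r) (\<lambda>b. if b then pmf_of_set (actions G i) else return_pmf (p x))"

definition rho_check_bound ::
  "('i::finite, 'x::finite, 'u) game \<Rightarrow> ('i \<Rightarrow> real) \<Rightarrow> real \<Rightarrow> bool" where
  "rho_check_bound G \<delta> r \<longleftrightarrow> 0 < r \<and>
     (\<forall>\<rho>. (\<forall>i. 0 < \<rho> i \<and> \<rho> i < 1 \<and> \<rho> i \<le> r) \<longrightarrow>
       (\<forall>i. \<forall>\<pi>\<in>joint_det_policies G. \<forall>p\<in>det_policies G i.
          (let \<pi>' = (\<lambda>j. perturbed_policy G (\<rho> j) j (\<pi> j)) in
           max (table_dist G i (q_factor G i (\<pi> i) (embed_joint \<pi>)) (q_factor G i (\<pi> i) \<pi>'))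
               (table_dist G i (q_factor G i p (embed_joint \<pi>)) (q_factor G i p \<pi>'))
           < 1/2 * min (\<delta> i) (delta_check G - \<delta> i))))"


section \<open>The learning algorithm\<close>

record ('i, 'x, 'u) algorithm =
  table_set :: "'i \<Rightarrow> ('x \<Rightarrow> 'u \<Rightarrow> real) set"
  experiment_prob :: "'i \<Rightarrow> real"
  inertia :: "'i \<Rightarrow> real"
  tolerance :: "'i \<Rightarrow> real"
  step_size :: "'i \<Rightarrow> nat \<Rightarrow> real"

definition valid_algorithm :: "('i, 'x, 'u) game \<Rightarrow> ('i, 'x, 'u) algorithm \<Rightarrow> bool" where
  "valid_algorithm G A \<longleftrightarrow> (\<forall>i.
     compact (table_set A i) \<and> table_set A i \<subseteq> tables G i \<and>
     0 < experiment_prob A i \<and> experiment_prob A i < 1 \<and>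
     0 < inertia A i \<and> inertia A i < 1 \<and>
     0 < tolerance A i \<and>
     (\<forall>n. 0 \<le> step_size A i n \<and> step_size A i n \<le> 1) \<and>
     filterlim (\<lambda>N. \<Sum>n<N. step_size A i n) at_top sequentially \<and>
     summable (\<lambda>n. (step_size A i n)\<^sup>2))"

text \<open>
  The state of the system at some time during an exploration phase: the current state \<open>env\<close> of the
  game, the baseline policies, the candidate policies, the associated tables, and the
  state-decision pairs \<open>(x\<^sub>t, u\<^sub>t)\<close> visited so far in the current phase, in chronological order.
\<close>

record ('i, 'x, 'u) phase_state =
  env :: 'x
  baseline :: "'i \<Rightarrow> 'x \<Rightarrow> 'u"
  candidate :: "'i \<Rightarrow> 'x \<Rightarrow> 'u"
  base_table :: "'i \<Rightarrow> 'x \<Rightarrow> 'u \<Rightarrow> real"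
  cand_table :: "'i \<Rightarrow> 'x \<Rightarrow> 'u \<Rightarrow> real"
  visited :: "('x \<times> ('i \<Rightarrow> 'u)) list"

definition num_visits :: "'i \<Rightarrow> ('x \<times> ('i \<Rightarrow> 'u)) list \<Rightarrow> 'x \<Rightarrow> 'u \<Rightarrow> nat" where
  "num_visits i vs x a = length (filter (\<lambda>(y, v). y = x \<and> v i = a) vs)"

text \<open>The \<open>a\<close>-damped update of the table \<open>q\<close> for policy \<open>p\<close> on the transition \<open>(x, u, x')\<close>.\<close>

definition q_update ::
  "('i, 'x, 'u) game \<Rightarrow> 'i \<Rightarrow> real \<Rightarrow> ('x \<Rightarrow> 'u) \<Rightarrow> 'x \<Rightarrow> ('i \<Rightarrow> 'u) \<Rightarrow> 'x
     \<Rightarrow> ('x \<Rightarrow> 'u \<Rightarrow> real) \<Rightarrow> 'x \<Rightarrow> 'u \<Rightarrow> real" where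
  "q_update G i a p x u x' q =
     q(x := (q x)(u i := (1 - a) * q x (u i) + a * (cost G i x u + discount G i * q x' (p x'))))"

text \<open>
  The visit counts that index the step sizes include the current visit, so they start from 1.
\<close>

definition explore_step ::
  "('i::finite, 'x, 'u) game \<Rightarrow> ('i, 'x, 'u) algorithm \<Rightarrow> ('i, 'x, 'u) phase_state
     \<Rightarrow> ('i, 'x, 'u) phase_state pmf" where
  "explore_step G A s = do {
     let x = env s;
     u \<leftarrow> joint_decision (\<lambda>i. perturbed_policy G (experiment_prob A i) i (baseline s i)) x;
     x' \<leftarrow> transition G x u;
     let vs = visited s @ [(x, u)];
     let a = (\<lambda>i. step_size A i (num_visits i vs x (u i)));
     return_pmf (s\<lparr>env := x',
       base_table := (\<lambda>i. q_update G i (a i) (baseline s i) x u x' (base_table s i)),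
       cand_table := (\<lambda>i. q_update G i (a i) (candidate s i) x u x' (cand_table s i)),
       visited := vs\<rparr>)
   }"

fun explore ::
  "('i::finite, 'x, 'u) game \<Rightarrow> ('i, 'x, 'u) algorithm \<Rightarrow> nat \<Rightarrow> ('i, 'x, 'u) phase_state
     \<Rightarrow> ('i, 'x, 'u) phase_state pmf" where
  "explore G A 0 s = return_pmf s"
| "explore G A (Suc n) s = bind_pmf (explore_step G A s) (explore G A n)"

definition accepts :: "('i, 'x, 'u) algorithm \<Rightarrow> ('i, 'x, 'u) phase_state \<Rightarrow> 'i \<Rightarrow> bool" where
  "accepts A s i \<longleftrightarrow>
     (\<forall>x. cand_table s i x (candidate s i x) \<le> base_table s i x (baseline s i x) + tolerance A i) \<and>
     (\<exists>x. cand_table s i x (candidate s i x) \<le> base_table s i x (baseline s i x) - tolerance A i)"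

text \<open>The new baseline and candidate policies of decision maker \<open>i\<close> at the end of a phase.\<close>

definition new_policies ::
  "('i, 'x, 'u) game \<Rightarrow> ('i, 'x, 'u) algorithm \<Rightarrow> ('i, 'x, 'u) phase_state \<Rightarrow> 'i
     \<Rightarrow> (('x \<Rightarrow> 'u) \<times> ('x \<Rightarrow> 'u)) pmf" where
  "new_policies G A s i = do {
     p \<leftarrow> if accepts A s i
          then map_pmf (\<lambda>stay. if stay then baseline s i else candidate s i) (bernoulli_pmf (inertia A i))
          else return_pmf (baseline s i);
     p' \<leftarrow> pmf_of_set (det_policies G i - {p});
     return_pmf (p, p')
   }"

text \<open>
  A reset rule selects the initial tables of a phase for the baseline and for the candidate policy. It may depend on everything that
  has happened before: the list of final states of all completed phases (each of which records
  all state-decision pairs visited in that phase), the current state of the game and the new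
  baseline and candidate policies. For the empty list it gives the tables at time \<open>0\<close>.
\<close>

type_synonym ('i, 'x, 'u) reset_rule =
  "('i, 'x, 'u) phase_state list \<Rightarrow> 'x \<Rightarrow> ('i \<Rightarrow> 'x \<Rightarrow> 'u) \<Rightarrow> ('i \<Rightarrow> 'x \<Rightarrow> 'u)
     \<Rightarrow> 'i \<Rightarrow> ('x \<Rightarrow> 'u \<Rightarrow> real) \<times> ('x \<Rightarrow> 'u \<Rightarrow> real)"

definition start_phase ::
  "('i, 'x, 'u) reset_rule \<Rightarrow> ('i, 'x, 'u) phase_state list \<Rightarrow> 'x
     \<Rightarrow> ('i \<Rightarrow> 'x \<Rightarrow> 'u) \<Rightarrow> ('i \<Rightarrow> 'x \<Rightarrow> 'u) \<Rightarrow> ('i, 'x, 'u) phase_state" where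
  "start_phase R h x \<pi> \<pi>' =
     \<lparr>env = x, baseline = \<pi>, candidate = \<pi>',
      base_table = (\<lambda>i. fst (R h x \<pi> \<pi>' i)), cand_table = (\<lambda>i. snd (R h x \<pi> \<pi>' i)), visited = []\<rparr>"

text \<open>
  A run is described at the beginnings of the exploration phases, by the list of final states
  of the completed phases together with the initial state of the new phase.
\<close>

type_synonym ('i, 'x, 'u) run_state =
  "('i, 'x, 'u) phase_state list \<times> ('i, 'x, 'u) phase_state"

definition next_phase ::
  "('i::finite, 'x, 'u) game \<Rightarrow> ('i, 'x, 'u) algorithm \<Rightarrow> ('i, 'x, 'u) reset_rule \<Rightarrow> nat
     \<Rightarrow> ('i, 'x, 'u) run_state \<Rightarrow> ('i, 'x, 'u) run_state pmf" where
  "next_phase G A R n = (\<lambda>(h, s). do {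
     e \<leftarrow> explore G A n s;
     f \<leftarrow> Pi_pmf UNIV undefined (new_policies G A e);
     let h' = h @ [e];
     return_pmf (h', start_phase R h' (env e) (\<lambda>i. fst (f i)) (\<lambda>i. snd (f i)))
   })"

text \<open>
  The law of a run with initial baseline policies \<open>\<pi>\<^sub>0\<close>, initial candidate policies \<open>\<pi>\<^sub>0'\<close> and
  length \<open>T k\<close> of the \<open>k\<close>-th exploration phase.
\<close>

definition run_measure ::
  "('i::finite, 'x, 'u) game \<Rightarrow> ('i, 'x, 'u) algorithm \<Rightarrow> ('i \<Rightarrow> 'x \<Rightarrow> 'u) \<Rightarrow> ('i \<Rightarrow> 'x \<Rightarrow> 'u)
     \<Rightarrow> ('i, 'x, 'u) reset_rule \<Rightarrow> (nat \<Rightarrow> nat) \<Rightarrow> (nat \<Rightarrow> ('i, 'x, 'u) run_state) measure" where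
  "run_measure G A \<pi>\<^sub>0 \<pi>\<^sub>0' R T =
     chain_measure (map_pmf (\<lambda>x. ([], start_phase R [] x \<pi>\<^sub>0 \<pi>\<^sub>0')) (initial G))
       (\<lambda>k. next_phase G A R (T k))"

definition baseline_at :: "(nat \<Rightarrow> ('i, 'x, 'u) run_state) \<Rightarrow> nat \<Rightarrow> 'i \<Rightarrow> 'x \<Rightarrow> 'u" where
  "baseline_at \<omega> k = baseline (snd (\<omega> k))"

definition valid_run ::
  "('i, 'x, 'u) game \<Rightarrow> ('i, 'x, 'u) algorithm \<Rightarrow> ('i \<Rightarrow> 'x \<Rightarrow> 'u) \<Rightarrow> ('i \<Rightarrow> 'x \<Rightarrow> 'u)
     \<Rightarrow> ('i, 'x, 'u) reset_rule \<Rightarrow> (nat \<Rightarrow> nat) \<Rightarrow> bool" where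
  "valid_run G A \<pi>\<^sub>0 \<pi>\<^sub>0' R T \<longleftrightarrow>
     \<pi>\<^sub>0 \<in> joint_det_policies G \<and> \<pi>\<^sub>0' \<in> joint_det_policies G \<and> (\<forall>i. \<pi>\<^sub>0' i \<noteq> \<pi>\<^sub>0 i) \<and>
     (\<forall>h x \<pi> \<pi>' i. R h x \<pi> \<pi>' i \<in> table_set A i \<times> table_set A i) \<and>
     (\<forall>k. 1 \<le> T k)"

end

theory Submission
  imports Defs
begin

text \<open>
  Within an exploration phase all policies are fixed, so the updates of one decision maker are those
  of temporal-difference learning of the value of a fixed policy in a Markov decision process. The
  recursion is affine and a contraction with factor \<open>\<beta>\<close> in the maximum norm. Its error is split into
  the average of the sampling noise, formed with the same step sizes, and a remainder. The average
  has bounded second moment up to the sum of the squared step sizes still to come, so after many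
  visits it stays small forever with high probability (\<open>noise_exceeds_unlikely\<close>). Meanwhile the
  remainder shrinks towards \<open>\<beta>\<close> times its bound once each pair has used up enough step size
  (\<open>quiet_error_bound\<close>). Since all joint decisions have positive probability during exploration
  and all states communicate, every pair is visited often (\<open>all_visited_often\<close>), and finitely many
  such contractions make the tables as accurate as desired (\<open>tables_converge\<close>). All estimates are
  uniform over the initial state and over bounded initial tables, which covers every reset rule and
  every past.

  The learned values are those against the perturbed policies of the others. The choice of the
  experimentation probabilities makes them differ from the true costs by so little that after an
  accurate phase the acceptance test passes if and only if the candidate is a strict better reply
  (\<open>accepts_iff_improves\<close>). Hence an equilibrium is left only after an inaccurate phase, and from any
  other policy the run follows a strict better reply path to an equilibrium within a bounded number
  of phases with probability bounded below: in each phase the right decision maker moves, the others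
  keep their policies through inertia, and the next candidate is the right one. The probability of
  being outside the equilibria thus satisfies \<open>b (k + M) \<le> (1 - p) * b k + M * d\<close>, where \<open>d\<close> bounds
  the probability of an inaccurate phase and \<open>M\<close> and \<open>p\<close> depend only on the game and the algorithm
  (\<open>miss_drift\<close>). This yields the first two claims, since long phases make \<open>d\<close> small. For the third,
  phases are made so long that the probabilities of inaccuracy are summable: after a late phase that
  starts in equilibrium, the probability of ever leaving it is then small.
\<close>

section \<open>Finite-horizon laws of Markov chains\<close>

text \<open>
  The law after \<open>n\<close> steps of the chain that is in state \<open>s\<close> at time \<open>k\<close>. All probabilities of
  the argument are computed with these finite-horizon laws; the path space enters only through
  the law of two consecutive states.
\<close>

primrec evolve :: "(nat \<Rightarrow> 's \<Rightarrow> 's pmf) \<Rightarrow> nat \<Rightarrow> nat \<Rightarrow> 's \<Rightarrow> 's pmf" where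
  "evolve K k 0 s = return_pmf s"
| "evolve K k (Suc n) s = bind_pmf (K k s) (evolve K (Suc k) n)"

lemma evolve_0_fun: "evolve K k 0 = return_pmf"
  by (simp add: fun_eq_iff)

lemma evolve_1_fun: "evolve K k (Suc 0) = K k"
  by (simp add: fun_eq_iff evolve_0_fun bind_return_pmf')

lemma evolve_add:
  "evolve K k (m + n) s = bind_pmf (evolve K k m s) (evolve K (k + m) n)"
proof (induction m arbitrary: k s)
  case 0
  then show ?case by (simp add: bind_return_pmf)
next
  case (Suc m)
  have "evolve K k (Suc m + n) s = bind_pmf (K k s) (\<lambda>t. evolve K (Suc k) (m + n) t)"
    by (simp add: fun_eq_iff)
  also have "\<dots> = bind_pmf (K k s) (\<lambda>t. bind_pmf (evolve K (Suc k) m t) (evolve K (Suc k + m) n))"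
    by (simp only: Suc.IH)
  finally show ?case
    by (simp add: bind_assoc_pmf)
qed

lemma evolve_Suc':
  "evolve K k (Suc n) s = bind_pmf (evolve K k n s) (K (k + n))"
  using evolve_add[of K k n 1 s] by (simp add: evolve_1_fun del: evolve.simps)

lemma evolve_homogeneous: "evolve (\<lambda>_. K) k n s = evolve (\<lambda>_. K) 0 n s"
proof (induction n arbitrary: k s)
  case (Suc n)
  show ?case
    using Suc[of "Suc k"] Suc[of "Suc 0"] by (simp cong: bind_pmf_cong)
qed simp

lemma evolve_invariant:
  assumes "\<And>k s s'. I s \<Longrightarrow> s' \<in> set_pmf (K k s) \<Longrightarrow> I s'"
    and "I s" and "s' \<in> set_pmf (evolve K k n s)"
  shows "I s'"
  using assms(2,3)
proof (induction n arbitrary: k s)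
  case (Suc n)
  from Suc.prems obtain t where t: "t \<in> set_pmf (K k s)" "s' \<in> set_pmf (evolve K (Suc k) n t)"
    by auto
  show ?case
    by (rule Suc.IH[OF assms(1)[OF Suc.prems(1) t(1)] t(2)])
qed simp

lemma evolve_map:
  assumes inv: "\<And>k s s'. I s \<Longrightarrow> s' \<in> set_pmf (K k s) \<Longrightarrow> I s'"
    and comm: "\<And>k s. I s \<Longrightarrow> map_pmf f (K k s) = K' k (f s)"
    and "I s"
  shows "map_pmf f (evolve K k n s) = evolve K' k n (f s)"
  using assms(3)
proof (induction n arbitrary: k s)
  case (Suc n)
  have "map_pmf f (evolve K k (Suc n) s) =
      bind_pmf (K k s) (\<lambda>t. map_pmf f (evolve K (Suc k) n t))"
    by (simp add: map_bind_pmf)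
  also have "\<dots> = bind_pmf (K k s) (\<lambda>t. evolve K' (Suc k) n (f t))"
    using Suc.IH inv[OF Suc.prems] by (intro bind_pmf_cong refl) blast
  also have "\<dots> = bind_pmf (map_pmf f (K k s)) (evolve K' (Suc k) n)"
    by (simp add: bind_map_pmf)
  finally show ?case
    using comm[OF Suc.prems] by simp
qed simp

lemma prob_bind_pmf:
  "measure_pmf.prob (bind_pmf p f) A = (\<integral>x. measure_pmf.prob (f x) A \<partial>measure_pmf p)"
proof -
  have "emeasure (bind_pmf p f) A = (\<integral>\<^sup>+x. ennreal (measure_pmf.prob (f x) A) \<partial>measure_pmf p)"
    by (simp add: measure_pmf.emeasure_eq_measure[symmetric])
  also have "\<dots> = ennreal (\<integral>x. measure_pmf.prob (f x) A \<partial>measure_pmf p)"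
    by (intro nn_integral_eq_integral measure_pmf.integrable_const_bound[where B=1]) auto
  finally show ?thesis
    by (simp add: measure_pmf.emeasure_eq_measure)
qed

lemma prob_bind_affine:
  assumes "\<And>x. x \<in> set_pmf p \<Longrightarrow> x \<in> B \<Longrightarrow> measure_pmf.prob (f x) A \<le> a" and "0 \<le> a"
    and "\<And>x. x \<in> set_pmf p \<Longrightarrow> x \<notin> B \<Longrightarrow> measure_pmf.prob (f x) A \<le> c" and "0 \<le> c"
  shows "measure_pmf.prob (bind_pmf p f) A \<le> measure_pmf.prob p B * a + c"
proof -
  have int: "integrable (measure_pmf p) (\<lambda>x. indicat_real B x * a)"
    by (intro measure_pmf.integrable_const_bound[where B="\<bar>a\<bar>"]) (auto simp: indicator_def)
  have "measure_pmf.prob (bind_pmf p f) A \<le> (\<integral>x. indicat_real B x * a + c \<partial>measure_pmf p)"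
    unfolding prob_bind_pmf
  proof (rule integral_mono_AE)
    show "AE x in measure_pmf p. measure_pmf.prob (f x) A \<le> indicat_real B x * a + c"
      using assms by (fastforce simp: AE_measure_pmf_iff indicator_def intro: add_increasing2)
    show "integrable (measure_pmf p) (\<lambda>x. indicat_real B x * a + c)"
      by (rule Bochner_Integration.integrable_add[OF int]) simp
  qed (auto intro!: measure_pmf.integrable_const_bound[where B=1])
  also have "\<dots> = measure_pmf.prob p B * a + c"
    by (subst Bochner_Integration.integral_add[OF int]) auto
  finally show ?thesis .
qed

lemma prob_bind_le:
  assumes "\<And>x. x \<in> set_pmf p \<Longrightarrow> x \<notin> B \<Longrightarrow> measure_pmf.prob (f x) A \<le> c" and "0 \<le> c"
  shows "measure_pmf.prob (bind_pmf p f) A \<le> measure_pmf.prob p B + c"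
  using prob_bind_affine[of p B f A 1 c] assms by simp

lemma prob_bind_ge:
  assumes "\<And>x. x \<in> set_pmf p \<Longrightarrow> x \<in> B \<Longrightarrow> c \<le> measure_pmf.prob (f x) A" and "0 \<le> c"
  shows "measure_pmf.prob p B * c \<le> measure_pmf.prob (bind_pmf p f) A"
proof -
  have "measure_pmf.prob p B * c = (\<integral>x. indicat_real B x * c \<partial>measure_pmf p)"
    by simp
  also have "\<dots> \<le> measure_pmf.prob (bind_pmf p f) A"
    unfolding prob_bind_pmf
  proof (rule integral_mono_AE)
    show "AE x in measure_pmf p. indicat_real B x * c \<le> measure_pmf.prob (f x) A"
      using assms by (auto simp: AE_measure_pmf_iff indicator_def)
  qed (auto intro!: measure_pmf.integrable_const_bound[where B=1] integrable_mult_left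
       integrable_real_indicator simp: measure_pmf.emeasure_eq_measure)
  finally show ?thesis .
qed

lemma prob_mono_support:
  assumes "\<And>x. x \<in> set_pmf p \<Longrightarrow> x \<in> A \<Longrightarrow> x \<in> B"
  shows "measure_pmf.prob p A \<le> measure_pmf.prob p B"
  using assms by (intro measure_pmf.finite_measure_mono_AE) (auto simp: AE_measure_pmf_iff)

lemma prob_eq_1_support:
  assumes "set_pmf p \<subseteq> A" shows "measure_pmf.prob p A = 1"
  using assms by (auto simp: measure_pmf.prob_eq_1 AE_measure_pmf_iff)

lemma prob_eq_0_support:
  assumes "set_pmf p \<inter> A = {}" shows "measure_pmf.prob p A = 0"
  using assms by (simp add: measure_pmf_zero_iff)

lemma finite_set_evolve:
  assumes "\<And>k s. I s \<Longrightarrow> finite (set_pmf (K k s))"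
    and "\<And>k s s'. I s \<Longrightarrow> s' \<in> set_pmf (K k s) \<Longrightarrow> I s'" and "I s"
  shows "finite (set_pmf (evolve K k n s))"
  using assms(3)
proof (induction n arbitrary: k s)
  case (Suc n)
  then show ?case using assms(1,2) by auto
qed simp

lemma expectation_bind_finite:
  fixes h :: "'b \<Rightarrow> real"
  assumes "finite (set_pmf p)" and "\<And>x. x \<in> set_pmf p \<Longrightarrow> finite (set_pmf (f x))"
  shows "measure_pmf.expectation (bind_pmf p f) h =
    measure_pmf.expectation p (\<lambda>x. measure_pmf.expectation (f x) h)"
  using pmf_expectation_bind[of "set_pmf p" f p h] assms
  by (simp add: integral_measure_pmf[of "set_pmf p"])

lemma expectation_mono_finite:
  fixes f :: "'a \<Rightarrow> real"
  assumes "finite (set_pmf p)" and "\<And>x. x \<in> set_pmf p \<Longrightarrow> f x \<le> g x"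
  shows "measure_pmf.expectation p f \<le> measure_pmf.expectation p g"
  using assms by (intro integral_mono_AE integrable_measure_pmf_finite) (auto simp: AE_measure_pmf_iff)

text \<open>
  A function \<open>U\<close> that does not increase on average in one step does not do so in \<open>n\<close> steps,
  and Markov's inequality bounds the probability that it has become large. A maximal inequality is the special
  case in which the state remembers that a threshold has been crossed.
\<close>

lemma evolve_supermartingale:
  fixes U :: "'s \<Rightarrow> real"
  assumes fin: "\<And>k s. I s \<Longrightarrow> finite (set_pmf (K k s))"
    and inv: "\<And>k s s'. I s \<Longrightarrow> s' \<in> set_pmf (K k s) \<Longrightarrow> I s'"
    and super: "\<And>k s. I s \<Longrightarrow> measure_pmf.expectation (K k s) U \<le> U s"
    and "I s"
  shows "measure_pmf.expectation (evolve K k n s) U \<le> U s"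
  using assms(4)
proof (induction n arbitrary: k s)
  case (Suc n)
  have "measure_pmf.expectation (evolve K k (Suc n) s) U =
      measure_pmf.expectation (K k s) (\<lambda>t. measure_pmf.expectation (evolve K (Suc k) n t) U)"
    unfolding evolve.simps
  proof (rule expectation_bind_finite[OF fin[OF Suc.prems]])
    fix t assume "t \<in> set_pmf (K k s)"
    then have "I t"
      by (rule inv[OF Suc.prems])
    then show "finite (set_pmf (evolve K (Suc k) n t))"
      by (intro finite_set_evolve[where I=I]) (blast intro: fin inv)+
  qed
  also have "\<dots> \<le> measure_pmf.expectation (K k s) U"
    using Suc fin inv by (intro expectation_mono_finite) auto
  finally show ?case
    using super[OF Suc.prems, of k] by simp
qed simp

lemma evolve_supermartingale_prob:
  fixes U :: "'s \<Rightarrow> real"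
  assumes fin: "\<And>k s. I s \<Longrightarrow> finite (set_pmf (K k s))"
    and inv: "\<And>k s s'. I s \<Longrightarrow> s' \<in> set_pmf (K k s) \<Longrightarrow> I s'"
    and super: "\<And>k s. I s \<Longrightarrow> measure_pmf.expectation (K k s) U \<le> U s"
    and s: "I s"
    and ge: "\<And>s. I s \<Longrightarrow> 0 \<le> U s" "\<And>s. I s \<Longrightarrow> s \<in> A \<Longrightarrow> 1 \<le> U s"
  shows "measure_pmf.prob (evolve K k n s) A \<le> U s"
proof -
  have I: "I s'" if "s' \<in> set_pmf (evolve K k n s)" for s'
    using s that by (intro evolve_invariant[where I=I and s=s and s'=s']) (blast intro: inv)+
  have fin': "finite (set_pmf (evolve K k n s))"
    using s by (intro finite_set_evolve[where I=I]) (blast intro: fin inv)+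
  have "measure_pmf.prob (evolve K k n s) A =
      measure_pmf.expectation (evolve K k n s) (indicat_real A)"
    by simp
  also have "\<dots> \<le> measure_pmf.expectation (evolve K k n s) U"
    using I ge by (intro expectation_mono_finite fin') (auto simp: indicator_def)
  also have "\<dots> \<le> U s"
    using s by (intro evolve_supermartingale[where I=I]) (blast intro: fin inv super)+
  finally show ?thesis .
qed


section \<open>Marginals of the chain measure\<close>

definition marginal :: "'s pmf \<Rightarrow> (nat \<Rightarrow> 's \<Rightarrow> 's pmf) \<Rightarrow> nat \<Rightarrow> 's pmf" where
  "marginal p K n = bind_pmf p (evolve K 0 n)"

lemma marginal_0 [simp]: "marginal p K 0 = p"
  by (simp add: marginal_def evolve_0_fun bind_return_pmf')

lemma marginal_add: "marginal p K (m + n) = bind_pmf (marginal p K m) (evolve K m n)"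
  by (simp add: marginal_def evolve_add bind_assoc_pmf fun_eq_iff cong: bind_pmf_cong)

lemma marginal_Suc [simp]: "marginal p K (Suc n) = bind_pmf (marginal p K n) (K n)"
  using marginal_add[of p K n 1] by (simp add: evolve_1_fun del: evolve.simps)

lemma sets_chain_measure [measurable_cong]:
  "sets (chain_measure p K) = sets (PiM UNIV (\<lambda>_. count_space UNIV))"
proof -
  interpret Ionescu_Tulcea "chain_kernel p K" "\<lambda>_. count_space UNIV"
    by (rule Ionescu_Tulcea_chain_kernel)
  show ?thesis
    by (simp add: chain_measure_def PF.sets_lim)
qed

lemma space_chain_measure [simp]: "space (chain_measure p K) = UNIV"
  using sets_eq_imp_space_eq[OF sets_chain_measure[of p K]] by (simp add: space_PiM)

lemma measurable_chain_component [measurable]: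
  "(\<lambda>\<omega>. \<omega> n) \<in> measurable (chain_measure p K) (count_space UNIV)"
  by (simp add: measurable_cong_sets[OF sets_chain_measure refl])

text \<open>
  The event is a rectangle because the state space may be uncountable, in which case the pair of
  two coordinates is not measurable for the discrete \<open>\<sigma>\<close>-algebra.
\<close>

lemma emeasure_chain_two:
  "emeasure (chain_measure p K) {\<omega>. \<omega> n \<in> A \<and> \<omega> (Suc n) \<in> B} =
    (\<integral>\<^sup>+s. indicator A s * emeasure (K n s) B \<partial>marginal p K n)"
proof -
  interpret Ionescu_Tulcea "chain_kernel p K" "\<lambda>_. count_space UNIV"
    by (rule Ionescu_Tulcea_chain_kernel)
  let ?P = "\<lambda>n::nat. PiM {0..<n} (\<lambda>_. count_space (UNIV :: 'a set))"
  let ?u = "\<lambda>_. undefined"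
  have u: "?u \<in> space (?P 0)"
    by (auto simp: space_PiM PiE_iff)
  have comp: "(\<lambda>\<omega>. g (\<omega> m)) \<in> borel_measurable (?P n)" if "m < n" for m n
    and g :: "'a \<Rightarrow> ennreal"
    using that by (intro measurable_compose[OF measurable_component_singleton]) auto
  have one: "(\<integral>\<^sup>+\<omega>. g (\<omega> m) \<partial>C 0 (Suc m) ?u) = (\<integral>\<^sup>+s. g s \<partial>marginal p K m)" for m
    and g :: "'a \<Rightarrow> ennreal"
  proof (induction m arbitrary: g)
    case 0
    have "C 0 (Suc 0) ?u = eP 0 ?u"
      using bind_return[OF measurable_eP[of 0] u] by simp
    moreover have "(\<integral>\<^sup>+\<omega>. g (\<omega> 0) \<partial>eP 0 ?u) = (\<integral>\<^sup>+s. g s \<partial>p)"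
      using comp[of 0 "Suc 0" g] by (subst nn_integral_eP[OF u]) (auto simp: chain_kernel_def)
    ultimately show ?case
      by (simp del: C.simps)
  next
    case (Suc m)
    have "(\<integral>\<^sup>+\<omega>. g (\<omega> (Suc m)) \<partial>C 0 (Suc (Suc m)) ?u) =
        (\<integral>\<^sup>+\<omega>. \<integral>\<^sup>+\<omega>'. g (\<omega>' (Suc m)) \<partial>eP (Suc m) \<omega> \<partial>C 0 (Suc m) ?u)"
      using u comp[of "Suc m" "Suc (Suc m)" g] measurable_eP[of "Suc m"] sets_C[OF u, of "Suc m"]
      unfolding C.simps(2)[of 0 "Suc m"]
      by (subst nn_integral_bind[where B="?P (Suc (Suc m))"])
         (auto simp: measurable_cong_sets[OF sets_C[OF u, of "Suc m"]] simp del: C.simps)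
    also have "\<dots> = (\<integral>\<^sup>+\<omega>. (\<integral>\<^sup>+s. g s \<partial>K m (\<omega> m)) \<partial>C 0 (Suc m) ?u)"
      using comp[of "Suc m" "Suc (Suc m)" g]
      by (intro nn_integral_cong)
         (auto simp: nn_integral_eP space_C[OF u] chain_kernel_def simp del: C.simps)
    also have "\<dots> = (\<integral>\<^sup>+s. (\<integral>\<^sup>+s'. g s' \<partial>K m s) \<partial>marginal p K m)"
      by (rule Suc.IH)
    finally show ?case
      by simp
  qed
  define X where "X = {\<omega> \<in> space (?P (Suc (Suc n))). \<omega> n \<in> A \<and> \<omega> (Suc n) \<in> B}"
  have cn: "(\<lambda>\<omega>. \<omega> m) \<in> measurable (?P (Suc (Suc n))) (count_space UNIV)" if "m \<le> Suc n" for m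
    using that by (intro measurable_component_singleton) auto
  have "X = ((\<lambda>\<omega>. \<omega> n) -` A \<inter> space (?P (Suc (Suc n)))) \<inter>
      ((\<lambda>\<omega>. \<omega> (Suc n)) -` B \<inter> space (?P (Suc (Suc n))))"
    by (auto simp: X_def)
  then have X: "X \<in> sets (?P (Suc (Suc n)))"
    using measurable_sets[OF cn[of n], of A] measurable_sets[OF cn[of "Suc n"], of B] by auto
  have emb: "{\<omega>. \<omega> n \<in> A \<and> \<omega> (Suc n) \<in> B} = PF.emb UNIV {0..<Suc (Suc n)} X"
    by (auto simp: prod_emb_def X_def space_PiM)
  have "emeasure (chain_measure p K) {\<omega>. \<omega> n \<in> A \<and> \<omega> (Suc n) \<in> B} =
      emeasure (C 0 (Suc (Suc n)) ?u) X"
    unfolding emb chain_measure_def using X sets.sets_into_space[OF X]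
    by (subst lim) (auto simp: emeasure_CI[of _ "Suc (Suc n)"] prod_emb_id space_PiM simp del: C.simps)
  also have "\<dots> = (\<integral>\<^sup>+\<omega>. indicator X \<omega> \<partial>C 0 (Suc (Suc n)) ?u)"
    using X sets_C[OF u, of "Suc (Suc n)"] by (simp del: C.simps)
  also have "\<dots> = (\<integral>\<^sup>+\<omega>. \<integral>\<^sup>+\<omega>'. indicator X \<omega>' \<partial>eP (Suc n) \<omega> \<partial>C 0 (Suc n) ?u)"
    using u measurable_eP[of "Suc n"] sets_C[OF u, of "Suc n"] X
    unfolding C.simps(2)[of 0 "Suc n"]
    by (subst nn_integral_bind[where B="?P (Suc (Suc n))"])
       (auto simp: measurable_cong_sets[OF sets_C[OF u, of "Suc n"]] simp del: C.simps)
  also have "\<dots> = (\<integral>\<^sup>+\<omega>. indicator A (\<omega> n) * emeasure (K n (\<omega> n)) B \<partial>C 0 (Suc n) ?u)"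
  proof (rule nn_integral_cong)
    fix \<omega> assume "\<omega> \<in> space (C 0 (Suc n) ?u)"
    then have \<omega>: "\<omega> \<in> space (?P (Suc n))"
      using space_C[OF u, of "Suc n"] by simp
    have "(\<integral>\<^sup>+\<omega>'. indicator X \<omega>' \<partial>eP (Suc n) \<omega>) =
        (\<integral>\<^sup>+s. indicator X (fun_upd \<omega> (Suc n) s) \<partial>K n (\<omega> n))"
      using X \<omega> by (subst nn_integral_eP) (auto simp: chain_kernel_def)
    also have "\<dots> = (\<integral>\<^sup>+s. indicator A (\<omega> n) * indicator B s \<partial>K n (\<omega> n))"
      using \<omega> by (intro nn_integral_cong)
        (auto simp: X_def indicator_def space_PiM PiE_iff extensional_def)
    also have "\<dots> = indicator A (\<omega> n) * emeasure (K n (\<omega> n)) B"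
      by (simp add: nn_integral_cmult)
    finally show "(\<integral>\<^sup>+\<omega>'. indicator X \<omega>' \<partial>eP (Suc n) \<omega>) =
        indicator A (\<omega> n) * emeasure (K n (\<omega> n)) B" .
  qed
  also have "\<dots> = (\<integral>\<^sup>+s. indicator A s * emeasure (K n s) B \<partial>marginal p K n)"
    by (rule one)
  finally show ?thesis .
qed

lemma distr_chain_component:
  "distr (chain_measure p K) (count_space UNIV) (\<lambda>\<omega>. \<omega> n) = measure_pmf (marginal p K n)"
proof (rule measure_eqI)
  fix A
  have "emeasure (distr (chain_measure p K) (count_space UNIV) (\<lambda>\<omega>. \<omega> n)) A =
      emeasure (chain_measure p K) {\<omega>. \<omega> n \<in> A \<and> \<omega> (Suc n) \<in> UNIV}"
    by (subst emeasure_distr) (auto intro!: arg_cong2[where f=emeasure])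
  also have "\<dots> = emeasure (marginal p K n) A"
    unfolding emeasure_chain_two by simp
  finally show "emeasure (distr (chain_measure p K) (count_space UNIV) (\<lambda>\<omega>. \<omega> n)) A =
      emeasure (marginal p K n) A" .
qed simp

lemma prob_chain_component:
  "measure (chain_measure p K) {\<omega>. \<omega> n \<in> A} = measure_pmf.prob (marginal p K n) A"
  unfolding distr_chain_component[symmetric] by (subst measure_distr) (auto simp: vimage_def)

lemma prob_chain_two_le:
  assumes "\<And>s. s \<in> set_pmf (marginal p K n) \<Longrightarrow> s \<in> A \<Longrightarrow> measure_pmf.prob (K n s) B \<le> c"
    and "0 \<le> c"
  shows "measure (chain_measure p K) {\<omega>. \<omega> n \<in> A \<and> \<omega> (Suc n) \<in> B} \<le> c"
proof -
  have "emeasure (chain_measure p K) {\<omega>. \<omega> n \<in> A \<and> \<omega> (Suc n) \<in> B} \<le>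
      (\<integral>\<^sup>+s. ennreal c \<partial>marginal p K n)"
    unfolding emeasure_chain_two using assms
    by (intro nn_integral_mono_AE)
       (auto simp: AE_measure_pmf_iff indicator_def measure_pmf.emeasure_eq_measure)
  also have "\<dots> = ennreal c"
    by simp
  finally show ?thesis
    using assms(2) by (simp add: measure_def enn2real_leI)
qed

section \<open>Discounted costs and Q-factors\<close>

lemma expectation_finite_UNIV:
  fixes h :: "'x::finite \<Rightarrow> real"
  shows "measure_pmf.expectation p h = (\<Sum>x\<in>UNIV. pmf p x * h x)"
  by (subst integral_measure_pmf[of UNIV]) auto

lemma finite_joint_actions:
  "discounted_game G \<Longrightarrow> finite (joint_actions (G :: ('i::finite, 'x::finite, 'u) game))"
  using finite_PiE[of UNIV "actions G"]
  by (simp add: joint_actions_def discounted_game_def PiE_UNIV_domain Pi_def)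

lemma set_joint_decision:
  assumes "\<sigma> \<in> joint_rand_policies G"
  shows "set_pmf (joint_decision \<sigma> x) \<subseteq> joint_actions (G :: ('i::finite, 'x, 'u) game)"
  using assms set_Pi_pmf_subset'[of UNIV undefined "\<lambda>i. \<sigma> i x"]
  by (fastforce simp: joint_decision_def joint_actions_def joint_rand_policies_def rand_policies_def
      PiE_dflt_def)

lemma joint_decision_split:
  "joint_decision \<sigma> x = bind_pmf (\<sigma> i x) (\<lambda>a. map_pmf (\<lambda>v. v(i := a))
     (Pi_pmf (UNIV - {i}) undefined (\<lambda>j. \<sigma> j x)))"
proof -
  have "joint_decision \<sigma> x = Pi_pmf (insert i (UNIV - {i})) undefined (\<lambda>j. \<sigma> j x)"
    by (simp add: joint_decision_def insert_absorb)
  also have "\<dots> = bind_pmf (\<sigma> i x) (\<lambda>a. map_pmf (\<lambda>v. v(i := a))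
     (Pi_pmf (UNIV - {i}) undefined (\<lambda>j. \<sigma> j x)))"
    by (subst Pi_pmf_insert') (auto simp: map_pmf_def)
  finally show ?thesis .
qed

lemma finite_set_Pi_pmf:
  assumes "finite A" "\<And>j. j \<in> A \<Longrightarrow> finite (set_pmf (p j))"
  shows "finite (set_pmf (Pi_pmf A d p))"
  by (rule finite_subset[OF set_Pi_pmf_subset'[OF assms(1)]]) (use assms in auto)

lemma embed_policy_in_rand: "p \<in> det_policies G i \<Longrightarrow> embed_policy p \<in> rand_policies G i"
  by (auto simp: det_policies_def rand_policies_def embed_policy_def)

lemma embed_joint_in_rand: "\<pi> \<in> joint_det_policies G \<Longrightarrow> embed_joint \<pi> \<in> joint_rand_policies G"
  by (auto simp: joint_det_policies_def joint_rand_policies_def embed_joint_def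
      intro: embed_policy_in_rand)

lemma joint_rand_upd:
  "\<sigma> \<in> joint_rand_policies G \<Longrightarrow> p \<in> det_policies G i \<Longrightarrow>
    \<sigma>(i := embed_policy p) \<in> joint_rand_policies G"
  by (auto simp: joint_rand_policies_def intro: embed_policy_in_rand)

lemma cost_bounded:
  assumes "discounted_game (G :: ('i::finite, 'x::finite, 'u) game)"
  obtains M where "0 \<le> M" "\<And>x u. u \<in> joint_actions G \<Longrightarrow> \<bar>cost G i x u\<bar> \<le> M"
proof
  let ?S = "(\<lambda>(x, u). \<bar>cost G i x u\<bar>) ` (UNIV \<times> joint_actions G)"
  have fin: "finite ?S"
    using finite_joint_actions[OF assms] by auto
  show "0 \<le> Max (insert 0 ?S)"
    using fin by (intro Max_ge) auto
  show "\<bar>cost G i x u\<bar> \<le> Max (insert 0 ?S)" if "u \<in> joint_actions G" for x u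
    using fin that by (intro Max_ge) auto
qed

definition state_step :: "('i::finite, 'x, 'u) game \<Rightarrow> ('i \<Rightarrow> 'x \<Rightarrow> 'u pmf) \<Rightarrow> 'x \<Rightarrow> 'x pmf" where
  "state_step G \<sigma> x = bind_pmf (joint_decision \<sigma> x) (transition G x)"

definition mean_cost ::
  "('i::finite, 'x, 'u) game \<Rightarrow> 'i \<Rightarrow> ('i \<Rightarrow> 'x \<Rightarrow> 'u pmf) \<Rightarrow> nat \<Rightarrow> 'x \<Rightarrow> real" where
  "mean_cost G i \<sigma> t x = measure_pmf.expectation (evolve (\<lambda>_. state_step G \<sigma>) 0 t x)
     (\<lambda>y. measure_pmf.expectation (joint_decision \<sigma> y) (cost G i y))"

lemma trajectory_marginal:
  "marginal (map_pmf (Pair x) (joint_decision \<sigma> x))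
     (\<lambda>_ (y, u). bind_pmf (transition G y u) (\<lambda>y. map_pmf (Pair y) (joint_decision \<sigma> y))) t =
   bind_pmf (evolve (\<lambda>_. state_step G \<sigma>) 0 t x) (\<lambda>y. map_pmf (Pair y) (joint_decision \<sigma> y))"
proof (induction t)
  case (Suc t)
  have step: "bind_pmf (map_pmf (Pair y) (joint_decision \<sigma> y))
      (\<lambda>(y, u). bind_pmf (transition G y u) d) = bind_pmf (state_step G \<sigma> y) d" for y d
    by (simp add: bind_map_pmf bind_assoc_pmf state_step_def)
  show ?case
    unfolding evolve_Suc' marginal_Suc Suc.IH by (simp add: bind_assoc_pmf step)
qed (simp add: bind_return_pmf)

lemma total_cost_suminf:
  assumes G: "discounted_game (G :: ('i::finite, 'x::finite, 'u) game)"
    and \<sigma>: "\<sigma> \<in> joint_rand_policies G"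
  shows "(\<lambda>t. discount G i ^ t * mean_cost G i \<sigma> t x) sums total_cost G i \<sigma> x"
proof -
  obtain M where M: "0 \<le> M" "\<And>x u. u \<in> joint_actions G \<Longrightarrow> \<bar>cost G i x u\<bar> \<le> M"
    using cost_bounded[OF G] by blast
  have \<beta>: "0 \<le> discount G i" "discount G i < 1"
    using G by (auto simp: discounted_game_def less_imp_le)
  define decide where "decide y = map_pmf (Pair y) (joint_decision \<sigma> y)" for y
  define K where "K = (\<lambda>(_::nat) (y, u). bind_pmf (transition G y u) decide)"
  define N where "N = chain_measure (decide x) K"
  define c where "c = (\<lambda>(y, u). cost G i y u)"
  let ?m = "marginal (decide x) K"
  have marg: "?m t = bind_pmf (evolve (\<lambda>_. state_step G \<sigma>) 0 t x) decide" for t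
    using trajectory_marginal[of x \<sigma> G t] by (simp add: decide_def[abs_def] K_def)
  interpret N: prob_space N
    unfolding N_def by (rule prob_space_chain_measure)
  have meas [measurable]: "(\<lambda>\<omega>. \<omega> t) \<in> measurable N (count_space UNIV)" for t
    unfolding N_def by simp
  have distr: "distr N (count_space UNIV) (\<lambda>\<omega>. \<omega> t) = measure_pmf (?m t)" for t
    unfolding N_def by (rule distr_chain_component)
  \<comment> \<open>The cost may be unbounded outside the joint decisions, which have probability zero.\<close>
  have ae_marg: "AE y in measure_pmf (?m t). \<bar>c y\<bar> \<le> M" for t
    unfolding marg using set_joint_decision[OF \<sigma>] M(2)
    by (auto simp: AE_measure_pmf_iff c_def decide_def subset_eq)
  have ae: "AE \<omega> in N. \<bar>c (\<omega> t)\<bar> \<le> M" for t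
    using ae_marg[of t] unfolding distr[symmetric] by (rule AE_distrD[OF meas])
  have cmeas [measurable]: "(\<lambda>\<omega>. c (\<omega> t)) \<in> borel_measurable N" for t
    by (rule measurable_compose[OF meas]) simp
  let ?f = "\<lambda>t \<omega>. discount G i ^ t * c (\<omega> t)"
  have int: "integrable N (?f t)" for t
    using ae by (intro integrable_mult_right N.integrable_const_bound[where B=M]) auto
  have geo: "summable (\<lambda>t. discount G i ^ t * M)"
    using \<beta> by (intro summable_mult2 summable_geometric) auto
  have bound: "norm (?f t \<omega>) \<le> discount G i ^ t * M" if "\<bar>c (\<omega> t)\<bar> \<le> M" for t \<omega>
    using that \<beta> by (simp add: abs_mult mult_left_mono)
  have sumAE: "AE \<omega> in N. summable (\<lambda>t. norm (?f t \<omega>))"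
    using AE_all_countable[THEN iffD2, OF allI, OF ae]
  proof (eventually_elim)
    fix \<omega> assume "\<forall>t::nat. \<bar>c (\<omega> t)\<bar> \<le> M"
    then show "summable (\<lambda>t. norm (?f t \<omega>))"
      using bound by (intro summable_comparison_test'[OF geo, of 0]) simp
  qed
  have sumint: "summable (\<lambda>t. \<integral>\<omega>. norm (?f t \<omega>) \<partial>N)"
  proof (rule summable_comparison_test'[OF geo, of 0])
    fix t
    have "(\<integral>\<omega>. norm (?f t \<omega>) \<partial>N) \<le> (\<integral>\<omega>. discount G i ^ t * M \<partial>N)"
    proof (rule integral_mono_AE)
      show "AE \<omega> in N. norm (?f t \<omega>) \<le> discount G i ^ t * M"
        using ae[of t] by eventually_elim (rule bound)
    qed (use int[of t] in auto)
    then show "norm (\<integral>\<omega>. norm (?f t \<omega>) \<partial>N) \<le> discount G i ^ t * M"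
      by (simp add: N.prob_space)
  qed
  have "(\<lambda>t. \<integral>\<omega>. ?f t \<omega> \<partial>N) sums (\<integral>\<omega>. (\<Sum>t. ?f t \<omega>) \<partial>N)"
    by (rule sums_integral[OF int sumAE sumint])
  moreover have "(\<integral>\<omega>. ?f t \<omega> \<partial>N) = discount G i ^ t * mean_cost G i \<sigma> t x" for t
  proof -
    have "(\<integral>\<omega>. c (\<omega> t) \<partial>N) = measure_pmf.expectation (?m t) c"
      unfolding distr[symmetric] by (subst integral_distr) auto
    also have "\<dots> = mean_cost G i \<sigma> t x"
      unfolding marg mean_cost_def
      using set_joint_decision[OF \<sigma>] finite_joint_actions[OF G]
      by (subst expectation_bind_finite)
         (auto simp: decide_def c_def intro: finite_subset)
    finally show ?thesis by simp
  qed
  moreover have "total_cost G i \<sigma> x = (\<integral>\<omega>. (\<Sum>t. ?f t \<omega>) \<partial>N)"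
    by (simp add: total_cost_def trajectory_measure_def N_def K_def decide_def[abs_def] c_def
        case_prod_unfold Let_def)
  ultimately show ?thesis
    by (simp only:)
qed

lemma mean_cost_Suc:
  fixes G :: "('i::finite, 'x::finite, 'u) game"
  shows "mean_cost G i \<sigma> (Suc t) x =
    measure_pmf.expectation (state_step G \<sigma> x) (mean_cost G i \<sigma> t)"
  unfolding mean_cost_def
  by (simp add: expectation_bind_finite evolve_homogeneous[of _ "Suc 0"])

text \<open>Splitting off the first stage of the discounted sum.\<close>

lemma total_cost_bellman:
  assumes G: "discounted_game (G :: ('i::finite, 'x::finite, 'u) game)"
    and \<sigma>: "\<sigma> \<in> joint_rand_policies G"
  shows "total_cost G i \<sigma> x = measure_pmf.expectation (joint_decision \<sigma> x)
    (\<lambda>u. cost G i x u + discount G i *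
      (\<Sum>x'\<in>UNIV. pmf (transition G x u) x' * total_cost G i \<sigma> x'))"
proof -
  let ?b = "discount G i"
  note sums = total_cost_suminf[OF G \<sigma>, of i]
  have fin: "finite (set_pmf (joint_decision \<sigma> x))"
    using set_joint_decision[OF \<sigma>] finite_joint_actions[OF G] by (rule finite_subset)
  have "(\<lambda>t. \<Sum>x'\<in>UNIV. pmf (state_step G \<sigma> x) x' * (?b ^ t * mean_cost G i \<sigma> t x')) sums
      (\<Sum>x'\<in>UNIV. pmf (state_step G \<sigma> x) x' * total_cost G i \<sigma> x')"
    by (intro sums_sum sums_mult sums)
  then have "(\<lambda>t. ?b ^ t * mean_cost G i \<sigma> (Suc t) x) sums
      measure_pmf.expectation (state_step G \<sigma> x) (total_cost G i \<sigma>)"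
    by (simp add: mean_cost_Suc expectation_finite_UNIV sum_distrib_left mult_ac)
  from sums_mult[OF this, of ?b]
  have "(\<lambda>t. ?b ^ Suc t * mean_cost G i \<sigma> (Suc t) x) sums
      (?b * measure_pmf.expectation (state_step G \<sigma> x) (total_cost G i \<sigma>))"
    by (simp add: mult_ac)
  then have "(\<lambda>t. ?b ^ t * mean_cost G i \<sigma> t x) sums
      (?b * measure_pmf.expectation (state_step G \<sigma> x) (total_cost G i \<sigma>) + mean_cost G i \<sigma> 0 x)"
    using sums_Suc[of "\<lambda>t. ?b ^ t * mean_cost G i \<sigma> t x"] by simp
  then have "total_cost G i \<sigma> x =
      ?b * measure_pmf.expectation (state_step G \<sigma> x) (total_cost G i \<sigma>) + mean_cost G i \<sigma> 0 x"
    using sums[of x] by (rule sums_unique2[rotated])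
  also have "\<dots> = measure_pmf.expectation (joint_decision \<sigma> x) (\<lambda>u. cost G i x u + ?b *
      (\<Sum>x'\<in>UNIV. pmf (transition G x u) x' * total_cost G i \<sigma> x'))"
    unfolding state_step_def mean_cost_def using fin
    by (subst expectation_bind_finite)
       (auto simp: expectation_finite_UNIV integrable_measure_pmf_finite)
  finally show ?thesis .
qed

definition q_backup ::
  "('i::finite, 'x::finite, 'u) game \<Rightarrow> 'i \<Rightarrow> ('x \<Rightarrow> 'u) \<Rightarrow> ('i \<Rightarrow> 'x \<Rightarrow> 'u pmf)
     \<Rightarrow> ('x \<Rightarrow> 'u \<Rightarrow> real) \<Rightarrow> 'x \<Rightarrow> 'u \<Rightarrow> real" where
  "q_backup G i p \<sigma> q x u =
     measure_pmf.expectation (Pi_pmf (UNIV - {i}) undefined (\<lambda>j. \<sigma> j x))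
       (\<lambda>v. cost G i x (v(i := u)) +
         discount G i * (\<Sum>x'\<in>UNIV. pmf (transition G x (v(i := u))) x' * q x' (p x')))"

lemma q_backup_contraction:
  assumes G: "discounted_game (G :: ('i::finite, 'x::finite, 'u) game)"
    and \<sigma>: "\<sigma> \<in> joint_rand_policies G"
    and le: "\<And>x. \<bar>q x (p x) - q' x (p x)\<bar> \<le> m"
  shows "\<bar>q_backup G i p \<sigma> q x u - q_backup G i p \<sigma> q' x u\<bar> \<le> discount G i * m"
proof -
  let ?M = "Pi_pmf (UNIV - {i}) undefined (\<lambda>j. \<sigma> j x)"
  have \<beta>: "0 \<le> discount G i"
    using G by (auto simp: discounted_game_def less_imp_le)
  have fin: "finite (set_pmf ?M)"
  proof (rule finite_set_Pi_pmf)
    show "finite (set_pmf (\<sigma> j x))" for j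
      using \<sigma> G finite_subset[of "set_pmf (\<sigma> j x)" "actions G j"]
      by (auto simp: joint_rand_policies_def rand_policies_def discounted_game_def)
  qed simp
  have "\<bar>q_backup G i p \<sigma> q x u - q_backup G i p \<sigma> q' x u\<bar> =
      \<bar>measure_pmf.expectation ?M (\<lambda>v. discount G i *
        (\<Sum>x'\<in>UNIV. pmf (transition G x (v(i := u))) x' * (q x' (p x') - q' x' (p x'))))\<bar>"
    unfolding q_backup_def using fin
    by (subst Bochner_Integration.integral_diff[symmetric])
       (auto simp: integrable_measure_pmf_finite algebra_simps sum_subtractf)
  also have "\<dots> \<le> measure_pmf.expectation ?M (\<lambda>v. \<bar>discount G i *
        (\<Sum>x'\<in>UNIV. pmf (transition G x (v(i := u))) x' * (q x' (p x') - q' x' (p x')))\<bar>)"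
    by (rule integral_abs_bound)
  also have "\<dots> \<le> measure_pmf.expectation ?M (\<lambda>v. discount G i * m)"
  proof (rule expectation_mono_finite[OF fin])
    fix v
    let ?t = "transition G x (v(i := u))"
    have "\<bar>\<Sum>x'\<in>UNIV. pmf ?t x' * (q x' (p x') - q' x' (p x'))\<bar> \<le> (\<Sum>x'\<in>UNIV. pmf ?t x' * m)"
      using le by (intro order_trans[OF sum_abs] sum_mono) (auto simp: abs_mult intro: mult_left_mono)
    also have "\<dots> = m"
      by (simp add: sum_distrib_right[symmetric] sum_pmf_eq_1)
    finally show "\<bar>discount G i *
        (\<Sum>x'\<in>UNIV. pmf ?t x' * (q x' (p x') - q' x' (p x')))\<bar> \<le> discount G i * m"
      using \<beta> by (simp add: abs_mult mult_left_mono)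
  qed
  finally show ?thesis by simp
qed

text \<open>
  The backup of the discounted cost \<open>J\<close> of the policy solves the equation, because the Bellman
  equation for \<open>J\<close> says that its value at \<open>(x, p x)\<close> is \<open>J x\<close> again. It is the only solution because
  the backup is a contraction. The value at \<open>(x, p x)\<close> is what relates the learned tables to better
  replies.
\<close>

lemma q_factor:
  assumes G: "discounted_game (G :: ('i::finite, 'x::finite, 'u) game)"
    and \<sigma>: "\<sigma> \<in> joint_rand_policies G" and p: "p \<in> det_policies G i"
  shows q_factor_in_tables: "q_factor G i p \<sigma> \<in> tables G i"
    and q_factor_backup:
      "\<And>x u. u \<in> actions G i \<Longrightarrow> q_factor G i p \<sigma> x u = q_backup G i p \<sigma> (q_factor G i p \<sigma>) x u"
    and q_factor_value: "\<And>x. q_factor G i p \<sigma> x (p x) = total_cost G i (\<sigma>(i := embed_policy p)) x"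
proof -
  let ?sol = "\<lambda>q. q \<in> tables G i \<and> (\<forall>x. \<forall>u\<in>actions G i. q x u = q_backup G i p \<sigma> q x u)"
  let ?J = "total_cost G i (\<sigma>(i := embed_policy p))"
  have act: "finite (actions G i)" "actions G i \<noteq> {}"
    and \<beta>: "0 \<le> discount G i" "discount G i < 1"
    using G by (auto simp: discounted_game_def less_imp_le)
  have px: "p x \<in> actions G i" for x
    using p by (auto simp: det_policies_def)
  define q where "q x u = (if u \<in> actions G i then q_backup G i p \<sigma> (\<lambda>x _. ?J x) x u else 0)" for x u
  have qJ: "q x (p x) = ?J x" for x
  proof -
    have "joint_decision (\<sigma>(i := embed_policy p)) x =
        map_pmf (\<lambda>v. v(i := p x)) (Pi_pmf (UNIV - {i}) undefined (\<lambda>j. (\<sigma>(i := embed_policy p)) j x))"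
      unfolding joint_decision_split[of _ _ i] by (simp add: embed_policy_def bind_return_pmf)
    also have "\<dots> = map_pmf (\<lambda>v. v(i := p x)) (Pi_pmf (UNIV - {i}) undefined (\<lambda>j. \<sigma> j x))"
      by (intro arg_cong[where f="map_pmf _"] Pi_pmf_cong) auto
    finally show ?thesis
      using total_cost_bellman[OF G joint_rand_upd[OF \<sigma> p], of i x] px[of x]
      by (simp add: q_def q_backup_def)
  qed
  have sol: "?sol q"
    unfolding q_backup_def qJ by (auto simp: q_def tables_def q_backup_def)
  have unique: "r = q" if r: "?sol r" for r
  proof -
    let ?D = "(\<lambda>(x, u). \<bar>r x u - q x u\<bar>) ` (UNIV \<times> actions G i)"
    have fin: "finite ?D" "?D \<noteq> {}"
      using act by auto
    have le: "\<bar>r x u - q x u\<bar> \<le> Max ?D" if "u \<in> actions G i" for x u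
      using fin that by (intro Max_ge) auto
    have "\<bar>r x u - q x u\<bar> \<le> discount G i * Max ?D" if u: "u \<in> actions G i" for x u
    proof -
      have "r x u = q_backup G i p \<sigma> r x u" "q x u = q_backup G i p \<sigma> q x u"
        using r sol u by blast+
      then show ?thesis
        using q_backup_contraction[OF G \<sigma>, of r p q "Max ?D" i x u] le[OF px] by simp
    qed
    then have "Max ?D \<le> discount G i * Max ?D"
      using fin by (subst Max_le_iff) auto
    then have "Max ?D * (1 - discount G i) \<le> 0"
      by (simp add: algebra_simps)
    then have "Max ?D \<le> 0"
      using \<beta> by (simp add: mult_le_0_iff)
    then have "r x u = q x u" if "u \<in> actions G i" for x u
      using le[OF that, of x] by simp
    moreover have "r x u = q x u" if "u \<notin> actions G i" for x u
      using that r sol by (auto simp: tables_def)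
    ultimately show "r = q" by blast
  qed
  have "q_factor G i p \<sigma> = (THE q. ?sol q)"
    by (simp add: q_factor_def q_backup_def)
  also have "\<dots> = q"
    using sol unique by (rule the_equality)
  finally have eq: "q_factor G i p \<sigma> = q" .
  show "q_factor G i p \<sigma> \<in> tables G i"
    and "\<And>x u. u \<in> actions G i \<Longrightarrow> q_factor G i p \<sigma> x u = q_backup G i p \<sigma> (q_factor G i p \<sigma>) x u"
    and "\<And>x. q_factor G i p \<sigma> x (p x) = ?J x"
    unfolding eq using sol qJ by blast+
qed

section \<open>Temporal-difference learning for one decision maker\<close>

definition mix_at :: "('x \<Rightarrow> 'u \<Rightarrow> real) \<Rightarrow> 'x \<Rightarrow> 'u \<Rightarrow> real \<Rightarrow> real \<Rightarrow> 'x \<Rightarrow> 'u \<Rightarrow> real" where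
  "mix_at f x a t v = f(x := (f x)(a := (1 - t) * f x a + t * v))"

lemma mix_at_same [simp]: "mix_at f x a t v x a = (1 - t) * f x a + t * v"
  by (simp add: mix_at_def)

lemma mix_at_other: "(y, b) \<noteq> (x, a) \<Longrightarrow> mix_at f x a t v y b = f y b"
  by (auto simp: mix_at_def)

lemma convex_abs_le:
  fixes t u v m :: real
  assumes "0 \<le> t" "t \<le> 1" "\<bar>u\<bar> \<le> m" "\<bar>v\<bar> \<le> m"
  shows "\<bar>(1 - t) * u + t * v\<bar> \<le> m"
proof -
  have "\<bar>(1 - t) * u + t * v\<bar> \<le> (1 - t) * \<bar>u\<bar> + t * \<bar>v\<bar>"
    using assms by (intro order_trans[OF abs_triangle_ineq]) (simp add: abs_mult)
  also have "\<dots> \<le> (1 - t) * m + t * m"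
    using assms by (intro add_mono mult_left_mono) auto
  finally show ?thesis by (simp add: algebra_simps)
qed

text \<open>
  One decision maker facing others whose policies are fixed: it draws its decision at \<open>x\<close> from \<open>\<mu> x\<close>
  and then observes its own cost and the next state, distributed according to \<open>\<kappa>\<close>. It learns the
  Q-factors of the policy \<open>p\<close>, which may differ from the one it follows.
\<close>

locale learner =
  fixes U :: "'u set"
    and \<mu> :: "'x::finite \<Rightarrow> 'u pmf"
    and \<kappa> :: "'x \<Rightarrow> 'u \<Rightarrow> (real \<times> 'x) pmf"
    and \<beta> :: real
    and \<alpha> :: "nat \<Rightarrow> real"
    and p :: "'x \<Rightarrow> 'u"
  assumes finite_U: "finite U"
    and set_mu: "set_pmf (\<mu> x) = U"
    and finite_kappa: "a \<in> U \<Longrightarrow> finite (set_pmf (\<kappa> x a))"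
    and p_U: "p x \<in> U"
    and beta: "0 \<le> \<beta>" "\<beta> < 1"
    and alpha: "0 \<le> \<alpha> n" "\<alpha> n \<le> 1"
    and alpha_diverges: "filterlim (\<lambda>N. \<Sum>n<N. \<alpha> n) at_top sequentially"
    and alpha_square_summable: "summable (\<lambda>n. (\<alpha> n)\<^sup>2)"
    and irreducible:
      "(x, y) \<in> {(x, x'). x' \<in> set_pmf (bind_pmf (\<mu> x) (\<lambda>a. map_pmf snd (\<kappa> x a)))}\<^sup>*"
begin

fun successor ::
  "'x \<times> ('x \<Rightarrow> 'u \<Rightarrow> nat) \<times> ('x \<Rightarrow> 'u \<Rightarrow> real) \<Rightarrow> 'u \<Rightarrow> real \<times> 'x
     \<Rightarrow> 'x \<times> ('x \<Rightarrow> 'u \<Rightarrow> nat) \<times> ('x \<Rightarrow> 'u \<Rightarrow> real)" where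
  "successor (x, c, q) a (r, x') =
     (x', c(x := (c x)(a := Suc (c x a))), mix_at q x a (\<alpha> (Suc (c x a))) (r + \<beta> * q x' (p x')))"

definition learn_step where
  "learn_step s = bind_pmf (\<mu> (fst s)) (\<lambda>a. map_pmf (successor s a) (\<kappa> (fst s) a))"

abbreviation learn where
  "learn n s \<equiv> evolve (\<lambda>_. learn_step) 0 n s"

abbreviation count :: "'x \<times> ('x \<Rightarrow> 'u \<Rightarrow> nat) \<times> ('x \<Rightarrow> 'u \<Rightarrow> real) \<Rightarrow> 'x \<Rightarrow> 'u \<Rightarrow> nat" where
  "count s \<equiv> fst (snd s)"

abbreviation table :: "'x \<times> ('x \<Rightarrow> 'u \<Rightarrow> nat) \<times> ('x \<Rightarrow> 'u \<Rightarrow> real) \<Rightarrow> 'x \<Rightarrow> 'u \<Rightarrow> real" where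
  "table s \<equiv> snd (snd s)"

lemma learn_add: "learn (m + n) s = bind_pmf (learn m s) (learn n)"
  by (simp add: evolve_add evolve_homogeneous[of _ m] fun_eq_iff cong: bind_pmf_cong)

lemma learn_step_support:
  assumes "s' \<in> set_pmf (learn_step s)"
  obtains a r x' where "a \<in> U" "(r, x') \<in> set_pmf (\<kappa> (fst s) a)" "s' = successor s a (r, x')"
  using assms by (auto simp: learn_step_def set_mu)


subsection \<open>Every pair is visited often\<close>

lemma count_learn_step:
  "s' \<in> set_pmf (learn_step s) \<Longrightarrow> count s y b \<le> count s' y b \<and> count s' y b \<le> Suc (count s y b)"
  by (cases s) (auto elim!: learn_step_support)

lemma count_learn_mono: "s' \<in> set_pmf (learn n s) \<Longrightarrow> count s y b \<le> count s' y b"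
proof (rule evolve_invariant[where I="\<lambda>s'. count s y b \<le> count s' y b" and K="\<lambda>_. learn_step"])
  show "count s y b \<le> count s'' y b"
    if "count s y b \<le> count s' y b" "s'' \<in> set_pmf (learn_step s')" for s' s''
    using that(1) count_learn_step[OF that(2), of y b] by linarith
qed auto

lemma count_learn_le: "s' \<in> set_pmf (learn n s) \<Longrightarrow> count s' y b \<le> count s y b + n"
proof (induction n arbitrary: s')
  case (Suc n)
  then obtain t where t: "t \<in> set_pmf (learn n s)" "s' \<in> set_pmf (learn_step t)"
    unfolding evolve_Suc' by auto
  show ?case
    using Suc.IH[OF t(1)] count_learn_step[OF t(2), of y b] by linarith
qed simp

lemma map_fst_learn_step:
  "map_pmf fst (learn_step s) = bind_pmf (\<mu> (fst s)) (\<lambda>a. map_pmf snd (\<kappa> (fst s) a))"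
proof -
  have "fst (successor s a z) = snd z" for a z
    by (cases s; cases z) simp
  then show ?thesis
    by (simp add: learn_step_def map_bind_pmf pmf.map_comp comp_def)
qed

text \<open>
  The bounds must not depend on the table or the counts of the starting state, of which there are
  infinitely many; they depend on its position only, because decisions do.
\<close>

lemma visit_possible:
  assumes a: "a \<in> U"
  shows "\<exists>n e. 0 < e \<and> (\<forall>s. fst s = x \<longrightarrow>
    e \<le> measure_pmf.prob (learn n s) {s'. count s y a < count s' y a})"
  using irreducible[of x y]
proof (induction rule: converse_rtrancl_induct)
  case base
  have "pmf (\<mu> y) a \<le> measure_pmf.prob (learn (Suc 0) s) {s'. count s y a < count s' y a}"
    if "fst s = y" for s
  proof -
    have "measure_pmf.prob (\<mu> y) {a} * 1 \<le>
        measure_pmf.prob (learn_step s) {s'. count s y a < count s' y a}"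
      unfolding learn_step_def that
    proof (rule prob_bind_ge)
      fix b assume "b \<in> {a}"
      then show "1 \<le> measure_pmf.prob (map_pmf (successor s b) (\<kappa> y b))
          {s'. count s y a < count s' y a}"
        using that by (cases s) (subst prob_eq_1_support, auto)
    qed simp
    then show ?thesis
      by (simp add: measure_pmf_single evolve_1_fun del: evolve.simps)
  qed
  moreover have "0 < pmf (\<mu> y) a"
    using a set_mu[of y] by (simp add: pmf_positive_iff)
  ultimately show ?case by blast
next
  case (step x z)
  then obtain n e where e: "0 < e" and n: "\<And>s. fst s = z \<Longrightarrow>
      e \<le> measure_pmf.prob (learn n s) {s'. count s y a < count s' y a}"
    by blast
  let ?move = "bind_pmf (\<mu> x) (\<lambda>a. map_pmf snd (\<kappa> x a))"
  have "pmf ?move z * e \<le> measure_pmf.prob (learn (Suc n) s) {s'. count s y a < count s' y a}"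
    if s: "fst s = x" for s
  proof -
    have "pmf ?move z = measure_pmf.prob (map_pmf fst (learn_step s)) {z}"
      by (simp add: map_fst_learn_step s measure_pmf_single)
    also have "\<dots> = measure_pmf.prob (learn_step s) {s. fst s = z}"
      by (simp add: vimage_def)
    finally have "pmf ?move z * e = measure_pmf.prob (learn_step s) {s. fst s = z} * e"
      by simp
    also have "\<dots> \<le> measure_pmf.prob (bind_pmf (learn_step s) (learn n))
        {s'. count s y a < count s' y a}"
    proof (rule prob_bind_ge)
      fix t assume t: "t \<in> set_pmf (learn_step s)" "t \<in> {s. fst s = z}"
      have "e \<le> measure_pmf.prob (learn n t) {s'. count t y a < count s' y a}"
        using n t by simp
      also have "\<dots> \<le> measure_pmf.prob (learn n t) {s'. count s y a < count s' y a}"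
        using count_learn_step[OF t(1), of y a] by (intro prob_mono_support) auto
      finally show "e \<le> measure_pmf.prob (learn n t) {s'. count s y a < count s' y a}" .
    qed (use e in simp)
    also have "bind_pmf (learn_step s) (learn n) = learn (Suc n) s"
      using learn_add[of 1 n s] by (simp add: evolve_1_fun del: evolve.simps)
    finally show ?thesis .
  qed
  moreover have "0 < pmf ?move z * e"
    using step.hyps(1) e by (intro mult_pos_pos pmf_positive) auto
  ultimately show ?case by blast
qed

lemma miss_unlikely:
  assumes a: "a \<in> U"
  shows "\<exists>m e. 0 < e \<and> e \<le> 1 \<and>
    (\<forall>s. measure_pmf.prob (learn m s) {s'. count s' y a \<le> count s y a} \<le> 1 - e)"
proof -
  have "\<forall>x. \<exists>ne. 0 < snd ne \<and> (\<forall>s. fst s = x \<longrightarrow>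
      snd ne \<le> measure_pmf.prob (learn (fst ne) s) {s'. count s y a < count s' y a})"
    using visit_possible[OF a, of _ y] by simp
  from choice[OF this] obtain ne' where ne': "\<And>x. 0 < snd (ne' x)" "\<And>x s. fst s = x \<Longrightarrow>
      snd (ne' x) \<le> measure_pmf.prob (learn (fst (ne' x)) s) {s'. count s y a < count s' y a}"
    by blast
  define n e where "n x = fst (ne' x)" and "e x = snd (ne' x)" for x
  have ne: "\<And>x. 0 < e x" "\<And>x s. fst s = x \<Longrightarrow>
      e x \<le> measure_pmf.prob (learn (n x) s) {s'. count s y a < count s' y a}"
    using ne' unfolding n_def e_def by blast+
  define m where "m = Max (range n)"
  define e' where "e' = Min (range e)"
  have m: "n x \<le> m" and e': "e' \<le> e x" for x
    by (auto simp: m_def e'_def)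
  have "0 < e'"
    using ne(1) by (auto simp: e'_def)
  have ge: "e' \<le> measure_pmf.prob (learn m s) {s'. count s y a < count s' y a}" for s
  proof -
    let ?n = "n (fst s)"
    have "e' \<le> measure_pmf.prob (learn ?n s) {s'. count s y a < count s' y a} * 1"
      using e'[of "fst s"] ne(2)[of s "fst s"] by simp
    also have "\<dots> \<le> measure_pmf.prob (bind_pmf (learn ?n s) (learn (m - ?n)))
        {s'. count s y a < count s' y a}"
    proof (rule prob_bind_ge)
      fix t assume "t \<in> {s'. count s y a < count s' y a}"
      then show "1 \<le> measure_pmf.prob (learn (m - ?n) t) {s'. count s y a < count s' y a}"
        using count_learn_mono[of _ "m - ?n" t y a]
        by (subst prob_eq_1_support) (auto intro: less_le_trans)
    qed simp
    also have "bind_pmf (learn ?n s) (learn (m - ?n)) = learn m s"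
      using m[of "fst s"] by (simp add: learn_add[symmetric])
    finally show ?thesis .
  qed
  have "measure_pmf.prob (learn m s) {s'. count s' y a \<le> count s y a} \<le> 1 - e'" for s
  proof -
    have "{s'. count s' y a \<le> count s y a} = UNIV - {s'. count s y a < count s' y a}"
      by auto
    then show ?thesis
      using ge[of s] measure_pmf.prob_compl[of "{s'. count s y a < count s' y a}" "learn m s"]
      by simp
  qed
  moreover have "e' \<le> 1"
    using ge[of undefined] measure_pmf.prob_le_1 order_trans by blast
  ultimately show ?thesis
    using \<open>0 < e'\<close> by blast
qed

lemma first_visit_soon:
  assumes a: "a \<in> U" and "0 < d"
  shows "\<exists>T. \<forall>s. measure_pmf.prob (learn T s) {s'. count s' y a \<le> count s y a} \<le> d"
proof -
  obtain m e where e: "0 < e" "e \<le> 1" and m: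
    "\<And>s. measure_pmf.prob (learn m s) {s'. count s' y a \<le> count s y a} \<le> 1 - e"
    using miss_unlikely[OF a, of y] by blast
  have blocks: "measure_pmf.prob (learn (k * m) s) {s'. count s' y a \<le> count s y a} \<le> (1 - e) ^ k"
    for k s
  proof (induction k arbitrary: s)
    case (Suc k)
    let ?A = "{s'. count s' y a \<le> count s y a}"
    have "measure_pmf.prob (learn (Suc k * m) s) ?A =
        measure_pmf.prob (bind_pmf (learn m s) (learn (k * m))) ?A"
      by (simp add: learn_add)
    also have "\<dots> \<le> measure_pmf.prob (learn m s) ?A * (1 - e) ^ k + 0"
    proof (rule prob_bind_affine)
      fix t assume t: "t \<in> set_pmf (learn m s)"
      show "measure_pmf.prob (learn (k * m) t) ?A \<le> (1 - e) ^ k" if "t \<in> ?A"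
      proof -
        have "count t y a = count s y a"
          using that count_learn_mono[OF t, of y a] by simp
        then show ?thesis
          using Suc.IH[of t] by simp
      qed
      show "measure_pmf.prob (learn (k * m) t) ?A \<le> 0" if "t \<notin> ?A"
        using that count_learn_mono[of _ "k * m" t y a]
        by (subst prob_eq_0_support) (auto dest: order_trans)
    qed (use e in auto)
    also have "\<dots> \<le> (1 - e) ^ Suc k"
      using m[of s] e by (simp add: mult_right_mono)
    finally show ?case .
  qed simp
  have "(\<lambda>k. (1 - e) ^ k) \<longlonglongrightarrow> 0"
    using e by (intro LIMSEQ_power_zero) auto
  then have "\<forall>\<^sub>F k in sequentially. (1 - e) ^ k < d"
    using \<open>0 < d\<close> by (rule order_tendstoD)
  then obtain k where "(1 - e) ^ k < d"
    by (auto simp: eventually_sequentially)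
  then have "\<forall>s. measure_pmf.prob (learn (k * m) s) {s'. count s' y a \<le> count s y a} \<le> d"
    using blocks[of k] order_trans less_imp_le by blast
  then show ?thesis by blast
qed

text \<open>
  If fewer than \<open>N\<close> visits occur in \<open>N\<close> successive periods, one of the periods passes without a visit.
\<close>

lemma many_visits_soon:
  assumes a: "a \<in> U" and "0 < d"
  shows "\<exists>T. \<forall>s. measure_pmf.prob (learn T s) {s'. count s' y a < count s y a + N} \<le> d"
  using \<open>0 < d\<close>
proof (induction N arbitrary: d)
  case 0
  have "measure_pmf.prob (learn 0 s) {s'. count s' y a < count s y a + 0} \<le> d" for s
    using 0 by simp
  then show ?case by blast
next
  case (Suc N)
  obtain T1 where T1: "\<And>s. measure_pmf.prob (learn T1 s) {s'. count s' y a \<le> count s y a} \<le> d / 2"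
    using first_visit_soon[OF a half_gt_zero[OF Suc.prems], of y] by blast
  obtain T2 where T2: "\<And>s. measure_pmf.prob (learn T2 s) {s'. count s' y a < count s y a + N} \<le> d / 2"
    using Suc.IH[OF half_gt_zero[OF Suc.prems]] by blast
  have "measure_pmf.prob (learn (T1 + T2) s) {s'. count s' y a < count s y a + Suc N} \<le> d" for s
  proof -
    have "measure_pmf.prob (bind_pmf (learn T1 s) (learn T2))
        {s'. count s' y a < count s y a + Suc N} \<le>
      measure_pmf.prob (learn T1 s) {s'. count s' y a \<le> count s y a} + d / 2"
    proof (rule prob_bind_le)
      fix t assume "t \<notin> {s'. count s' y a \<le> count s y a}"
      then have "measure_pmf.prob (learn T2 t) {s'. count s' y a < count s y a + Suc N} \<le>
          measure_pmf.prob (learn T2 t) {s'. count s' y a < count t y a + N}"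
        by (intro prob_mono_support) auto
      then show "measure_pmf.prob (learn T2 t) {s'. count s' y a < count s y a + Suc N} \<le> d / 2"
        using T2[of t] by simp
    qed (use Suc.prems in simp)
    then show ?thesis
      using T1[of s] by (simp add: learn_add)
  qed
  then show ?case by blast
qed

lemma all_visited_often:
  assumes "0 < d"
  shows "\<exists>T. \<forall>n\<ge>T. \<forall>s. measure_pmf.prob (learn n s)
    {s'. \<exists>y. \<exists>a\<in>U. count s' y a < count s y a + N} \<le> d"
proof -
  let ?S = "(UNIV :: 'x set) \<times> U"
  have fin: "finite ?S"
    using finite_U by simp
  have ne: "?S \<noteq> {}"
    using p_U by auto
  define d' where "d' = d / card ?S"
  have d': "0 < d'"
    using fin ne assms by (simp add: d'_def card_gt_0_iff del: card_cartesian_product)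
  have "\<forall>z\<in>?S. \<exists>T. \<forall>s. measure_pmf.prob (learn T s)
      {s'. count s' (fst z) (snd z) < count s (fst z) (snd z) + N} \<le> d'"
    using many_visits_soon[OF _ d'] by auto
  from bchoice[OF this] obtain T where T: "\<And>z s. z \<in> ?S \<Longrightarrow> measure_pmf.prob (learn (T z) s)
      {s'. count s' (fst z) (snd z) < count s (fst z) (snd z) + N} \<le> d'"
    by blast
  have "measure_pmf.prob (learn n s) {s'. \<exists>y. \<exists>a\<in>U. count s' y a < count s y a + N} \<le> d"
    if n: "Max (T ` ?S) \<le> n" for n s
  proof -
    let ?A = "\<lambda>z. {s'. count s' (fst z) (snd z) < count s (fst z) (snd z) + N}"
    have le: "measure_pmf.prob (learn n s) (?A z) \<le> d'" if z: "z \<in> ?S" for z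
    proof -
      have "T z \<le> n"
        using fin z by (intro order_trans[OF Max_ge n]) auto
      then have "learn n s = bind_pmf (learn (T z) s) (learn (n - T z))"
        by (simp add: learn_add[symmetric])
      also have "measure_pmf.prob \<dots> (?A z) \<le> measure_pmf.prob (learn (T z) s) (?A z) + 0"
      proof (rule prob_bind_le)
        fix t assume "t \<notin> ?A z"
        then show "measure_pmf.prob (learn (n - T z) t) (?A z) \<le> 0"
          using count_learn_mono[of _ "n - T z" t "fst z" "snd z"]
          by (subst prob_eq_0_support) (auto dest: le_less_trans)
      qed simp
      finally show ?thesis
        using T[OF z, of s] by simp
    qed
    have "{s'. \<exists>y. \<exists>a\<in>U. count s' y a < count s y a + N} = (\<Union>z\<in>?S. ?A z)"
      by (auto; blast)
    then have "measure_pmf.prob (learn n s) {s'. \<exists>y. \<exists>a\<in>U. count s' y a < count s y a + N} \<le>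
        (\<Sum>z\<in>?S. measure_pmf.prob (learn n s) (?A z))"
      using fin by (simp add: measure_pmf.finite_measure_subadditive_finite del: UN_simps Sigma_Union)
    also have "\<dots> \<le> (\<Sum>z\<in>?S. d')"
      using le by (intro sum_mono) auto
    also have "\<dots> = d"
      using fin ne by (simp add: d'_def del: card_cartesian_product)
    finally show ?thesis .
  qed
  then show ?thesis by blast
qed


subsection \<open>Averaged noise\<close>

definition backup :: "('x \<Rightarrow> 'u \<Rightarrow> real) \<Rightarrow> 'x \<Rightarrow> 'u \<Rightarrow> real" where
  "backup q x a = measure_pmf.expectation (\<kappa> x a) (\<lambda>(r, x'). r + \<beta> * q x' (p x'))"

lemma backup_contraction:
  assumes a: "a \<in> U" and le: "\<And>x. \<bar>q x (p x) - q' x (p x)\<bar> \<le> m"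
  shows "\<bar>backup q x a - backup q' x a\<bar> \<le> \<beta> * m"
proof -
  have "\<bar>backup q x a - backup q' x a\<bar> = \<bar>measure_pmf.expectation (\<kappa> x a)
      (\<lambda>z. \<beta> * (q (snd z) (p (snd z)) - q' (snd z) (p (snd z))))\<bar>"
    unfolding backup_def using finite_kappa[OF a]
    by (subst Bochner_Integration.integral_diff[symmetric])
       (auto simp: integrable_measure_pmf_finite case_prod_unfold algebra_simps)
  also have "\<dots> \<le> measure_pmf.expectation (\<kappa> x a)
      (\<lambda>z. \<bar>\<beta> * (q (snd z) (p (snd z)) - q' (snd z) (p (snd z)))\<bar>)"
    by (rule integral_abs_bound)
  also have "\<dots> \<le> measure_pmf.expectation (\<kappa> x a) (\<lambda>z. \<beta> * m)"
    using le beta by (intro expectation_mono_finite finite_kappa[OF a])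
      (auto simp: abs_mult intro: mult_left_mono)
  finally show ?thesis by simp
qed

text \<open>
  The deviation of the sampled target from its mean is averaged with the same step sizes as the
  table itself. A flag records whether the average has stayed below \<open>\<eta>\<close> in absolute value, which
  turns a statement about all times into one about the final state.
\<close>

fun noisy_successor where
  "noisy_successor \<eta> ((x, c, q), w, quiet) a (r, x') =
     (let w' = mix_at w x a (\<alpha> (Suc (c x a))) (r + \<beta> * q x' (p x') - backup q x a)
      in (successor (x, c, q) a (r, x'), w', quiet \<and> \<bar>w' x a\<bar> \<le> \<eta>))"

definition noisy_step where
  "noisy_step \<eta> s =
     bind_pmf (\<mu> (fst (fst s))) (\<lambda>a. map_pmf (noisy_successor \<eta> s a) (\<kappa> (fst (fst s)) a))"

abbreviation noisy_learn where
  "noisy_learn \<eta> n s \<equiv> evolve (\<lambda>_. noisy_step \<eta>) 0 n s"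

abbreviation noise ::
  "('x \<times> ('x \<Rightarrow> 'u \<Rightarrow> nat) \<times> ('x \<Rightarrow> 'u \<Rightarrow> real)) \<times> ('x \<Rightarrow> 'u \<Rightarrow> real) \<times> bool \<Rightarrow> 'x \<Rightarrow> 'u \<Rightarrow> real"
  where "noise s \<equiv> fst (snd s)"

abbreviation quiet ::
  "('x \<times> ('x \<Rightarrow> 'u \<Rightarrow> nat) \<times> ('x \<Rightarrow> 'u \<Rightarrow> real)) \<times> ('x \<Rightarrow> 'u \<Rightarrow> real) \<times> bool \<Rightarrow> bool"
  where "quiet s \<equiv> snd (snd s)"

lemma map_fst_noisy_learn: "map_pmf fst (noisy_learn \<eta> n s) = learn n (fst s)"
proof (rule evolve_map[where I="\<lambda>_. True"])
  have "fst (noisy_successor \<eta> s a z) = successor (fst s) a z" for s a z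
    by (cases s; cases z) (auto simp: Let_def)
  then show "map_pmf fst (noisy_step \<eta> s) = learn_step (fst s)" for s
    by (simp add: noisy_step_def learn_step_def map_bind_pmf pmf.map_comp comp_def)
qed auto

lemma finite_noisy_step: "finite (set_pmf (noisy_step \<eta> s))"
  using finite_U finite_kappa by (auto simp: noisy_step_def set_mu)

lemma finite_rewards: "finite (\<Union>x. \<Union>a\<in>U. set_pmf (\<kappa> x a))"
  using finite_U finite_kappa by auto

definition reward_bound :: "real \<Rightarrow> bool" where
  "reward_bound R \<longleftrightarrow> (\<forall>x. \<forall>a\<in>U. \<forall>(r, x')\<in>set_pmf (\<kappa> x a). \<bar>r\<bar> \<le> R)"

lemma reward_bound_exists: "\<exists>R. 0 \<le> R \<and> reward_bound R"
proof -
  let ?S = "insert 0 ((\<lambda>z. \<bar>fst z\<bar>) ` (\<Union>x. \<Union>a\<in>U. set_pmf (\<kappa> x a)))"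
  have fin: "finite ?S"
    using finite_rewards by simp
  have "0 \<le> Max ?S"
    using fin by (intro Max_ge) auto
  moreover have "reward_bound (Max ?S)"
    unfolding reward_bound_def using fin by (auto intro!: Max_ge image_eqI)
  ultimately show ?thesis by blast
qed

definition table_bound :: "real \<Rightarrow> ('x \<Rightarrow> 'u \<Rightarrow> real) \<Rightarrow> bool" where
  "table_bound B q \<longleftrightarrow> (\<forall>x. \<forall>a\<in>U. \<bar>q x a\<bar> \<le> B)"

lemma sample_bound:
  assumes R: "reward_bound R" and B: "R + \<beta> * B \<le> B" and q: "table_bound B q"
    and a: "a \<in> U" "(r, x') \<in> set_pmf (\<kappa> x a)"
  shows "\<bar>r + \<beta> * q x' (p x')\<bar> \<le> B"
proof -
  have "\<bar>r\<bar> \<le> R"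
    using R a by (fastforce simp: reward_bound_def)
  moreover have "\<bar>q x' (p x')\<bar> \<le> B"
    using q p_U by (auto simp: table_bound_def)
  ultimately have "\<bar>r + \<beta> * q x' (p x')\<bar> \<le> R + \<beta> * B"
    using beta by (intro order_trans[OF abs_triangle_ineq] add_mono) (auto simp: abs_mult intro: mult_left_mono)
  then show ?thesis using B by simp
qed

lemma table_bound_successor:
  assumes R: "reward_bound R" and B: "R + \<beta> * B \<le> B" and q: "table_bound B (table s)"
    and a: "a \<in> U" "z \<in> set_pmf (\<kappa> (fst s) a)"
  shows "table_bound B (table (successor s a z))"
proof -
  obtain x c q' r x' where s: "s = (x, c, q')" "z = (r, x')"
    by (cases s; cases z)
  have "\<bar>mix_at q' x a (\<alpha> (Suc (c x a))) (r + \<beta> * q' x' (p x')) y b\<bar> \<le> B" if b: "b \<in> U" for y b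
  proof (cases "(y, b) = (x, a)")
    case True
    have "\<bar>q' x a\<bar> \<le> B"
      using q a by (simp add: table_bound_def s)
    moreover have "\<bar>r + \<beta> * q' x' (p x')\<bar> \<le> B"
      using q a by (intro sample_bound[OF R B]) (auto simp: s)
    ultimately show ?thesis
      using True alpha by (auto intro!: convex_abs_le)
  next
    case False
    then show ?thesis
      using q b by (subst mix_at_other) (auto simp: table_bound_def s)
  qed
  then show ?thesis
    by (simp add: table_bound_def s)
qed

lemma backup_bound:
  assumes "reward_bound R" "R + \<beta> * B \<le> B" "table_bound B q" "a \<in> U"
  shows "\<bar>backup q x a\<bar> \<le> B"
proof -
  have "\<bar>backup q x a\<bar> \<le> measure_pmf.expectation (\<kappa> x a) (\<lambda>z. \<bar>case z of (r, x') \<Rightarrow> r + \<beta> * q x' (p x')\<bar>)"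
    unfolding backup_def by (rule integral_abs_bound)
  also have "\<dots> \<le> measure_pmf.expectation (\<kappa> x a) (\<lambda>z. B)"
    using sample_bound[OF assms(1-4)] by (intro expectation_mono_finite finite_kappa assms) auto
  finally show ?thesis by simp
qed

definition square_tail :: "nat \<Rightarrow> real" where
  "square_tail n = (\<Sum>k. (\<alpha> (k + Suc n))\<^sup>2)"

lemma square_tail_Suc: "square_tail n = (\<alpha> (Suc n))\<^sup>2 + square_tail (Suc n)"
proof -
  have "summable (\<lambda>k. (\<alpha> (k + Suc n))\<^sup>2)"
    using alpha_square_summable summable_iff_shift[of "\<lambda>k. (\<alpha> k)\<^sup>2" "Suc n"] by simp
  from suminf_split_head[OF this] show ?thesis
    by (simp add: square_tail_def)
qed

lemma square_tail_nonneg: "0 \<le> square_tail n"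
proof -
  have "summable (\<lambda>k. (\<alpha> (k + Suc n))\<^sup>2)"
    using alpha_square_summable summable_iff_shift[of "\<lambda>k. (\<alpha> k)\<^sup>2" "Suc n"] by simp
  then show ?thesis
    unfolding square_tail_def by (intro suminf_nonneg) auto
qed

lemma square_tail_small:
  assumes "0 < e"
  obtains N where "\<And>n. N \<le> n \<Longrightarrow> square_tail n \<le> e"
proof -
  obtain N where N: "\<And>n. n \<ge> N \<Longrightarrow> norm (\<Sum>k. (\<alpha> (k + n))\<^sup>2) < e"
    using suminf_exist_split[OF assms alpha_square_summable] by blast
  show thesis
  proof
    show "square_tail n \<le> e" if "N \<le> n" for n
      using N[of "Suc n"] that by (simp add: square_tail_def)
  qed
qed

text \<open>
  Given its current value \<open>w\<close>, the average has conditional second moment at most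
  \<open>w\<^sup>2 + C t\<^sup>2\<close> after an update with step size \<open>t\<close>. Adding the square sum of all
  step sizes still to come therefore gives a supermartingale.
\<close>

definition noise_potential where
  "noise_potential C s =
     (\<Sum>(y, b)\<in>UNIV \<times> U. (noise s y b)\<^sup>2 + C * square_tail (count (fst s) y b))"

lemma noise_potential_step:
  assumes R: "reward_bound R" and B: "R + \<beta> * B \<le> B" and q: "table_bound B (table (fst s))"
    and a: "a \<in> U"
  shows "measure_pmf.expectation (\<kappa> (fst (fst s)) a)
      (\<lambda>z. noise_potential (4 * B\<^sup>2) (noisy_successor \<eta> s a z)) \<le> noise_potential (4 * B\<^sup>2) s"
proof -
  obtain x c q w k where s: "s = ((x, c, q), w, k)"
    by (metis prod.exhaust)
  let ?E = "measure_pmf.expectation (\<kappa> x a)" and ?C = "4 * B\<^sup>2"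
  let ?term = "\<lambda>y b s. (noise s y b)\<^sup>2 + ?C * square_tail (count (fst s) y b)"
  have int: "integrable (\<kappa> x a) f" for f :: "_ \<Rightarrow> real"
    by (intro integrable_measure_pmf_finite finite_kappa a)
  have le: "?E (\<lambda>z. ?term y b (noisy_successor \<eta> s a z)) \<le> ?term y b s" for y b
  proof (cases "(y, b) = (x, a)")
    case False
    then have "?term y b (noisy_successor \<eta> s a z) = ?term y b s" for z
      by (cases z) (auto simp: s Let_def mix_at_other)
    then show ?thesis by simp
  next
    case True
    define t where "t = \<alpha> (Suc (c x a))"
    define \<xi> where "\<xi> z = (case z of (r, x') \<Rightarrow> r + \<beta> * q x' (p x')) - backup q x a" for z
    have t: "0 \<le> t" "t \<le> 1"
      using alpha by (auto simp: t_def)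
    have mean: "?E \<xi> = 0"
      unfolding \<xi>_def by (subst Bochner_Integration.integral_diff) (auto simp: int backup_def)
    have "\<bar>\<xi> z\<bar> \<le> 2 * B" if "z \<in> set_pmf (\<kappa> x a)" for z
      using that sample_bound[OF R B _ a] backup_bound[OF R B _ a, of q x] q
      by (cases z) (fastforce simp: \<xi>_def s)
    then have sq: "(\<xi> z)\<^sup>2 \<le> ?C" if "z \<in> set_pmf (\<kappa> x a)" for z
      using that power_mono[of "\<bar>\<xi> z\<bar>" "2 * B" 2] by (simp add: power_mult_distrib)
    have "?term y b (noisy_successor \<eta> s a z) = ((1 - t)\<^sup>2 * (w x a)\<^sup>2 + ?C * square_tail (Suc (c x a)))
        + 2 * ((1 - t) * w x a * t) * \<xi> z + t\<^sup>2 * (\<xi> z)\<^sup>2" for z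
      using True by (cases z) (auto simp: s Let_def t_def \<xi>_def power2_eq_square algebra_simps)
    then have "?E (\<lambda>z. ?term y b (noisy_successor \<eta> s a z)) =
        ((1 - t)\<^sup>2 * (w x a)\<^sup>2 + ?C * square_tail (Suc (c x a)))
        + 2 * ((1 - t) * w x a * t) * ?E \<xi> + t\<^sup>2 * ?E (\<lambda>z. (\<xi> z)\<^sup>2)"
      by (simp only:) (simp add: int)
    also have "\<dots> \<le> (w x a)\<^sup>2 + ?C * square_tail (Suc (c x a)) + t\<^sup>2 * ?C"
    proof -
      have "(1 - t)\<^sup>2 * (w x a)\<^sup>2 \<le> 1 * (w x a)\<^sup>2"
        using t by (intro mult_right_mono) (auto simp: power_le_one)
      moreover have "?E (\<lambda>z. (\<xi> z)\<^sup>2) \<le> ?E (\<lambda>z. ?C)"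
        using sq by (intro expectation_mono_finite finite_kappa a)
      then have "t\<^sup>2 * ?E (\<lambda>z. (\<xi> z)\<^sup>2) \<le> t\<^sup>2 * ?C"
        by (intro mult_left_mono) auto
      ultimately show ?thesis
        unfolding mean by simp
    qed
    also have "\<dots> = ?term y b s"
      using True square_tail_Suc[of "c x a"] by (simp add: s t_def algebra_simps)
    finally show ?thesis .
  qed
  have "?E (\<lambda>z. noise_potential ?C (noisy_successor \<eta> s a z)) =
      (\<Sum>(y, b)\<in>UNIV \<times> U. ?E (\<lambda>z. ?term y b (noisy_successor \<eta> s a z)))"
    unfolding noise_potential_def
    by (subst Bochner_Integration.integral_sum) (auto simp: int case_prod_unfold)
  also have "\<dots> \<le> noise_potential ?C s"
    unfolding noise_potential_def using le by (intro sum_mono) auto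
  finally show ?thesis
    by (simp add: s)
qed

text \<open>
  The potential is frozen at \<open>1\<close> as soon as the flag is lowered. At that moment it was at least \<open>1\<close>,
  since one of its terms has then exceeded \<open>\<eta>\<^sup>2\<close> before scaling, so freezing preserves the
  supermartingale property. Starting the average at zero leaves only the square sums to be paid for.
\<close>

lemma noise_exceeds_unlikely:
  assumes R: "reward_bound R" and B: "R + \<beta> * B \<le> B" and q: "table_bound B (table s)"
    and \<eta>: "0 < \<eta>"
  shows "measure_pmf.prob (noisy_learn \<eta> n (s, \<lambda>_ _. 0, True)) {s. \<not> quiet s} \<le>
    4 * B\<^sup>2 * (\<Sum>(y, b)\<in>UNIV \<times> U. square_tail (count s y b)) / \<eta>\<^sup>2"
proof -
  let ?C = "4 * B\<^sup>2"
  define V where "V s = (if quiet s then noise_potential ?C s / \<eta>\<^sup>2 else 1)" for s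
  let ?I = "\<lambda>s. table_bound B (table (fst s))"
  have pot_nonneg: "0 \<le> noise_potential ?C s" for s
    unfolding noise_potential_def using square_tail_nonneg by (intro sum_nonneg) auto
  have inv: "?I (noisy_successor \<eta> s a z)"
    if "?I s" "a \<in> U" "z \<in> set_pmf (\<kappa> (fst (fst s)) a)" for s a z
  proof -
    have "fst (noisy_successor \<eta> s a z) = successor (fst s) a z"
      by (cases s; cases z) (auto simp: Let_def)
    then show ?thesis
      using table_bound_successor[OF R B that] by simp
  qed
  have V_le: "V (noisy_successor \<eta> s a z) \<le> noise_potential ?C (noisy_successor \<eta> s a z) / \<eta>\<^sup>2"
    if "quiet s" "a \<in> U" for s a z
  proof (cases "quiet (noisy_successor \<eta> s a z)")
    case False
    obtain x c q w k r x' where s: "s = ((x, c, q), w, k)" "z = (r, x')"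
      by (metis prod.exhaust)
    let ?s = "noisy_successor \<eta> s a z"
    have "\<eta> < \<bar>noise ?s x a\<bar>"
      using False that by (simp add: s Let_def)
    then have "\<eta>\<^sup>2 \<le> (noise ?s x a)\<^sup>2"
      using \<eta> power_mono[of \<eta> "\<bar>noise ?s x a\<bar>" 2] by simp
    also have "\<dots> \<le> (noise ?s x a)\<^sup>2 + ?C * square_tail (count (fst ?s) x a)"
      using square_tail_nonneg by simp
    also have "\<dots> = (\<Sum>(y, b)\<in>{(x, a)}. (noise ?s y b)\<^sup>2 + ?C * square_tail (count (fst ?s) y b))"
      by simp
    also have "\<dots> \<le> noise_potential ?C ?s"
      unfolding noise_potential_def using that finite_U square_tail_nonneg
      by (intro sum_mono2) auto
    finally show ?thesis
      using \<eta> False by (simp add: V_def)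
  qed (simp add: V_def)
  have super: "measure_pmf.expectation (noisy_step \<eta> s) V \<le> V s" if "?I s" for s
  proof -
    let ?x = "fst (fst s)"
    have "measure_pmf.expectation (noisy_step \<eta> s) V = measure_pmf.expectation (\<mu> ?x)
        (\<lambda>a. measure_pmf.expectation (\<kappa> ?x a) (\<lambda>z. V (noisy_successor \<eta> s a z)))"
      unfolding noisy_step_def using finite_U finite_kappa
      by (subst expectation_bind_finite) (auto simp: set_mu)
    also have "\<dots> \<le> measure_pmf.expectation (\<mu> ?x) (\<lambda>a. V s)"
    proof (rule expectation_mono_finite)
      fix a assume "a \<in> set_pmf (\<mu> ?x)"
      then have a: "a \<in> U" by (simp add: set_mu)
      show "measure_pmf.expectation (\<kappa> ?x a) (\<lambda>z. V (noisy_successor \<eta> s a z)) \<le> V s"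
      proof (cases "quiet s")
        case True
        have "measure_pmf.expectation (\<kappa> ?x a) (\<lambda>z. V (noisy_successor \<eta> s a z)) \<le>
            measure_pmf.expectation (\<kappa> ?x a)
              (\<lambda>z. noise_potential ?C (noisy_successor \<eta> s a z) / \<eta>\<^sup>2)"
          using V_le[OF True a] by (intro expectation_mono_finite finite_kappa a)
        also have "\<dots> \<le> noise_potential ?C s / \<eta>\<^sup>2"
          using noise_potential_step[OF R B that a, of \<eta>] by (simp add: divide_right_mono)
        finally show ?thesis
          using True by (simp add: V_def)
      next
        case False
        then have "\<not> quiet (noisy_successor \<eta> s a z)" for z
          by (cases s; cases z) (auto simp: Let_def)
        then show ?thesis
          using False by (simp add: V_def)
      qed
    qed (simp add: set_mu finite_U)
    finally show ?thesis by simp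
  qed
  have "measure_pmf.prob (noisy_learn \<eta> n (s, \<lambda>_ _. 0, True)) {s. \<not> quiet s} \<le> V (s, \<lambda>_ _. 0, True)"
  proof (rule evolve_supermartingale_prob[where I="?I"])
    show "?I s'" if "?I s" "s' \<in> set_pmf (noisy_step \<eta> s)" for s s'
    proof -
      from that(2) obtain a z where "a \<in> U" "z \<in> set_pmf (\<kappa> (fst (fst s)) a)"
          "s' = noisy_successor \<eta> s a z"
        by (auto simp: noisy_step_def set_mu simp del: noisy_successor.simps)
      then show ?thesis
        using inv[OF that(1)] by blast
    qed
    show "0 \<le> V s" for s
      using pot_nonneg[of s] by (simp add: V_def)
    show "1 \<le> V s" if "s \<in> {s. \<not> quiet s}" for s
      using that by (simp add: V_def)
  qed (use finite_noisy_step super q in auto)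
  also have "V (s, \<lambda>_ _. 0, True) = ?C * (\<Sum>(y, b)\<in>UNIV \<times> U. square_tail (count s y b)) / \<eta>\<^sup>2"
    by (simp add: V_def noise_potential_def sum_distrib_left case_prod_unfold)
  finally show ?thesis .
qed

subsection \<open>Contraction\<close>

definition decay :: "nat \<Rightarrow> nat \<Rightarrow> real" where
  "decay m n = (\<Prod>k\<in>{m<..n}. 1 - \<alpha> k)"

lemma decay_same [simp]: "decay m m = 1"
  by (simp add: decay_def)

lemma decay_Suc: "m \<le> n \<Longrightarrow> decay m (Suc n) = decay m n * (1 - \<alpha> (Suc n))"
proof -
  assume "m \<le> n"
  then have "{m<..Suc n} = insert (Suc n) {m<..n}"
    by auto
  then show ?thesis
    by (simp add: decay_def mult.commute)
qed

lemma decay_bounds: "0 \<le> decay m n" "decay m n \<le> 1"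
  using alpha by (auto simp: decay_def intro!: prod_nonneg prod_le_1)

lemma decay_antimono:
  assumes "m \<le> t" "N \<le> n"
  shows "decay m n \<le> decay t N"
proof -
  have "decay m n = (\<Prod>k\<in>{m<..n} - {t<..N}. 1 - \<alpha> k) * decay t N"
    using assms unfolding decay_def by (intro prod.subset_diff) auto
  also have "\<dots> \<le> 1 * decay t N"
    using alpha decay_bounds by (intro mult_right_mono prod_le_1) auto
  finally show ?thesis by simp
qed

lemma decay_small:
  assumes "0 < e"
  obtains N where "decay t N \<le> e"
proof -
  let ?S = "\<lambda>N. \<Sum>n<N. \<alpha> n"
  have "\<forall>\<^sub>F N in sequentially. ?S (Suc t) - ln e \<le> ?S N"
    using alpha_diverges by (simp add: filterlim_at_top)
  then obtain N where N: "\<And>n. N \<le> n \<Longrightarrow> ?S (Suc t) - ln e \<le> ?S n"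
    unfolding eventually_sequentially by blast
  define M where "M = max N t"
  have "{..<Suc M} = {..<Suc t} \<union> {t<..M}"
    by (auto simp: M_def)
  moreover have "sum \<alpha> ({..<Suc t} \<union> {t<..M}) = ?S (Suc t) + (\<Sum>n\<in>{t<..M}. \<alpha> n)"
    by (rule sum.union_disjoint) auto
  ultimately have "?S (Suc M) = ?S (Suc t) + (\<Sum>n\<in>{t<..M}. \<alpha> n)"
    by metis
  then have sum: "- ln e \<le> (\<Sum>n\<in>{t<..M}. \<alpha> n)"
    using N[of "Suc M"] by (simp add: M_def del: sum.lessThan_Suc)
  have "1 - \<alpha> k \<le> exp (- \<alpha> k)" for k
    using exp_ge_add_one_self[of "- \<alpha> k"] by simp
  then have "decay t M \<le> (\<Prod>k\<in>{t<..M}. exp (- \<alpha> k))"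
    unfolding decay_def using alpha by (intro prod_mono) auto
  also have "\<dots> = exp (- (\<Sum>n\<in>{t<..M}. \<alpha> n))"
    by (simp add: exp_sum sum_negf[symmetric])
  also have "\<dots> \<le> exp (ln e)"
    using sum by simp
  finally show thesis
    using assms by (intro that[of M]) simp
qed

text \<open>
  As long as the averaged noise \<open>w\<close> stays below \<open>\<eta>\<close>, the part \<open>q - q* - w\<close> of the error is moved
  by each update towards \<open>\<beta>\<close> times the error at the successor state. A bound \<open>D\<close> on it is thus
  preserved, and at each pair it decreases to \<open>\<beta> (D + \<eta>)\<close> up to the weight that the initial entry
  still has.
\<close>

lemma quiet_error_bound:
  assumes qs: "\<And>x a. a \<in> U \<Longrightarrow> qs x a = backup qs x a"
    and D: "0 \<le> D" "\<beta> * (D + \<eta>) \<le> D" and \<eta>: "0 \<le> \<eta>"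
    and init: "\<And>x a. a \<in> U \<Longrightarrow> \<bar>table s x a - qs x a\<bar> \<le> D"
    and s': "s' \<in> set_pmf (noisy_learn \<eta> n (s, \<lambda>_ _. 0, True))" and "quiet s'" and "b \<in> U"
  shows "\<bar>table (fst s') y b - qs y b\<bar> \<le>
    \<beta> * (D + \<eta>) + decay (count s y b) (count (fst s') y b) * D + \<eta>"
proof -
  let ?err = "\<lambda>s' y b. table (fst s') y b - qs y b - noise s' y b"
  define I where "I = (\<lambda>s'. (\<forall>y b. count s y b \<le> count (fst s') y b) \<and> (quiet s' \<longrightarrow>
    (\<forall>y. \<forall>b\<in>U. \<bar>noise s' y b\<bar> \<le> \<eta> \<and> \<bar>?err s' y b\<bar> \<le> D \<and>
      \<bar>?err s' y b\<bar> \<le> \<beta> * (D + \<eta>) + decay (count s y b) (count (fst s') y b) * D)))"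
  have "I s'"
  proof (rule evolve_invariant[where I=I, OF _ _ s'])
    have "0 \<le> \<beta> * (D + \<eta>)"
      using beta D \<eta> by simp
    then show "I (s, \<lambda>_ _. 0, True)"
      using init \<eta> by (auto simp: I_def intro: add_increasing)
  next
    fix t t' assume I: "I t" and t': "t' \<in> set_pmf (noisy_step \<eta> t)"
    obtain x c q w k where t: "t = ((x, c, q), w, k)"
      by (metis prod.exhaust)
    from t' obtain a r x' where a: "a \<in> U" and "(r, x') \<in> set_pmf (\<kappa> x a)"
      and t'_eq: "t' = noisy_successor \<eta> t a (r, x')"
      by (auto simp: noisy_step_def set_mu t simp del: noisy_successor.simps)
    let ?h = "\<alpha> (Suc (c x a))"
    have cle: "count s y b \<le> count (fst t') y b" for y b
    proof -
      have "count s y b \<le> c y b"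
        using I by (auto simp: I_def t)
      also have "\<dots> \<le> count (fst t') y b"
        by (auto simp: t'_eq t Let_def)
      finally show ?thesis .
    qed
    have "\<bar>noise t' y b\<bar> \<le> \<eta> \<and> \<bar>?err t' y b\<bar> \<le> D \<and>
        \<bar>?err t' y b\<bar> \<le> \<beta> * (D + \<eta>) + decay (count s y b) (count (fst t') y b) * D"
      if k': "quiet t'" and b: "b \<in> U" for y b
    proof -
      have "k"
        using k' by (simp add: t'_eq t Let_def)
      then have old: "\<bar>w y b\<bar> \<le> \<eta>" "\<bar>q y b - qs y b - w y b\<bar> \<le> D"
          "\<bar>q y b - qs y b - w y b\<bar> \<le> \<beta> * (D + \<eta>) + decay (count s y b) (c y b) * D"
        if "b \<in> U" for y b
        using I that by (auto simp: I_def t)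
      show ?thesis
      proof (cases "(y, b) = (x, a)")
        case False
        then show ?thesis
          using old[OF b, of y] by (auto simp: t'_eq t Let_def mix_at_other)
      next
        case True
        let ?e = "q x a - qs x a - w x a" and ?g = "backup q x a - qs x a"
        have "\<bar>q z (p z) - qs z (p z)\<bar> \<le> D + \<eta>" for z
          using old(1,2)[OF p_U, of z z] by linarith
        then have "\<bar>?g\<bar> \<le> \<beta> * (D + \<eta>)"
          using backup_contraction[OF a, of q qs "D + \<eta>" x] qs[OF a, of x] by simp
        have err: "?err t' y b = (1 - ?h) * ?e + ?h * ?g"
          using True by (simp add: t'_eq t Let_def algebra_simps)
        have "\<bar>?err t' y b\<bar> \<le> D"
          unfolding err using alpha old(2)[OF a, of x] \<open>\<bar>?g\<bar> \<le> \<beta> * (D + \<eta>)\<close> D(2)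
          by (intro convex_abs_le) auto
        moreover have "\<bar>?err t' y b\<bar> \<le>
            (1 - ?h) * (\<beta> * (D + \<eta>) + decay (count s x a) (c x a) * D) + ?h * (\<beta> * (D + \<eta>))"
        proof -
          have "\<bar>?err t' y b\<bar> \<le> (1 - ?h) * \<bar>?e\<bar> + ?h * \<bar>?g\<bar>"
            unfolding err using alpha
            by (intro order_trans[OF abs_triangle_ineq]) (simp add: abs_mult)
          also have "\<dots> \<le>
              (1 - ?h) * (\<beta> * (D + \<eta>) + decay (count s x a) (c x a) * D) + ?h * (\<beta> * (D + \<eta>))"
            using alpha old(3)[OF a, of x] \<open>\<bar>?g\<bar> \<le> \<beta> * (D + \<eta>)\<close>
            by (intro add_mono mult_left_mono) auto
          finally show ?thesis .
        qed
        moreover have "count s x a \<le> c x a"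
          using I by (auto simp: I_def t)
        then have "(1 - ?h) * (\<beta> * (D + \<eta>) + decay (count s x a) (c x a) * D) + ?h * (\<beta> * (D + \<eta>)) =
            \<beta> * (D + \<eta>) + decay (count s y b) (count (fst t') y b) * D"
          using True by (simp add: t'_eq t Let_def decay_Suc algebra_simps)
        moreover have "\<bar>noise t' y b\<bar> \<le> \<eta>"
          using True k' by (simp add: t'_eq t Let_def)
        ultimately show ?thesis by simp
      qed
    qed
    with cle show "I t'"
      by (auto simp: I_def)
  qed
  then have "\<bar>noise s' y b\<bar> \<le> \<eta>"
    "\<bar>?err s' y b\<bar> \<le> \<beta> * (D + \<eta>) + decay (count s y b) (count (fst s') y b) * D"
    using assms by (auto simp: I_def)
  then show ?thesis by linarith
qed

lemma table_bound_learn: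
  assumes R: "reward_bound R" and B: "R + \<beta> * B \<le> B" and q: "table_bound B (table s)"
    and s': "s' \<in> set_pmf (learn n s)"
  shows "table_bound B (table s')"
proof (rule evolve_invariant[where I="\<lambda>s. table_bound B (table s)" and K="\<lambda>_. learn_step", OF _ q s'])
  fix t t' assume t: "table_bound B (table t)" "t' \<in> set_pmf (learn_step t)"
  from t(2) obtain a r x' where "a \<in> U" "(r, x') \<in> set_pmf (\<kappa> (fst t) a)" "t' = successor t a (r, x')"
    by (rule learn_step_support)
  then show "table_bound B (table t')"
    using table_bound_successor[OF R B t(1)] by blast
qed

definition deviates :: "('x \<Rightarrow> 'u \<Rightarrow> real) \<Rightarrow> real
    \<Rightarrow> ('x \<times> ('x \<Rightarrow> 'u \<Rightarrow> nat) \<times> ('x \<Rightarrow> 'u \<Rightarrow> real)) set" where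
  "deviates qs D = {s. \<exists>x. \<exists>a\<in>U. D < \<bar>table s x a - qs x a\<bar>}"

definition settles_within :: "real \<Rightarrow> ('x \<Rightarrow> 'u \<Rightarrow> real) \<Rightarrow> real \<Rightarrow> bool" where
  "settles_within B qs D \<longleftrightarrow> (\<forall>d>0. \<exists>T. \<forall>n\<ge>T. \<forall>x q. table_bound B q \<longrightarrow>
     measure_pmf.prob (learn n (x, \<lambda>_ _. 0, q)) (deviates qs D) \<le> d)"

text \<open>
  Once all tables are within \<open>D\<close> at some fixed time \<open>t\<close> and all pairs have been visited so often
  that the remaining noise is negligible, waiting until each pair has collected enough further
  step size brings the tables within a smaller multiple of \<open>D\<close>. The number of visits needed is
  determined from \<open>t\<close> alone, because no pair has been visited more than \<open>t\<close> times by then.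
\<close>

lemma settles_within_contract:
  assumes qs: "\<And>x a. a \<in> U \<Longrightarrow> qs x a = backup qs x a"
    and R: "reward_bound R" and B: "R + \<beta> * B \<le> B" "0 < B"
    and D: "0 < D" and settled: "settles_within B qs D"
  shows "settles_within B qs ((1 + \<beta>) / 2 * D)"
  unfolding settles_within_def
proof (intro allI impI)
  fix d :: real assume d: "0 < d"
  let ?S = "(UNIV :: 'x set) \<times> U"
  \<comment> \<open>Chosen such that \<open>\<beta> (D + \<eta>) + e D + \<eta>\<close> is at most \<open>(1 + \<beta>) / 2 * D\<close>.\<close>
  define \<eta> where "\<eta> = (1 - \<beta>) * D / 8"
  define e where "e = (1 - \<beta>) / 4"
  have \<eta>: "0 < \<eta>" and e: "0 < e"
    using beta D by (auto simp: \<eta>_def e_def)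
  have \<beta>\<eta>: "\<beta> * \<eta> \<le> \<eta>"
    using beta \<eta> by (simp add: mult_left_le_one_le)
  have \<eta>_le: "\<eta> \<le> (1 - \<beta>) * D"
    using beta D by (simp add: \<eta>_def)
  have D_step: "\<beta> * (D + \<eta>) \<le> D"
    using \<beta>\<eta> \<eta>_le by (simp add: algebra_simps)
  have target: "\<beta> * (D + \<eta>) + e * D + \<eta> \<le> (1 + \<beta>) / 2 * D"
    using \<beta>\<eta> by (simp add: \<eta>_def e_def field_simps)
  define \<tau> where "\<tau> = d / 4 * \<eta>\<^sup>2 / (4 * B\<^sup>2) / card ?S"
  have S: "finite ?S" "0 < card ?S"
    using finite_U p_U by (auto simp: card_gt_0_iff)
  then have "0 < \<tau>"
    using d \<eta> B by (simp add: \<tau>_def)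
  then obtain N0 where N0: "\<And>n. N0 \<le> n \<Longrightarrow> square_tail n \<le> \<tau>"
    by (rule square_tail_small) blast
  have "0 < d / 4"
    using d by simp
  then obtain T1 where T1: "\<And>n x q. T1 \<le> n \<Longrightarrow> table_bound B q \<Longrightarrow>
      measure_pmf.prob (learn n (x, \<lambda>_ _. 0, q)) (deviates qs D) \<le> d / 4"
    using settled unfolding settles_within_def by blast
  let ?few = "\<lambda>N. {s. \<exists>y. \<exists>a\<in>U. count s y a < N}"
  have few: "\<exists>T. \<forall>n\<ge>T. \<forall>x q. measure_pmf.prob (learn n (x, \<lambda>_ _. 0, q)) (?few N) \<le> d / 4" for N
  proof -
    from all_visited_often[OF \<open>0 < d / 4\<close>, of N] obtain T where T: "\<And>n s. T \<le> n \<Longrightarrow>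
        measure_pmf.prob (learn n s) {s'. \<exists>y. \<exists>a\<in>U. count s' y a < count s y a + N} \<le> d / 4"
      by blast
    have "measure_pmf.prob (learn n (x, \<lambda>_ _. 0, q)) (?few N) \<le> d / 4" if "T \<le> n" for n x q
      using T[OF that, of "(x, \<lambda>_ _. 0, q)"] by simp
    then show ?thesis by blast
  qed
  obtain T2 where T2: "\<And>n x q. T2 \<le> n \<Longrightarrow>
      measure_pmf.prob (learn n (x, \<lambda>_ _. 0, q)) (?few N0) \<le> d / 4"
    using few[of N0] by blast
  define t where "t = max T1 T2"
  obtain N1 where N1: "decay t N1 \<le> e"
    using decay_small[OF e] by blast
  obtain T3 where T3: "\<And>n x q. T3 \<le> n \<Longrightarrow>
      measure_pmf.prob (learn n (x, \<lambda>_ _. 0, q)) (?few N1) \<le> d / 4"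
    using few[of N1] by blast
  show "\<exists>T. \<forall>n\<ge>T. \<forall>x q. table_bound B q \<longrightarrow>
      measure_pmf.prob (learn n (x, \<lambda>_ _. 0, q)) (deviates qs ((1 + \<beta>) / 2 * D)) \<le> d"
  proof (intro exI allI impI)
    fix n x and q :: "'x \<Rightarrow> 'u \<Rightarrow> real"
    assume n: "max t T3 \<le> n" and q: "table_bound B q"
    let ?s = "(x, \<lambda>_ _. 0, q) :: 'x \<times> ('x \<Rightarrow> 'u \<Rightarrow> nat) \<times> ('x \<Rightarrow> 'u \<Rightarrow> real)"
    let ?A = "deviates qs ((1 + \<beta>) / 2 * D) - ?few N1"
    have later: "measure_pmf.prob (learn (n - t) s) ?A \<le> d / 4"
      if s: "s \<in> set_pmf (learn t ?s)" "s \<notin> deviates qs D \<union> ?few N0" for s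
    proof -
      have "table_bound B (table s)"
        using table_bound_learn[OF R B(1) _ s(1)] q by simp
      have "measure_pmf.prob (learn (n - t) s) ?A =
          measure_pmf.prob (map_pmf fst (noisy_learn \<eta> (n - t) (s, \<lambda>_ _. 0, True))) ?A"
        by (simp add: map_fst_noisy_learn)
      also have "\<dots> \<le> measure_pmf.prob (noisy_learn \<eta> (n - t) (s, \<lambda>_ _. 0, True)) {s. \<not> quiet s}"
        unfolding measure_map_pmf
      proof (rule prob_mono_support)
        fix s' assume s': "s' \<in> set_pmf (noisy_learn \<eta> (n - t) (s, \<lambda>_ _. 0, True))" "s' \<in> fst -` ?A"
        have near: "\<bar>table (fst s') y b - qs y b\<bar> \<le> (1 + \<beta>) / 2 * D" if "quiet s'" and b: "b \<in> U" for y b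
        proof -
          have "\<bar>table (fst s') y b - qs y b\<bar> \<le>
              \<beta> * (D + \<eta>) + decay (count s y b) (count (fst s') y b) * D + \<eta>"
          proof (rule quiet_error_bound[OF qs _ D_step _ _ s'(1) that])
            show "\<bar>table s x a - qs x a\<bar> \<le> D" if "a \<in> U" for x a
              using s(2) that by (auto simp: deviates_def not_less)
          qed (use D \<eta> in auto)
          also have "\<dots> \<le> \<beta> * (D + \<eta>) + e * D + \<eta>"
          proof -
            have "count s y b \<le> t"
              using count_learn_le[OF s(1), of y b] by simp
            moreover have "N1 \<le> count (fst s') y b"
              using s'(2) b by (auto simp: not_less)
            ultimately have "decay (count s y b) (count (fst s') y b) \<le> e"
              using decay_antimono[of "count s y b" t N1] N1 by (blast intro: order_trans)
            then show ?thesis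
              using D by (simp add: mult_right_mono)
          qed
          finally show ?thesis
            using target by simp
        qed
        from s'(2) have "fst s' \<in> deviates qs ((1 + \<beta>) / 2 * D)"
          by simp
        then obtain y b where "b \<in> U" "(1 + \<beta>) / 2 * D < \<bar>table (fst s') y b - qs y b\<bar>"
          unfolding deviates_def by blast
        with near[of b y] have "\<not> quiet s'"
          by linarith
        then show "s' \<in> {s. \<not> quiet s}" by simp
      qed
      also have "\<dots> \<le> 4 * B\<^sup>2 * (\<Sum>(y, b)\<in>?S. square_tail (count s y b)) / \<eta>\<^sup>2"
        by (rule noise_exceeds_unlikely[OF R B(1) \<open>table_bound B (table s)\<close> \<eta>])
      also have "\<dots> \<le> 4 * B\<^sup>2 * (\<Sum>(y, b)\<in>?S. \<tau>) / \<eta>\<^sup>2"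
        using s(2) by (intro divide_right_mono mult_left_mono sum_mono) (auto simp: not_less intro!: N0)
      also have "\<dots> = d / 4"
      proof -
        have "(\<Sum>(y, b)\<in>?S. \<tau>) = card ?S * \<tau>"
          by (simp add: case_prod_unfold del: card_cartesian_product)
        moreover have "U \<noteq> {}"
          using p_U by auto
        ultimately show ?thesis
          using S B \<eta> by (simp add: \<tau>_def del: card_cartesian_product)
      qed
      finally show ?thesis .
    qed
    have split: "learn n ?s = bind_pmf (learn t ?s) (learn (n - t))"
      using n by (simp add: learn_add[symmetric])
    have "measure_pmf.prob (learn n ?s) ?A \<le>
        measure_pmf.prob (learn t ?s) (deviates qs D \<union> ?few N0) + d / 4"
      unfolding split by (rule prob_bind_le[OF later]) (use d in auto)
    moreover have "measure_pmf.prob (learn t ?s) (deviates qs D \<union> ?few N0) \<le> d / 4 + d / 4"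
      using T1[of t q x] T2[of t x q] q
      by (intro order_trans[OF measure_Un_le] add_mono) (auto simp: t_def)
    moreover have "measure_pmf.prob (learn n ?s) (deviates qs ((1 + \<beta>) / 2 * D)) \<le>
        measure_pmf.prob (learn n ?s) ?A + measure_pmf.prob (learn n ?s) (?few N1)"
      by (intro order_trans[OF measure_pmf.finite_measure_mono measure_Un_le]) auto
    moreover have "measure_pmf.prob (learn n ?s) (?few N1) \<le> d / 4"
      using T3[of n x q] n by simp
    ultimately show "measure_pmf.prob (learn n ?s) (deviates qs ((1 + \<beta>) / 2 * D)) \<le> d"
      by linarith
  qed
qed

lemma settles_within_mono:
  assumes settles: "settles_within B qs D" and "D \<le> D'" "B' \<le> B"
  shows "settles_within B' qs D'"
  unfolding settles_within_def
proof (intro allI impI)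
  fix d :: real assume "0 < d"
  with settles obtain T where T: "\<And>n x q. T \<le> n \<Longrightarrow> table_bound B q \<Longrightarrow>
      measure_pmf.prob (learn n (x, \<lambda>_ _. 0, q)) (deviates qs D) \<le> d"
    unfolding settles_within_def by blast
  show "\<exists>T. \<forall>n\<ge>T. \<forall>x q. table_bound B' q \<longrightarrow>
      measure_pmf.prob (learn n (x, \<lambda>_ _. 0, q)) (deviates qs D') \<le> d"
  proof (intro exI allI impI)
    fix n x q assume "T \<le> n" and q: "table_bound B' q"
    have "table_bound B q"
      using q \<open>B' \<le> B\<close> by (auto simp: table_bound_def intro: order_trans)
    have "measure_pmf.prob (learn n (x, \<lambda>_ _. 0, q)) (deviates qs D') \<le>
        measure_pmf.prob (learn n (x, \<lambda>_ _. 0, q)) (deviates qs D)"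
      using \<open>D \<le> D'\<close> by (intro measure_pmf.finite_measure_mono)
        (auto simp: deviates_def intro: le_less_trans)
    also have "\<dots> \<le> d"
      using T \<open>T \<le> n\<close> \<open>table_bound B q\<close> by blast
    finally show "measure_pmf.prob (learn n (x, \<lambda>_ _. 0, q)) (deviates qs D') \<le> d" .
  qed
qed

text \<open>
  The tables stay bounded by a constant, which is the first bound on the error; each contraction
  then multiplies it by \<open>(1 + \<beta>) / 2\<close>.
\<close>

lemma tables_converge:
  assumes qs: "\<And>x a. a \<in> U \<Longrightarrow> qs x a = backup qs x a" and "0 < e"
  shows "settles_within B qs e"
proof -
  obtain R where R: "0 \<le> R" "reward_bound R"
    using reward_bound_exists by blast
  define B' where "B' = max (max B 1) (R / (1 - \<beta>))"
  have "R / (1 - \<beta>) \<le> B'"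
    by (simp add: B'_def)
  then have "R \<le> B' * (1 - \<beta>)"
    using beta by (simp add: pos_divide_le_eq)
  then have B'_reward: "R + \<beta> * B' \<le> B'"
    by (simp add: algebra_simps)
  have "1 \<le> B'" "B \<le> B'"
    by (auto simp: B'_def)
  then have B': "R + \<beta> * B' \<le> B'" "0 < B'" "B \<le> B'"
    using B'_reward by auto
  let ?S = "insert 0 ((\<lambda>z. \<bar>qs (fst z) (snd z)\<bar>) ` (UNIV \<times> U))"
  let ?M = "Max ?S"
  have fin: "finite ?S"
    using finite_U by simp
  have M: "0 \<le> ?M"
    by (rule Max_ge[OF fin]) simp
  have M': "\<bar>qs x a\<bar> \<le> ?M" if "a \<in> U" for x a
    by (rule Max_ge[OF fin]) (use that in force)
  let ?D = "B' + ?M"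
  have start: "settles_within B' qs ?D"
    unfolding settles_within_def
  proof (intro allI impI exI)
    fix d n :: real and x and q :: "'x \<Rightarrow> 'u \<Rightarrow> real" and m :: nat
    assume d: "0 < d" and q: "table_bound B' q"
    have "s \<notin> deviates qs ?D" if "s \<in> set_pmf (learn m (x, \<lambda>_ _. 0, q))" for s
    proof -
      have "table_bound B' (table s)"
        using table_bound_learn[OF R(2) B'(1) _ that] q by simp
      then have "\<bar>table s y b - qs y b\<bar> \<le> ?D" if "b \<in> U" for y b
        using M'[OF that, of y] that
        by (intro order_trans[OF abs_triangle_ineq4] add_mono) (auto simp: table_bound_def)
      then show ?thesis
        by (auto simp: deviates_def not_less)
    qed
    then have "measure_pmf.prob (learn m (x, \<lambda>_ _. 0, q)) (deviates qs ?D) = 0"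
      by (intro prob_eq_0_support) auto
    then show "measure_pmf.prob (learn m (x, \<lambda>_ _. 0, q)) (deviates qs ?D) \<le> d"
      using d by simp
  qed
  define D where "D = ?D"
  have "0 < D"
    using B' M by (simp add: D_def add_pos_nonneg)
  have iter: "settles_within B' qs (((1 + \<beta>) / 2) ^ j * D)" for j
  proof (induction j)
    case 0
    then show ?case using start by (simp add: D_def)
  next
    case (Suc j)
    have "0 < ((1 + \<beta>) / 2) ^ j * D"
      using beta \<open>0 < D\<close> by (intro mult_pos_pos zero_less_power) auto
    from settles_within_contract[OF qs R(2) B'(1,2) this Suc.IH] show ?case
      by (simp only: power_Suc mult.assoc)
  qed
  have "(\<lambda>j. ((1 + \<beta>) / 2) ^ j) \<longlonglongrightarrow> 0"
    using beta by (intro LIMSEQ_power_zero) auto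
  then have "(\<lambda>j. ((1 + \<beta>) / 2) ^ j * D) \<longlonglongrightarrow> 0"
    by (rule tendsto_mult_left_zero)
  then have "\<forall>\<^sub>F j in sequentially. ((1 + \<beta>) / 2) ^ j * D < e"
    using \<open>0 < e\<close> by (rule order_tendstoD(2))
  then obtain j where "((1 + \<beta>) / 2) ^ j * D \<le> e"
    unfolding eventually_sequentially by (blast intro: less_imp_le)
  then show ?thesis
    using B'(3) by (rule settles_within_mono[OF iter])
qed

end

section \<open>Accuracy of an exploration phase\<close>

definition exploring ::
  "('i, 'x, 'u) game \<Rightarrow> ('i, 'x, 'u) algorithm \<Rightarrow> ('i \<Rightarrow> 'x \<Rightarrow> 'u) \<Rightarrow> 'i \<Rightarrow> 'x \<Rightarrow> 'u pmf" where
  "exploring G A \<pi> j = perturbed_policy G (experiment_prob A j) j (\<pi> j)"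

definition reward_kernel ::
  "('i::finite, 'x, 'u) game \<Rightarrow> 'i \<Rightarrow> ('i \<Rightarrow> 'x \<Rightarrow> 'u pmf) \<Rightarrow> 'x \<Rightarrow> 'u \<Rightarrow> (real \<times> 'x) pmf" where
  "reward_kernel G i \<sigma> x a = bind_pmf (Pi_pmf (UNIV - {i}) undefined (\<lambda>j. \<sigma> j x))
     (\<lambda>v. map_pmf (Pair (cost G i x (v(i := a)))) (transition G x (v(i := a))))"

lemma set_exploring:
  assumes "discounted_game G" "valid_algorithm G A" "\<pi> \<in> joint_det_policies G"
  shows "set_pmf (exploring G A \<pi> i x) = actions (G :: ('i::finite, 'x::finite, 'u) game) i"
proof -
  have fin: "finite (actions G i)" "actions G i \<noteq> {}" and act: "\<pi> i x \<in> actions G i"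
    and "0 < experiment_prob A i" "experiment_prob A i < 1"
    using assms by (auto simp: discounted_game_def valid_algorithm_def joint_det_policies_def
        det_policies_def)
  then have "set_pmf (exploring G A \<pi> i x) =
      (\<Union>b. set_pmf (if b then pmf_of_set (actions G i) else return_pmf (\<pi> i x)))"
    by (simp add: exploring_def perturbed_policy_def set_pmf_bernoulli)
  also have "\<dots> = insert (\<pi> i x) (set_pmf (pmf_of_set (actions G i)))"
    by (auto simp: UNIV_bool)
  also have "\<dots> = actions G i"
    using fin act by (auto simp: set_pmf_of_set)
  finally show ?thesis .
qed

lemma exploring_in_rand:
  assumes "discounted_game G" "valid_algorithm G A" "\<pi> \<in> joint_det_policies G"
  shows "exploring G A \<pi> \<in> joint_rand_policies (G :: ('i::finite, 'x::finite, 'u) game)"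
  using set_exploring[OF assms] by (simp add: joint_rand_policies_def rand_policies_def)

lemma transition_in_state_step:
  assumes "discounted_game G" "valid_algorithm G A" "\<pi> \<in> joint_det_policies G"
    and "u \<in> joint_actions G"
  shows "set_pmf (transition G x u) \<subseteq>
    set_pmf (state_step (G :: ('i::finite, 'x::finite, 'u) game) (exploring G A \<pi>) x)"
proof -
  have "u \<in> set_pmf (joint_decision (exploring G A \<pi>) x)"
    using assms(4) by (auto simp: joint_decision_def set_Pi_pmf PiE_dflt_def joint_actions_def
        set_exploring[OF assms(1-3)])
  then show ?thesis
    by (auto simp: state_step_def)
qed

lemma apply_decisions_in_rtrancl:
  assumes "discounted_game G" "valid_algorithm G A" "\<pi> \<in> joint_det_policies G"
    and "set us \<subseteq> joint_actions G" and "x' \<in> set_pmf (apply_decisions G us x)"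
  shows "(x, x') \<in> {(x, x'). x' \<in> set_pmf
    (state_step (G :: ('i::finite, 'x::finite, 'u) game) (exploring G A \<pi>) x)}\<^sup>*"
  using assms(4,5)
proof (induction us arbitrary: x)
  case (Cons u us)
  then obtain y where y: "y \<in> set_pmf (transition G x u)" "x' \<in> set_pmf (apply_decisions G us y)"
    by auto
  then show ?case
    using Cons transition_in_state_step[OF assms(1-3), of u x]
    by (auto intro!: converse_rtrancl_into_rtrancl[of x y])
qed simp

text \<open>
  Experimentation gives positive probability to every joint decision, so the reachability of all
  states by decision sequences becomes irreducibility of the state process.
\<close>

lemma learner_exploring:
  fixes G :: "('i::finite, 'x::finite, 'u) game"
  assumes G: "discounted_game G" and A: "valid_algorithm G A" and reach: "all_states_reachable G"
    and \<pi>: "\<pi> \<in> joint_det_policies G" and p: "p \<in> det_policies G i"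
  shows "learner (actions G i) (exploring G A \<pi> i) (reward_kernel G i (exploring G A \<pi>))
    (discount G i) (step_size A i) p"
proof
  let ?\<sigma> = "exploring G A \<pi>"
  note set = set_exploring[OF G A \<pi>]
  show "finite (actions G i)" "p x \<in> actions G i" "0 \<le> discount G i" "discount G i < 1"
    "0 \<le> step_size A i n" "step_size A i n \<le> 1"
    "filterlim (\<lambda>N. \<Sum>n<N. step_size A i n) at_top sequentially"
    "summable (\<lambda>n. (step_size A i n)\<^sup>2)" for x n
    using G A p by (auto simp: discounted_game_def valid_algorithm_def det_policies_def less_imp_le)
  show "set_pmf (exploring G A \<pi> i x) = actions G i" for x
    by (rule set)
  have "finite (set_pmf (Pi_pmf (UNIV - {i}) undefined (\<lambda>j. ?\<sigma> j x)))" for x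
    using G by (intro finite_set_Pi_pmf) (auto simp: set discounted_game_def)
  then show "finite (set_pmf (reward_kernel G i ?\<sigma> x a))" for x a
    by (auto simp: reward_kernel_def)
  have move: "bind_pmf (?\<sigma> i x) (\<lambda>a. map_pmf snd (reward_kernel G i ?\<sigma> x a)) =
      state_step G ?\<sigma> x" for x
    by (simp add: reward_kernel_def state_step_def joint_decision_split[of _ _ i] map_bind_pmf
        pmf.map_comp comp_def bind_assoc_pmf bind_map_pmf)
  show "(x, y) \<in> {(x, x'). x' \<in> set_pmf (bind_pmf (?\<sigma> i x)
      (\<lambda>a. map_pmf snd (reward_kernel G i ?\<sigma> x a)))}\<^sup>*" for x y
  proof -
    obtain us where "set us \<subseteq> joint_actions G" "0 < pmf (apply_decisions G us x) y"
      using reach unfolding all_states_reachable_def by blast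
    then show ?thesis
      unfolding move by (intro apply_decisions_in_rtrancl[OF G A \<pi>, of us]) (auto simp: pmf_positive_iff)
  qed
qed

lemma learner_backup:
  fixes G :: "('i::finite, 'x::finite, 'u) game"
  assumes G: "discounted_game G" and A: "valid_algorithm G A" and reach: "all_states_reachable G"
    and \<pi>: "\<pi> \<in> joint_det_policies G" and p: "p \<in> det_policies G i"
  shows "learner.backup (reward_kernel G i (exploring G A \<pi>)) (discount G i) p q x a =
    q_backup G i p (exploring G A \<pi>) q x a"
proof -
  interpret learner "actions G i" "exploring G A \<pi> i" "reward_kernel G i (exploring G A \<pi>)"
    "discount G i" "step_size A i" p
    by (rule learner_exploring[OF assms])
  have fin: "finite (set_pmf (Pi_pmf (UNIV - {i}) undefined (\<lambda>j. exploring G A \<pi> j x)))"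
    using G by (intro finite_set_Pi_pmf) (auto simp: set_exploring[OF G A \<pi>] discounted_game_def)
  have "measure_pmf.expectation (map_pmf (Pair c) t) (\<lambda>(r, x'). r + discount G i * q x' (p x')) =
      c + discount G i * (\<Sum>x'\<in>UNIV. pmf t x' * q x' (p x'))" for c t
  proof -
    have "measure_pmf.expectation (map_pmf (Pair c) t) (\<lambda>(r, x'). r + discount G i * q x' (p x')) =
        (\<Sum>x'\<in>UNIV. pmf t x' * (c + discount G i * q x' (p x')))"
      by (simp add: expectation_finite_UNIV)
    also have "\<dots> = (\<Sum>x'\<in>UNIV. pmf t x' * c) + discount G i * (\<Sum>x'\<in>UNIV. pmf t x' * q x' (p x'))"
      by (simp add: distrib_left sum.distrib sum_distrib_left mult_ac)
    also have "(\<Sum>x'\<in>UNIV. pmf t x' * c) = c"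
      by (simp add: sum_distrib_right[symmetric] sum_pmf_eq_1)
    finally show ?thesis .
  qed
  then show ?thesis
    unfolding backup_def q_backup_def reward_kernel_def using fin
    by (subst expectation_bind_finite) auto
qed

lemma num_visits_snoc:
  "num_visits i (vs @ [(x, u)]) =
    (num_visits i vs)(x := (num_visits i vs x)(u i := Suc (num_visits i vs x (u i))))"
  by (auto simp: num_visits_def fun_eq_iff)

lemma explore_eq_evolve: "explore G A n s = evolve (\<lambda>_. explore_step G A) 0 n s"
proof (induction n arbitrary: s)
  case (Suc n)
  then show ?case
    by (simp add: evolve_homogeneous[of _ "Suc 0"] cong: bind_pmf_cong)
qed simp

lemma explore_step_policies:
  "s' \<in> set_pmf (explore_step G A s) \<Longrightarrow> baseline s' = baseline s \<and> candidate s' = candidate s"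
  by (auto simp: explore_step_def Let_def)

lemma explore_policies:
  assumes "s' \<in> set_pmf (explore G A n s)"
  shows "baseline s' = baseline s" "candidate s' = candidate s"
proof -
  have "baseline s' = baseline s \<and> candidate s' = candidate s"
  proof (rule evolve_invariant[where I="\<lambda>s'. baseline s' = baseline s \<and> candidate s' = candidate s"])
    show "s' \<in> set_pmf (evolve (\<lambda>_. explore_step G A) 0 n s)"
      using assms by (simp add: explore_eq_evolve)
  qed (use explore_step_policies in fastforce)+
  then show "baseline s' = baseline s" "candidate s' = candidate s"
    by auto
qed

text \<open>
  One decision maker sees the others only through the distribution of its own cost and of the next
  state. This turns the phase into a run of the single learner above, for each of its two tables.
\<close>

definition learner_view where
  "learner_view i tab s = (env s, num_visits i (visited s), tab s i)"

lemma learner_view_step: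
  fixes G :: "('i::finite, 'x::finite, 'u) game"
  assumes L: "learner (actions G i) (exploring G A (baseline s) i)
      (reward_kernel G i (exploring G A (baseline s))) (discount G i) (step_size A i) (pol s i)"
    and which: "(pol, tab) \<in> {(baseline, base_table), (candidate, cand_table)}"
  shows "map_pmf (learner_view i tab) (explore_step G A s) =
    learner.learn_step (exploring G A (baseline s) i) (reward_kernel G i (exploring G A (baseline s)))
      (discount G i) (step_size A i) (pol s i) (learner_view i tab s)"
proof -
  interpret learner "actions G i" "exploring G A (baseline s) i"
    "reward_kernel G i (exploring G A (baseline s))" "discount G i" "step_size A i" "pol s i"
    by (rule L)
  let ?x = "env s" and ?n = "num_visits i (visited s)" and ?q = "tab s i"
  let ?d = "joint_decision (exploring G A (baseline s)) ?x"
  let ?next = "\<lambda>u x'. (x', ?n(?x := (?n ?x)(u i := Suc (?n ?x (u i)))),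
    mix_at ?q ?x (u i) (step_size A i (Suc (?n ?x (u i)))) (cost G i ?x u + discount G i * ?q x' (pol s i x')))"
  let ?step = "\<lambda>u j. step_size A j (num_visits j (visited s @ [(?x, u)]) ?x (u j))"
  let ?succ = "\<lambda>u x'. s\<lparr>env := x',
    base_table := (\<lambda>j. q_update G j (?step u j) (baseline s j) ?x u x' (base_table s j)),
    cand_table := (\<lambda>j. q_update G j (?step u j) (candidate s j) ?x u x' (cand_table s j)),
    visited := visited s @ [(?x, u)]\<rparr>"
  have "learner_view i tab (?succ u x') = ?next u x'" for u x'
    using which by (auto simp: learner_view_def num_visits_snoc q_update_def mix_at_def)
  moreover have "explore_step G A s = bind_pmf ?d (\<lambda>u. map_pmf (?succ u) (transition G ?x u))"
    by (simp add: explore_step_def Let_def map_pmf_def exploring_def[abs_def])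
  ultimately have "map_pmf (learner_view i tab) (explore_step G A s) =
      bind_pmf ?d (\<lambda>u. map_pmf (?next u) (transition G ?x u))"
    by (simp only: map_bind_pmf pmf.map_comp comp_def)
  also have "\<dots> = bind_pmf (exploring G A (baseline s) i ?x) (\<lambda>a.
      bind_pmf (Pi_pmf (UNIV - {i}) undefined (\<lambda>j. exploring G A (baseline s) j ?x)) (\<lambda>v.
        map_pmf (?next (v(i := a))) (transition G ?x (v(i := a)))))"
    by (simp add: joint_decision_split[of _ _ i] bind_assoc_pmf bind_map_pmf)
  also have "\<dots> = learn_step (learner_view i tab s)"
    by (simp add: learn_step_def learner_view_def reward_kernel_def map_bind_pmf pmf.map_comp comp_def)
  finally show ?thesis .
qed

text \<open>
  The entries of a compact set of tables are bounded, so one phase length serves for all resets.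
\<close>

lemma tables_accurate:
  fixes G :: "('i::finite, 'x::finite, 'u) game"
  assumes G: "discounted_game G" and A: "valid_algorithm G A" and reach: "all_states_reachable G"
    and \<pi>: "\<pi> \<in> joint_det_policies G" and p: "p \<in> det_policies G i" and "0 < e" "0 < d"
    and which: "(pol, tab) \<in> {(baseline, base_table), (candidate, cand_table)}"
  shows "\<exists>T. \<forall>n\<ge>T. \<forall>s. baseline s = \<pi> \<and> pol s i = p \<and> visited s = [] \<and> tab s i \<in> table_set A i \<longrightarrow>
    measure_pmf.prob (explore G A n s) {s'. \<exists>x. \<exists>a\<in>actions G i.
      e < \<bar>tab s' i x a - q_factor G i p (exploring G A \<pi>) x a\<bar>} \<le> d"
proof -
  let ?\<sigma> = "exploring G A \<pi>"
  let ?qs = "q_factor G i p ?\<sigma>"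
  note L = learner_exploring[OF G A reach \<pi> p]
  interpret learner "actions G i" "?\<sigma> i" "reward_kernel G i ?\<sigma>" "discount G i" "step_size A i" p
    by (rule L)
  have comp: "compact (table_set A i)"
    using A by (simp add: valid_algorithm_def)
  have "bounded ((\<lambda>q. q x a) ` table_set A i)" for x a
  proof (rule compact_imp_bounded[OF compact_continuous_image[OF _ comp]])
    have "continuous_on UNIV (\<lambda>q :: 'x \<Rightarrow> 'u \<Rightarrow> real. q x a)"
      by (rule continuous_on_product_then_coordinatewise[OF continuous_on_product_coordinates])
    then show "continuous_on (table_set A i) (\<lambda>q. q x a)"
      by (rule continuous_on_subset) simp
  qed
  then have "\<forall>z. \<exists>B. \<forall>q\<in>table_set A i. \<bar>q (fst z) (snd z)\<bar> \<le> B"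
    by (auto simp: bounded_real)
  from choice[OF this] obtain B where B: "\<And>z q. q \<in> table_set A i \<Longrightarrow> \<bar>q (fst z) (snd z)\<bar> \<le> B z"
    by blast
  define B' where "B' = Max (B ` (UNIV \<times> actions G i))"
  have B': "table_bound B' q" if "q \<in> table_set A i" for q
    unfolding table_bound_def
  proof (intro allI ballI)
    fix x a assume "a \<in> actions G i"
    then have "B (x, a) \<le> B'"
      unfolding B'_def using finite_U by (intro Max_ge) auto
    with B[OF that, of "(x, a)"] show "\<bar>q x a\<bar> \<le> B'" by simp
  qed
  have "?qs x a = backup ?qs x a" if "a \<in> actions G i" for x a
    using q_factor_backup[OF G exploring_in_rand[OF G A \<pi>] p that]
    by (simp add: learner_backup[OF G A reach \<pi> p])
  then have "settles_within B' ?qs e"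
    using \<open>0 < e\<close> by (rule tables_converge)
  then obtain T where T: "\<And>n x q. T \<le> n \<Longrightarrow> table_bound B' q \<Longrightarrow>
      measure_pmf.prob (learn n (x, \<lambda>_ _. 0, q)) (deviates ?qs e) \<le> d"
    using \<open>0 < d\<close> unfolding settles_within_def by blast
  show ?thesis
  proof (intro exI allI impI, elim conjE)
    fix n and s :: "('i, 'x, 'u) phase_state"
    assume n: "T \<le> n" and s: "baseline s = \<pi>" "pol s i = p" "visited s = []" "tab s i \<in> table_set A i"
    have "map_pmf (learner_view i tab) (evolve (\<lambda>_. explore_step G A) 0 n s) =
        learn n (learner_view i tab s)"
    proof (rule evolve_map[where I="\<lambda>s. baseline s = \<pi> \<and> pol s i = p"])
      show "baseline s'' = \<pi> \<and> pol s'' i = p"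
        if "baseline s' = \<pi> \<and> pol s' i = p" "s'' \<in> set_pmf (explore_step G A s')" for s' s''
        using explore_step_policies[OF that(2)] that(1) which by auto
      show "map_pmf (learner_view i tab) (explore_step G A s') = learn_step (learner_view i tab s')"
        if "baseline s' = \<pi> \<and> pol s' i = p" for s'
        using learner_view_step[of G i A s' pol tab] L that which by simp
    qed (use s in auto)
    then have view: "map_pmf (learner_view i tab) (explore G A n s) = learn n (env s, \<lambda>_ _. 0, tab s i)"
      by (simp add: explore_eq_evolve learner_view_def s num_visits_def[abs_def])
    have "{s'. \<exists>x. \<exists>a\<in>actions G i. e < \<bar>tab s' i x a - ?qs x a\<bar>} = learner_view i tab -` deviates ?qs e"
      by (auto simp: learner_view_def deviates_def)
    then have "measure_pmf.prob (explore G A n s)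
        {s'. \<exists>x. \<exists>a\<in>actions G i. e < \<bar>tab s' i x a - ?qs x a\<bar>} =
      measure_pmf.prob (map_pmf (learner_view i tab) (explore G A n s)) (deviates ?qs e)"
      by simp
    also have "\<dots> \<le> d"
      unfolding view by (rule T[OF n B'[OF s(4)]])
    finally show "measure_pmf.prob (explore G A n s)
        {s'. \<exists>x. \<exists>a\<in>actions G i. e < \<bar>tab s' i x a - ?qs x a\<bar>} \<le> d" .
  qed
qed

section \<open>Accepted candidates are strict better replies\<close>

lemma finite_det_policies:
  "discounted_game G \<Longrightarrow> finite (det_policies (G :: ('i::finite, 'x::finite, 'u) game) i)"
  using finite_PiE[of "UNIV :: 'x set" "\<lambda>_. actions G i"]
  by (simp add: det_policies_def discounted_game_def PiE_UNIV_domain Pi_def)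

lemma finite_joint_det_policies:
  "discounted_game G \<Longrightarrow> finite (joint_det_policies (G :: ('i::finite, 'x::finite, 'u) game))"
  using finite_PiE[of "UNIV :: 'i set" "det_policies G"] finite_det_policies[of G]
  by (simp add: joint_det_policies_def PiE_UNIV_domain Pi_def)

lemma finite_value_gaps:
  assumes G: "discounted_game (G :: ('i::finite, 'x::finite, 'u) game)"
  shows "finite (value_gaps G)"
proof -
  let ?f = "\<lambda>(i, x, p, p', \<pi>). \<bar>q_factor G i p (embed_joint \<pi>) x (p x) -
    q_factor G i p' (embed_joint \<pi>) x (p' x)\<bar>"
  let ?D = "\<Union>i. det_policies G i"
  have "value_gaps G \<subseteq> ?f ` (UNIV \<times> UNIV \<times> ?D \<times> ?D \<times> joint_det_policies G)"
  proof
    fix g assume "g \<in> value_gaps G"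
    then obtain i x p p' \<pi> where g: "g = ?f (i, x, p, p', \<pi>)"
      and "p \<in> det_policies G i" "p' \<in> det_policies G i" "\<pi> \<in> joint_det_policies G"
      unfolding value_gaps_def by auto
    then have "(i, x, p, p', \<pi>) \<in> UNIV \<times> UNIV \<times> ?D \<times> ?D \<times> joint_det_policies G"
      by blast
    then show "g \<in> ?f ` (UNIV \<times> UNIV \<times> ?D \<times> ?D \<times> joint_det_policies G)"
      unfolding g by (rule imageI)
  qed
  moreover have "finite (UNIV \<times> UNIV \<times> ?D \<times> ?D \<times> joint_det_policies G :: ('i \<times> 'x \<times> _) set)"
    using finite_det_policies[OF G] finite_joint_det_policies[OF G] by simp
  ultimately show ?thesis
    by (rule finite_surj[rotated])
qed

lemma q_factor_own_policy:
  assumes "discounted_game (G :: ('i::finite, 'x::finite, 'u) game)" "\<pi> \<in> joint_det_policies G"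
  shows "q_factor G i (\<pi> i) (embed_joint \<pi>) x (\<pi> i x) = total_cost G i (embed_joint \<pi>) x"
proof -
  have "(embed_joint \<pi>)(i := embed_policy (\<pi> i)) = embed_joint \<pi>"
    by (auto simp: embed_joint_def)
  then show ?thesis
    using q_factor_value[OF assms(1) embed_joint_in_rand[OF assms(2)], of "\<pi> i" i x] assms(2)
    by (simp add: joint_det_policies_def)
qed

lemma delta_check_le:
  assumes G: "discounted_game (G :: ('i::finite, 'x::finite, 'u) game)"
    and \<pi>: "\<pi> \<in> joint_det_policies G" and p: "p \<in> det_policies G i"
    and "total_cost G i ((embed_joint \<pi>)(i := embed_policy p)) x \<noteq> total_cost G i (embed_joint \<pi>) x"
  shows "delta_check G \<le>
    \<bar>total_cost G i ((embed_joint \<pi>)(i := embed_policy p)) x - total_cost G i (embed_joint \<pi>) x\<bar>"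
proof -
  let ?q = "\<lambda>p. q_factor G i p (embed_joint \<pi>) x (p x)"
  have "\<pi> i \<in> det_policies G i"
    using \<pi> by (simp add: joint_det_policies_def)
  moreover have q: "?q p = total_cost G i ((embed_joint \<pi>)(i := embed_policy p)) x"
    "?q (\<pi> i) = total_cost G i (embed_joint \<pi>) x"
    using q_factor_value[OF G embed_joint_in_rand[OF \<pi>] p] q_factor_own_policy[OF G \<pi>] by auto
  ultimately have "\<bar>?q p - ?q (\<pi> i)\<bar> \<in> value_gaps G"
    using assms(4) unfolding value_gaps_def
    by (intro DiffI CollectI exI[of _ i] exI[of _ x] exI[of _ p] exI[of _ "\<pi> i"] exI[of _ \<pi>])
       (auto simp: \<pi> p)
  then show ?thesis
    unfolding delta_check_def q[symmetric] using finite_value_gaps[OF G] by (rule Min_le[rotated])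
qed

definition improves :: "('i::finite, 'x, 'u) game \<Rightarrow> ('i, 'x, 'u) phase_state \<Rightarrow> 'i \<Rightarrow> bool" where
  "improves G s i \<longleftrightarrow> candidate s i \<in> strict_better_replies G i (embed_joint (baseline s))"

text \<open>
  True cost differences are either zero or at least \<open>delta_check G\<close> in absolute value. If the
  difference of the estimates is off by less than the tolerance and by less than its distance to
  \<open>delta_check G\<close>, then comparing with the tolerance decides the sign of the true difference.
\<close>

lemma accepts_iff_improves:
  assumes G: "discounted_game (G :: ('i::finite, 'x::finite, 'u) game)"
    and s: "baseline s \<in> joint_det_policies G" "candidate s i \<in> det_policies G i"
    and base: "\<And>x. \<bar>base_table s i x (baseline s i x) - total_cost G i (embed_joint (baseline s)) x\<bar>
      < 1/2 * min (tolerance A i) (delta_check G - tolerance A i)"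
    and cand: "\<And>x. \<bar>cand_table s i x (candidate s i x) -
        total_cost G i ((embed_joint (baseline s))(i := embed_policy (candidate s i))) x\<bar>
      < 1/2 * min (tolerance A i) (delta_check G - tolerance A i)"
  shows "accepts A s i \<longleftrightarrow> improves G s i"
proof -
  let ?d = "tolerance A i" and ?D = "delta_check G"
  define b where "b = total_cost G i (embed_joint (baseline s))"
  define c where "c = total_cost G i ((embed_joint (baseline s))(i := embed_policy (candidate s i)))"
  define b' where "b' x = base_table s i x (baseline s i x)" for x
  define c' where "c' x = cand_table s i x (candidate s i x)" for x
  have "c x = b x \<or> ?D \<le> \<bar>c x - b x\<bar>" for x
    using delta_check_le[OF G s] unfolding b_def c_def by blast
  then have gap: "c x = b x \<or> c x \<le> b x - ?D \<or> b x + ?D \<le> c x" for x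
    by (smt (verit))
  have near: "\<bar>b' x - b x\<bar> < ?d / 2" "\<bar>b' x - b x\<bar> < (?D - ?d) / 2"
    "\<bar>c' x - c x\<bar> < ?d / 2" "\<bar>c' x - c x\<bar> < (?D - ?d) / 2" for x
    using base[of x] cand[of x] by (auto simp: b_def c_def b'_def c'_def)
  have le: "c' x \<le> b' x + ?d \<longleftrightarrow> c x \<le> b x" for x
    using gap[of x] near[of x] unfolding abs_less_iff by (elim disjE) auto
  have less: "c' x \<le> b' x - ?d \<longleftrightarrow> c x < b x" for x
    using gap[of x] near[of x] unfolding abs_less_iff by (elim disjE) auto
  show ?thesis
    using s(2) le less
    by (auto simp: accepts_def improves_def strict_better_replies_def better_replies_def
        b_def c_def b'_def c'_def)
qed

definition valid_start ::
  "('i, 'x, 'u) game \<Rightarrow> ('i, 'x, 'u) algorithm \<Rightarrow> ('i, 'x, 'u) phase_state \<Rightarrow> bool" where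
  "valid_start G A s \<longleftrightarrow> baseline s \<in> joint_det_policies G \<and> candidate s \<in> joint_det_policies G \<and>
     (\<forall>i. candidate s i \<noteq> baseline s i) \<and> visited s = [] \<and>
     (\<forall>i. base_table s i \<in> table_set A i \<and> cand_table s i \<in> table_set A i)"

definition accurate ::
  "('i::finite, 'x, 'u) game \<Rightarrow> ('i, 'x, 'u) algorithm \<Rightarrow> ('i, 'x, 'u) phase_state \<Rightarrow> bool" where
  "accurate G A s \<longleftrightarrow> (\<forall>i. accepts A s i \<longleftrightarrow> improves G s i)"

lemma le_table_dist:
  assumes "discounted_game (G :: ('i::finite, 'x::finite, 'u) game)" "u \<in> actions G i"
  shows "\<bar>q x u - q' x u\<bar> \<le> table_dist G i q q'"
proof -
  have "{\<bar>q x u - q' x u\<bar> | x u. u \<in> actions G i} = (\<lambda>(x, u). \<bar>q x u - q' x u\<bar>) ` (UNIV \<times> actions G i)"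
    by auto
  then have "finite {\<bar>q x u - q' x u\<bar> | x u. u \<in> actions G i}"
    using assms(1) by (simp add: discounted_game_def)
  then show ?thesis
    unfolding table_dist_def using assms(2) by (intro Max_ge) auto
qed

locale learning_game =
  fixes G :: "('i::finite, 'x::finite, 'u) game" and A :: "('i, 'x, 'u) algorithm" and \<rho>\<^sub>c :: real
  assumes game: "discounted_game G"
    and acyclic: "weakly_acyclic G"
    and algorithm: "valid_algorithm G A"
    and reachable: "all_states_reachable G"
    and tolerance: "0 < tolerance A i" "tolerance A i < delta_check G"
    and perturbation: "rho_check_bound G (tolerance A) \<rho>\<^sub>c"
    and experiment_small: "experiment_prob A i < \<rho>\<^sub>c"
begin

lemma perturbation_small:
  assumes "\<pi> \<in> joint_det_policies G" "p \<in> det_policies G i"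
  shows "table_dist G i (q_factor G i p (embed_joint \<pi>)) (q_factor G i p (exploring G A \<pi>))
    < 1/2 * min (tolerance A i) (delta_check G - tolerance A i)"
proof -
  have small: "\<forall>i. 0 < experiment_prob A i \<and> experiment_prob A i < 1 \<and> experiment_prob A i \<le> \<rho>\<^sub>c"
    using algorithm experiment_small by (auto simp: valid_algorithm_def less_imp_le)
  from perturbation[unfolded rho_check_bound_def, THEN conjunct2, THEN spec, THEN mp, OF small,
      rule_format, OF assms]
  show ?thesis
    unfolding Let_def exploring_def[abs_def] by (rule le_less_trans[OF max.cobounded2])
qed

text \<open>
  The perturbation of the others leaves a positive margin below the required precision, and half of
  this margin is the precision demanded of the tables.
\<close>

lemma value_estimate_accurate:
  assumes \<pi>: "\<pi> \<in> joint_det_policies G" and p: "p \<in> det_policies G i" and "0 < d"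
    and which: "(pol, tab) \<in> {(baseline, base_table), (candidate, cand_table)}"
  shows "\<exists>T. \<forall>n\<ge>T. \<forall>s. baseline s = \<pi> \<and> pol s i = p \<and> visited s = [] \<and> tab s i \<in> table_set A i \<longrightarrow>
    measure_pmf.prob (explore G A n s)
      {s'. \<exists>x. \<not> \<bar>tab s' i x (p x) - q_factor G i p (embed_joint \<pi>) x (p x)\<bar>
        < 1/2 * min (tolerance A i) (delta_check G - tolerance A i)} \<le> d"
proof -
  let ?q = "q_factor G i p (embed_joint \<pi>)" and ?q' = "q_factor G i p (exploring G A \<pi>)"
  define h where "h = 1/2 * min (tolerance A i) (delta_check G - tolerance A i)"
  define e where "e = (h - table_dist G i ?q ?q') / 2"
  have e: "0 < e"
    using perturbation_small[OF \<pi> p] by (simp add: e_def h_def)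
  have px: "p x \<in> actions G i" for x
    using p by (simp add: det_policies_def)
  from tables_accurate[OF game algorithm reachable \<pi> p e \<open>0 < d\<close> which]
  obtain T where T: "\<And>n s. T \<le> n \<Longrightarrow>
      baseline s = \<pi> \<and> pol s i = p \<and> visited s = [] \<and> tab s i \<in> table_set A i \<Longrightarrow>
      measure_pmf.prob (explore G A n s) {s'. \<exists>x. \<exists>a\<in>actions G i. e < \<bar>tab s' i x a - ?q' x a\<bar>} \<le> d"
    by blast
  have sub: "{s'. \<exists>x. \<not> \<bar>tab s' i x (p x) - ?q x (p x)\<bar> < h} \<subseteq>
      {s'. \<exists>x. \<exists>a\<in>actions G i. e < \<bar>tab s' i x a - ?q' x a\<bar>}"
  proof safe
    fix s' x assume far: "\<not> \<bar>tab s' i x (p x) - ?q x (p x)\<bar> < h"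
    have "2 * e = h - table_dist G i ?q ?q'"
      by (simp add: e_def)
    then have "\<bar>?q x (p x) - ?q' x (p x)\<bar> \<le> h - 2 * e"
      using le_table_dist[OF game px[of x], of ?q x ?q'] by linarith
    then have "e < \<bar>tab s' i x (p x) - ?q' x (p x)\<bar>"
      using far e by linarith
    then show "\<exists>x. \<exists>a\<in>actions G i. e < \<bar>tab s' i x a - ?q' x a\<bar>"
      using px[of x] by blast
  qed
  have "measure_pmf.prob (explore G A n s) {s'. \<exists>x. \<not> \<bar>tab s' i x (p x) - ?q x (p x)\<bar> < h} \<le> d"
    if "T \<le> n" "baseline s = \<pi> \<and> pol s i = p \<and> visited s = [] \<and> tab s i \<in> table_set A i" for n s
    using T[OF that] measure_pmf.finite_measure_mono[OF sub, of "explore G A n s"] by simp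
  then show ?thesis
    unfolding h_def by blast
qed

lemma decision_accurate:
  assumes \<pi>: "\<pi> \<in> joint_det_policies G" and \<pi>': "\<pi>' \<in> joint_det_policies G" and "0 < d"
  shows "\<exists>T. \<forall>n\<ge>T. \<forall>s. valid_start G A s \<and> baseline s = \<pi> \<and> candidate s = \<pi>' \<longrightarrow>
    measure_pmf.prob (explore G A n s) {s'. \<not> (accepts A s' i \<longleftrightarrow> improves G s' i)} \<le> d"
proof -
  have pi: "\<pi> i \<in> det_policies G i" "\<pi>' i \<in> det_policies G i"
    using \<pi> \<pi>' by (auto simp: joint_det_policies_def)
  let ?h = "1/2 * min (tolerance A i) (delta_check G - tolerance A i)"
  let ?bad = "\<lambda>tab p. {s'. \<exists>x. \<not> \<bar>tab s' i x (p x) - q_factor G i p (embed_joint \<pi>) x (p x)\<bar> < ?h}"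
  obtain T1 where T1: "\<And>n s. T1 \<le> n \<Longrightarrow>
      baseline s = \<pi> \<and> baseline s i = \<pi> i \<and> visited s = [] \<and> base_table s i \<in> table_set A i \<Longrightarrow>
      measure_pmf.prob (explore G A n s) (?bad base_table (\<pi> i)) \<le> d / 2"
    using value_estimate_accurate[OF \<pi> pi(1) half_gt_zero[OF \<open>0 < d\<close>], of baseline base_table] by auto
  obtain T2 where T2: "\<And>n s. T2 \<le> n \<Longrightarrow>
      baseline s = \<pi> \<and> candidate s i = \<pi>' i \<and> visited s = [] \<and> cand_table s i \<in> table_set A i \<Longrightarrow>
      measure_pmf.prob (explore G A n s) (?bad cand_table (\<pi>' i)) \<le> d / 2"
    using value_estimate_accurate[OF \<pi> pi(2) half_gt_zero[OF \<open>0 < d\<close>], of candidate cand_table] by auto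
  show ?thesis
  proof (intro exI allI impI)
    fix n s assume n: "max T1 T2 \<le> n"
      and s: "valid_start G A s \<and> baseline s = \<pi> \<and> candidate s = \<pi>'"
    have "measure_pmf.prob (explore G A n s) {s'. \<not> (accepts A s' i \<longleftrightarrow> improves G s' i)} \<le>
        measure_pmf.prob (explore G A n s) (?bad base_table (\<pi> i) \<union> ?bad cand_table (\<pi>' i))"
    proof (rule prob_mono_support, rule ccontr)
      fix s' assume s': "s' \<in> set_pmf (explore G A n s)"
        and wrong: "s' \<in> {s'. \<not> (accepts A s' i \<longleftrightarrow> improves G s' i)}"
        and near: "s' \<notin> ?bad base_table (\<pi> i) \<union> ?bad cand_table (\<pi>' i)"
      have pol: "baseline s' = \<pi>" "candidate s' = \<pi>'"
        using explore_policies[OF s'] s by auto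
      have "accepts A s' i \<longleftrightarrow> improves G s' i"
      proof (rule accepts_iff_improves[OF game])
        show "\<bar>base_table s' i x (baseline s' i x) - total_cost G i (embed_joint (baseline s')) x\<bar> < ?h" for x
          using near unfolding pol q_factor_own_policy[OF game \<pi>, of i x, symmetric] by blast
        show "\<bar>cand_table s' i x (candidate s' i x) -
            total_cost G i ((embed_joint (baseline s'))(i := embed_policy (candidate s' i))) x\<bar> < ?h" for x
          using near unfolding pol q_factor_value[OF game embed_joint_in_rand[OF \<pi>] pi(2), of x, symmetric]
          by blast
      qed (use pol \<pi> pi in auto)
      with wrong show False by simp
    qed
    also have "\<dots> \<le> d / 2 + d / 2"
      using n s by (intro order_trans[OF measure_Un_le] add_mono T1 T2) (auto simp: valid_start_def)
    finally show "measure_pmf.prob (explore G A n s)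
        {s'. \<not> (accepts A s' i \<longleftrightarrow> improves G s' i)} \<le> d" by simp
  qed
qed

definition phase_reliable :: "real \<Rightarrow> nat \<Rightarrow> bool" where
  "phase_reliable d n \<longleftrightarrow> (\<forall>s. valid_start G A s \<longrightarrow>
     measure_pmf.prob (explore G A n s) {s'. \<not> accurate G A s'} \<le> d)"

text \<open>
  The length is uniform because there are finitely many decision makers and joint policies, and
  each of the underlying estimates is uniform in the remaining components of the state.
\<close>

lemma long_phases_reliable:
  assumes "0 < d"
  shows "\<exists>T. \<forall>n\<ge>T. phase_reliable d n"
proof -
  define d' where "d' = d / CARD('i)"
  have d': "0 < d'"
    using assms by (simp add: d'_def)
  let ?S = "joint_det_policies G \<times> joint_det_policies G \<times> (UNIV :: 'i set)"
  have fin: "finite ?S"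
    using finite_joint_det_policies[OF game] by simp
  have "\<forall>z\<in>?S. \<exists>T. \<forall>n\<ge>T. \<forall>s.
      valid_start G A s \<and> baseline s = fst z \<and> candidate s = fst (snd z) \<longrightarrow>
      measure_pmf.prob (explore G A n s)
        {s'. \<not> (accepts A s' (snd (snd z)) \<longleftrightarrow> improves G s' (snd (snd z)))} \<le> d'"
    using decision_accurate[OF _ _ d'] by (simp add: mem_Times_iff)
  from bchoice[OF this] obtain T where T: "\<And>z n s. z \<in> ?S \<Longrightarrow> T z \<le> n \<Longrightarrow>
      valid_start G A s \<and> baseline s = fst z \<and> candidate s = fst (snd z) \<Longrightarrow>
      measure_pmf.prob (explore G A n s)
        {s'. \<not> (accepts A s' (snd (snd z)) \<longleftrightarrow> improves G s' (snd (snd z)))} \<le> d'"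
    by blast
  have "phase_reliable d n" if n: "Max (T ` ?S) \<le> n" for n
    unfolding phase_reliable_def
  proof (intro allI impI)
    fix s assume s: "valid_start G A s"
    have le: "measure_pmf.prob (explore G A n s) {s'. \<not> (accepts A s' i \<longleftrightarrow> improves G s' i)} \<le> d'" for i
    proof -
      have z: "(baseline s, candidate s, i) \<in> ?S"
        using s by (simp add: valid_start_def)
      then have "T (baseline s, candidate s, i) \<le> n"
        using fin by (intro order_trans[OF Max_ge n]) auto
      from T[OF z this, of s] s show ?thesis by simp
    qed
    have "{s'. \<not> accurate G A s'} = (\<Union>i. {s'. \<not> (accepts A s' i \<longleftrightarrow> improves G s' i)})"
      by (auto simp: accurate_def)
    then have "measure_pmf.prob (explore G A n s) {s'. \<not> accurate G A s'} \<le>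
        (\<Sum>i\<in>UNIV. measure_pmf.prob (explore G A n s) {s'. \<not> (accepts A s' i \<longleftrightarrow> improves G s' i)})"
      using measure_pmf.finite_measure_subadditive_finite[of UNIV
          "\<lambda>i. {s'. \<not> (accepts A s' i \<longleftrightarrow> improves G s' i)}" "explore G A n s"] by simp
    also have "\<dots> \<le> (\<Sum>i\<in>(UNIV :: 'i set). d')"
      using le by (intro sum_mono)
    also have "\<dots> = d"
      by (simp add: d'_def)
    finally show "measure_pmf.prob (explore G A n s) {s'. \<not> accurate G A s'} \<le> d" .
  qed
  then show ?thesis by blast
qed

end

section \<open>Progress along strict better reply paths\<close>

context learning_game
begin

primrec near_equilibrium :: "nat \<Rightarrow> ('i \<Rightarrow> 'x \<Rightarrow> 'u) set" where
  "near_equilibrium 0 = det_equilibria G"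
| "near_equilibrium (Suc m) = near_equilibrium m \<union>
     {\<pi> \<in> joint_det_policies G. \<exists>i. \<exists>q\<in>strict_better_replies G i (embed_joint \<pi>).
        q \<noteq> \<pi> i \<and> \<pi>(i := q) \<in> near_equilibrium m}"

lemma near_equilibrium_mono: "m \<le> n \<Longrightarrow> near_equilibrium m \<subseteq> near_equilibrium n"
  by (rule lift_Suc_mono_le) auto

lemma path_near_equilibrium:
  assumes path: "strict_better_reply_path G n \<phi>" and last: "\<phi> n \<in> det_equilibria G" and "j \<le> n"
  shows "\<phi> (n - j) \<in> near_equilibrium j"
  using \<open>j \<le> n\<close>
proof (induction j)
  case 0
  then show ?case using last by simp
next
  case (Suc j)
  let ?k = "n - Suc j"
  have k: "?k < n" "Suc ?k = n - j"
    using Suc.prems by auto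
  obtain i where i: "\<phi> (Suc ?k) i \<noteq> \<phi> ?k i" "\<forall>j. j \<noteq> i \<longrightarrow> \<phi> (Suc ?k) j = \<phi> ?k j"
    "\<phi> (Suc ?k) i \<in> strict_better_replies G i (embed_joint (\<phi> ?k))"
    using path k(1) unfolding strict_better_reply_path_def by blast
  have "(\<phi> ?k)(i := \<phi> (Suc ?k) i) = \<phi> (Suc ?k)"
    using i(2) by auto
  then have "(\<phi> ?k)(i := \<phi> (Suc ?k) i) \<in> near_equilibrium j"
    using Suc k(2) by simp
  moreover have "\<phi> ?k \<in> joint_det_policies G"
    using path by (simp add: strict_better_reply_path_def)
  ultimately show ?case
    using i by auto
qed

lemma all_near_equilibrium: "\<exists>L. joint_det_policies G \<subseteq> near_equilibrium L"
proof -
  have "\<forall>\<pi>\<in>joint_det_policies G. \<exists>n. \<pi> \<in> near_equilibrium n"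
  proof
    fix \<pi> assume "\<pi> \<in> joint_det_policies G"
    then obtain n \<phi> where "strict_better_reply_path G n \<phi>" "\<phi> 0 = \<pi>" "\<phi> n \<in> det_equilibria G"
      using acyclic unfolding weakly_acyclic_def by blast
    then show "\<exists>n. \<pi> \<in> near_equilibrium n"
      using path_near_equilibrium[of n \<phi> n] by auto
  qed
  from bchoice[OF this] obtain n where n: "\<And>\<pi>. \<pi> \<in> joint_det_policies G \<Longrightarrow> \<pi> \<in> near_equilibrium (n \<pi>)"
    by blast
  have "\<pi> \<in> near_equilibrium (Max (n ` joint_det_policies G))" if "\<pi> \<in> joint_det_policies G" for \<pi>
    using n[OF that] near_equilibrium_mono[OF Max_ge] that finite_joint_det_policies[OF game] by blast
  then show ?thesis by blast
qed

text \<open>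
  The candidates of a phase are drawn before it begins. Progress in the next phase is therefore
  possible only if the candidate of a suitable decision maker is already the next policy on a path.
\<close>

fun ready :: "nat \<Rightarrow> ('i \<Rightarrow> 'x \<Rightarrow> 'u) \<Rightarrow> ('i \<Rightarrow> 'x \<Rightarrow> 'u) \<Rightarrow> bool" where
  "ready 0 \<pi> \<pi>' \<longleftrightarrow> \<pi> \<in> det_equilibria G"
| "ready (Suc m) \<pi> \<pi>' \<longleftrightarrow> \<pi> \<in> det_equilibria G \<or>
     (\<exists>i. \<pi>' i \<in> strict_better_replies G i (embed_joint \<pi>) \<and> \<pi>(i := \<pi>' i) \<in> near_equilibrium m)"

lemma ready_Suc: "ready m \<pi> \<pi>' \<Longrightarrow> ready (Suc m) \<pi> \<pi>'"
  by (cases m) auto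

lemma ready_choice:
  assumes "\<pi> \<in> near_equilibrium m" and "\<psi> \<in> joint_det_policies G" "\<And>i. \<psi> i \<noteq> \<pi> i"
  shows "\<exists>\<pi>'\<in>joint_det_policies G. (\<forall>i. \<pi>' i \<noteq> \<pi> i) \<and> ready m \<pi> \<pi>'"
  using assms(1)
proof (induction m)
  case 0
  then show ?case using assms by auto
next
  case (Suc m)
  show ?case
  proof (cases "\<pi> \<in> near_equilibrium m")
    case True
    then show ?thesis
      using Suc.IH ready_Suc by blast
  next
    case False
    then obtain i q where q: "q \<in> strict_better_replies G i (embed_joint \<pi>)" "q \<noteq> \<pi> i"
        "\<pi>(i := q) \<in> near_equilibrium m"
      using Suc.prems by auto
    have "\<psi>(i := q) \<in> joint_det_policies G"
      using q(1) assms(2)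
      by (auto simp: strict_better_replies_def better_replies_def joint_det_policies_def)
    moreover have "ready (Suc m) \<pi> (\<psi>(i := q))"
      using q by auto
    ultimately show ?thesis
      using q(2) assms(3) by (intro bexI[of _ "\<psi>(i := q)"]) auto
  qed
qed

lemma equilibrium_no_improvement:
  assumes "baseline s \<in> det_equilibria G"
  shows "\<not> improves G s i"
proof
  assume "improves G s i"
  then obtain x where q: "candidate s i \<in> det_policies G i" and
    "total_cost G i ((embed_joint (baseline s))(i := embed_policy (candidate s i))) x <
      total_cost G i (embed_joint (baseline s)) x"
    by (auto simp: improves_def strict_better_replies_def better_replies_def)
  moreover have "total_cost G i (embed_joint (baseline s)) x \<le>
      total_cost G i ((embed_joint (baseline s))(i := embed_policy (candidate s i))) x"
    using assms embed_policy_in_rand[OF q] by (auto simp: det_equilibria_def equilibrium_def)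
  ultimately show False by simp
qed


section \<open>The transition between phases\<close>

text \<open>
  A lower bound on the probability of any particular outcome of the policy updates among those that
  the acceptance tests permit: each decision maker keeps or changes its policy with probability at
  least the minimum, and draws its candidate from fewer than all its policies.
\<close>

definition update_chance :: real where
  "update_chance = (\<Prod>i\<in>UNIV. min (inertia A i) (1 - inertia A i) / card (det_policies G i))"

lemma det_policies_nonempty: "det_policies G i \<noteq> {}"
proof -
  obtain a where "a \<in> actions G i"
    using game by (auto simp: discounted_game_def)
  then have "(\<lambda>_. a) \<in> det_policies G i"
    by (simp add: det_policies_def)
  then show ?thesis by blast
qed

lemma inertia_bounds: "0 < inertia A i" "inertia A i < 1"
  using algorithm by (auto simp: valid_algorithm_def)

lemma card_det_policies: "0 < card (det_policies G i)"
  using finite_det_policies[OF game] det_policies_nonempty by (simp add: card_gt_0_iff)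

lemma update_chance: "0 < update_chance" "update_chance \<le> 1"
proof -
  have pos: "0 < min (inertia A i) (1 - inertia A i) / card (det_policies G i)" for i
    using inertia_bounds[of i] card_det_policies[of i] by simp
  have "min (inertia A i) (1 - inertia A i) / card (det_policies G i) \<le> 1 / 1" for i
    using inertia_bounds[of i] card_det_policies[of i] by (intro frac_le) auto
  with pos show "update_chance \<le> 1"
    unfolding update_chance_def by (intro prod_le_1 conjI less_imp_le[OF pos]) auto
  show "0 < update_chance"
    unfolding update_chance_def using pos by (intro prod_pos)
qed

lemma new_policies_chance:
  assumes p: "p = baseline s i \<or> (accepts A s i \<and> p = candidate s i)"
    and p': "p' \<in> det_policies G i" "p' \<noteq> p"
  shows "min (inertia A i) (1 - inertia A i) / card (det_policies G i) \<le> pmf (new_policies G A s i) (p, p')"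
proof -
  let ?stay = "if accepts A s i
    then map_pmf (\<lambda>stay. if stay then baseline s i else candidate s i) (bernoulli_pmf (inertia A i))
    else return_pmf (baseline s i)"
  let ?draw = "\<lambda>p. map_pmf (Pair p) (pmf_of_set (det_policies G i - {p}))"
  let ?m = "min (inertia A i) (1 - inertia A i)"
  have fin: "finite (det_policies G i - {p})" "det_policies G i - {p} \<noteq> {}"
    using finite_det_policies[OF game] p' by auto
  have choose: "?m \<le> measure_pmf.prob ?stay {p}"
  proof (cases "accepts A s i")
    case True
    obtain b where b: "p = (if b then baseline s i else candidate s i)"
      using p by (metis (full_types))
    have "?m \<le> measure_pmf.prob (bernoulli_pmf (inertia A i)) {b}"
      using inertia_bounds[of i] by (cases b) (auto simp: measure_pmf_single)
    also have "\<dots> \<le> measure_pmf.prob ?stay {p}"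
      using True b by (auto intro!: measure_pmf.finite_measure_mono)
    finally show ?thesis .
  next
    case False
    then show ?thesis
      using p inertia_bounds[of i] by auto
  qed
  have "?m / card (det_policies G i) = ?m * (1 / card (det_policies G i))"
    by simp
  also have "\<dots> \<le> measure_pmf.prob ?stay {p} * (1 / card (det_policies G i - {p}))"
  proof (intro mult_mono choose divide_left_mono)
    show "real (card (det_policies G i - {p})) \<le> real (card (det_policies G i))"
      using finite_det_policies[OF game] by (simp add: card_mono)
    show "0 < real (card (det_policies G i)) * real (card (det_policies G i - {p}))"
      using card_det_policies fin by (simp add: card_gt_0_iff)
  qed auto
  also have "\<dots> \<le> measure_pmf.prob (bind_pmf ?stay ?draw) {(p, p')}"
  proof (rule prob_bind_ge)
    fix q assume "q \<in> {p}"
    then have "measure_pmf.prob (?draw q) {(p, p')} = pmf (pmf_of_set (det_policies G i - {p})) p'"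
      by (simp add: vimage_def measure_pmf_single[symmetric])
    then show "1 / card (det_policies G i - {p}) \<le> measure_pmf.prob (?draw q) {(p, p')}"
      using p' fin by simp
  qed simp
  also have "bind_pmf ?stay ?draw = new_policies G A s i"
    by (simp add: new_policies_def map_pmf_def)
  finally show ?thesis
    by (simp add: measure_pmf_single)
qed

definition draw_policies where
  "draw_policies s = Pi_pmf UNIV undefined (new_policies G A s)"

lemma draw_policies_chance:
  assumes "\<And>i. \<pi> i = baseline s i \<or> (accepts A s i \<and> \<pi> i = candidate s i)"
    and "\<pi>' \<in> joint_det_policies G" "\<And>i. \<pi>' i \<noteq> \<pi> i"
  shows "update_chance \<le> pmf (draw_policies s) (\<lambda>i. (\<pi> i, \<pi>' i))"
proof -
  have "update_chance \<le> (\<Prod>i\<in>UNIV. pmf (new_policies G A s i) (\<pi> i, \<pi>' i))"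
    unfolding update_chance_def
  proof (intro prod_mono conjI new_policies_chance assms)
    show "0 \<le> min (inertia A i) (1 - inertia A i) / card (det_policies G i)" for i
      using inertia_bounds[of i] by simp
    show "\<pi>' i \<in> det_policies G i" for i
      using assms(2) by (simp add: joint_det_policies_def)
  qed
  then show ?thesis
    unfolding draw_policies_def by (subst pmf_Pi') auto
qed

lemma draw_policies_support:
  assumes "valid_start G A s" and e: "baseline e = baseline s" "candidate e = candidate s"
    and f: "f \<in> set_pmf (draw_policies e)"
  shows "(\<lambda>i. fst (f i)) \<in> joint_det_policies G" "(\<lambda>i. snd (f i)) \<in> joint_det_policies G"
    "snd (f i) \<noteq> fst (f i)" "\<not> accepts A e i \<Longrightarrow> fst (f i) = baseline s i"
proof -
  have fi: "f i \<in> set_pmf (new_policies G A e i)" for i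
    using f by (auto simp: draw_policies_def set_Pi_pmf PiE_dflt_def)
  have bc: "baseline s i \<in> det_policies G i" "candidate s i \<in> det_policies G i"
    "candidate s i \<noteq> baseline s i" for i
    using assms(1) by (auto simp: valid_start_def joint_det_policies_def)
  have ne: "set_pmf (pmf_of_set (det_policies G i - {p})) = det_policies G i - {p}" for i p
    using finite_det_policies[OF game, of i] bc[of i] by (intro set_pmf_of_set) auto
  have "fst (f i) \<in> det_policies G i \<and> snd (f i) \<in> det_policies G i \<and> snd (f i) \<noteq> fst (f i) \<and>
      (\<not> accepts A e i \<longrightarrow> fst (f i) = baseline s i)" for i
    using fi[of i] bc[of i] by (auto simp: new_policies_def ne e split: if_splits)
  then show "(\<lambda>i. fst (f i)) \<in> joint_det_policies G" "(\<lambda>i. snd (f i)) \<in> joint_det_policies G"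
    "snd (f i) \<noteq> fst (f i)" "\<not> accepts A e i \<Longrightarrow> fst (f i) = baseline s i"
    by (auto simp: joint_det_policies_def)
qed

definition finish_phase where
  "finish_phase R h e = map_pmf (\<lambda>f.
     (h @ [e], start_phase R (h @ [e]) (env e) (\<lambda>i. fst (f i)) (\<lambda>i. snd (f i)))) (draw_policies e)"

lemma next_phase_eq: "next_phase G A R n (h, s) = bind_pmf (explore G A n s) (finish_phase R h)"
  by (simp add: next_phase_def finish_phase_def[abs_def] draw_policies_def Let_def map_pmf_def)

definition ready_states where
  "ready_states m = {s. ready m (baseline (snd s)) (candidate (snd s))}"

lemma ready_states_0: "ready_states 0 = {s. baseline (snd s) \<in> det_equilibria G}"
  by (simp add: ready_states_def)

text \<open>
  Whichever permitted policy is to come next, some choice of candidates makes the following phase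
  ready for progress, and this outcome has probability at least \<open>update_chance\<close> after an accurate phase.
\<close>

lemma next_phase_reaches:
  assumes s: "valid_start G A s" and reliable: "phase_reliable d n"
    and \<pi>: "\<pi> \<in> near_equilibrium m"
    and allowed: "\<And>i. \<pi> i = baseline s i \<or> (improves G s i \<and> \<pi> i = candidate s i)"
  shows "(1 - d) * update_chance \<le> measure_pmf.prob (next_phase G A R n (h, s)) (ready_states m)"
proof -
  \<comment> \<open>Witnesses that each decision maker has a policy other than its next one to draw as candidate.\<close>
  let ?\<psi> = "\<lambda>i. if \<pi> i = baseline s i then candidate s i else baseline s i"
  have "?\<psi> \<in> joint_det_policies G" "\<And>i. ?\<psi> i \<noteq> \<pi> i"
    using s by (auto simp: valid_start_def joint_det_policies_def)
  from ready_choice[OF \<pi> this] obtain \<pi>' where \<pi>': "\<pi>' \<in> joint_det_policies G"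
    "\<And>i. \<pi>' i \<noteq> \<pi> i" "ready m \<pi> \<pi>'"
    by blast
  have "1 - d \<le> measure_pmf.prob (explore G A n s) {e. accurate G A e}"
  proof -
    have "{e. accurate G A e} = UNIV - {e. \<not> accurate G A e}"
      by auto
    then show ?thesis
      using reliable s measure_pmf.prob_compl[of "{e. \<not> accurate G A e}" "explore G A n s"]
      by (simp add: phase_reliable_def)
  qed
  then have "(1 - d) * update_chance \<le>
      measure_pmf.prob (explore G A n s) {e. accurate G A e} * update_chance"
    using update_chance by (simp add: mult_right_mono)
  also have "\<dots> \<le> measure_pmf.prob (bind_pmf (explore G A n s) (finish_phase R h)) (ready_states m)"
  proof (rule prob_bind_ge)
    fix e assume e: "e \<in> set_pmf (explore G A n s)" "e \<in> {e. accurate G A e}"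
    note pol = explore_policies[OF e(1)]
    have "update_chance \<le> pmf (draw_policies e) (\<lambda>i. (\<pi> i, \<pi>' i))"
    proof (rule draw_policies_chance)
      show "\<pi> i = baseline e i \<or> accepts A e i \<and> \<pi> i = candidate e i" for i
        using allowed[of i] e(2) by (auto simp: pol accurate_def improves_def)
    qed (use \<pi>' in auto)
    also have "\<dots> = measure_pmf.prob (draw_policies e) {\<lambda>i. (\<pi> i, \<pi>' i)}"
      by (simp add: measure_pmf_single)
    also have "\<dots> \<le> measure_pmf.prob (finish_phase R h e) (ready_states m)"
      unfolding finish_phase_def measure_map_pmf using \<pi>'
      by (intro measure_pmf.finite_measure_mono) (auto simp: ready_states_def start_phase_def)
    finally show "update_chance \<le> measure_pmf.prob (finish_phase R h e) (ready_states m)" .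
  qed (use update_chance in simp)
  finally show ?thesis
    by (simp add: next_phase_eq)
qed

lemma next_phase_advances:
  assumes s: "valid_start G A s" and reliable: "phase_reliable d n"
    and ready: "(h, s) \<in> ready_states (Suc m)"
  shows "(1 - d) * update_chance \<le> measure_pmf.prob (next_phase G A R n (h, s)) (ready_states m)"
proof (cases "baseline s \<in> det_equilibria G")
  case True
  then have "baseline s \<in> near_equilibrium m"
    using near_equilibrium_mono[of 0 m] by auto
  then show ?thesis
    by (rule next_phase_reaches[OF s reliable]) simp
next
  case False
  then obtain i where i: "candidate s i \<in> strict_better_replies G i (embed_joint (baseline s))"
    "(baseline s)(i := candidate s i) \<in> near_equilibrium m"
    using ready by (auto simp: ready_states_def)
  show ?thesis
    by (rule next_phase_reaches[OF s reliable i(2)]) (use i(1) in \<open>auto simp: improves_def\<close>)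
qed

text \<open>In equilibrium no candidate is a strict better reply, so only an inaccurate phase can accept one.\<close>

lemma equilibrium_persists:
  assumes s: "valid_start G A s" and reliable: "phase_reliable d n"
    and eq: "baseline s \<in> det_equilibria G"
  shows "measure_pmf.prob (next_phase G A R n (h, s)) {s'. baseline (snd s') \<noteq> baseline s} \<le> d"
proof -
  let ?A = "{s'. baseline (snd s') \<noteq> baseline s}"
  have "measure_pmf.prob (bind_pmf (explore G A n s) (finish_phase R h)) ?A \<le>
      measure_pmf.prob (explore G A n s) {e. \<not> accurate G A e} + 0"
  proof (rule prob_bind_le)
    fix e assume e: "e \<in> set_pmf (explore G A n s)" "e \<notin> {e. \<not> accurate G A e}"
    note pol = explore_policies[OF e(1)]
    have "\<not> accepts A e i" for i
      using e(2) equilibrium_no_improvement[of e i] eq by (simp add: accurate_def pol)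
    then have "baseline (snd s') = baseline s" if "s' \<in> set_pmf (finish_phase R h e)" for s'
      using that draw_policies_support(4)[OF s pol]
      by (auto simp: finish_phase_def start_phase_def)
    then show "measure_pmf.prob (finish_phase R h e) ?A \<le> 0"
      by (subst prob_eq_0_support) auto
  qed simp
  also have "\<dots> \<le> d"
    using reliable s by (simp add: phase_reliable_def)
  finally show ?thesis
    by (simp add: next_phase_eq)
qed

lemma next_phase_valid:
  assumes s: "valid_start G A s" and s': "s' \<in> set_pmf (next_phase G A R n (h, s))"
    and R: "\<And>h x \<pi> \<pi>' i. R h x \<pi> \<pi>' i \<in> table_set A i \<times> table_set A i"
  shows "valid_start G A (snd s')"
proof -
  obtain e f where e: "e \<in> set_pmf (explore G A n s)" and f: "f \<in> set_pmf (draw_policies e)"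
    and s'_eq: "s' = (h @ [e], start_phase R (h @ [e]) (env e) (\<lambda>i. fst (f i)) (\<lambda>i. snd (f i)))"
    using s' by (auto simp: next_phase_eq finish_phase_def)
  show ?thesis
    using draw_policies_support(1-3)[OF s explore_policies[OF e] f] R
    by (auto simp: s'_eq valid_start_def start_phase_def mem_Times_iff)
qed

end


section \<open>Runs of the algorithm\<close>

locale learning_run = learning_game +
  fixes \<pi>\<^sub>0 \<pi>\<^sub>0' :: "'a \<Rightarrow> 'b \<Rightarrow> 'c" and R :: "('a, 'b, 'c) reset_rule" and T :: "nat \<Rightarrow> nat"
  assumes run: "valid_run G A \<pi>\<^sub>0 \<pi>\<^sub>0' R T"
begin

definition phases where "phases k = next_phase G A R (T k)"

definition start where "start = map_pmf (\<lambda>x. ([], start_phase R [] x \<pi>\<^sub>0 \<pi>\<^sub>0')) (initial G)"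

abbreviation law where "law \<equiv> marginal start phases"

lemma run_measure_eq: "run_measure G A \<pi>\<^sub>0 \<pi>\<^sub>0' R T = chain_measure start phases"
  by (simp add: run_measure_def start_def phases_def[abs_def])

lemma reset_in_tables: "R h x \<pi> \<pi>' i \<in> table_set A i \<times> table_set A i"
  using run unfolding valid_run_def by blast

lemma phases_valid:
  assumes "valid_start G A (snd s)" "s' \<in> set_pmf (phases k s)"
  shows "valid_start G A (snd s')"
  using assms next_phase_valid[of "snd s" s' R "T k" "fst s"] reset_in_tables
  by (simp add: phases_def)

lemma law_valid:
  assumes "s \<in> set_pmf (law k)"
  shows "valid_start G A (snd s)"
proof -
  obtain s0 where s0: "s0 \<in> set_pmf start" and s: "s \<in> set_pmf (evolve phases 0 k s0)"
    using assms by (auto simp: marginal_def)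
  have "valid_start G A (snd s0)"
    using s0 run reset_in_tables
    by (auto simp: start_def start_phase_def valid_start_def valid_run_def mem_Times_iff)
  then show ?thesis
    using s phases_valid by (rule evolve_invariant[where I="\<lambda>s. valid_start G A (snd s)", rotated])
qed

lemma reaches_equilibrium:
  assumes reliable: "\<And>l. k \<le> l \<Longrightarrow> phase_reliable d (T l)" and d: "d \<le> 1"
    and s: "valid_start G A (snd s)" "s \<in> ready_states m"
  shows "((1 - d) * update_chance) ^ m \<le> measure_pmf.prob (evolve phases k m s) (ready_states 0)"
  using s reliable
proof (induction m arbitrary: k s)
  case (Suc m)
  have c: "0 \<le> (1 - d) * update_chance"
    using d update_chance by simp
  have "((1 - d) * update_chance) ^ Suc m \<le>
      measure_pmf.prob (phases k s) (ready_states m) * ((1 - d) * update_chance) ^ m"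
    using next_phase_advances[OF Suc.prems(1) Suc.prems(3)[OF order_refl], of "fst s" m R] Suc.prems(2) c
    by (simp add: phases_def mult_right_mono)
  also have "\<dots> \<le> measure_pmf.prob (evolve phases k (Suc m) s) (ready_states 0)"
    unfolding evolve.simps
  proof (rule prob_bind_ge)
    fix s' assume "s' \<in> set_pmf (phases k s)" "s' \<in> ready_states m"
    then show "((1 - d) * update_chance) ^ m \<le>
        measure_pmf.prob (evolve phases (Suc k) m s') (ready_states 0)"
      using phases_valid[OF Suc.prems(1)] Suc.prems(3) by (intro Suc.IH) auto
  qed (use c in simp)
  finally show ?case .
qed simp

text \<open>The additional first phase serves to draw a candidate that makes the run ready.\<close>

lemma reaches_equilibrium_from_anywhere:
  assumes reliable: "\<And>l. k \<le> l \<Longrightarrow> phase_reliable d (T l)" and d: "d \<le> 1"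
    and s: "valid_start G A (snd s)" and L: "joint_det_policies G \<subseteq> near_equilibrium L"
  shows "((1 - d) * update_chance) ^ Suc L \<le>
    measure_pmf.prob (evolve phases k (Suc L) s) (ready_states 0)"
proof -
  have c: "0 \<le> (1 - d) * update_chance"
    using d update_chance by simp
  have "baseline (snd s) \<in> near_equilibrium L"
    using s L by (auto simp: valid_start_def)
  then have "((1 - d) * update_chance) ^ Suc L \<le>
      measure_pmf.prob (phases k s) (ready_states L) * ((1 - d) * update_chance) ^ L"
    using next_phase_reaches[OF s reliable[OF order_refl], of "baseline (snd s)" L R "fst s"] c
    by (simp add: phases_def mult_right_mono)
  also have "\<dots> \<le> measure_pmf.prob (evolve phases k (Suc L) s) (ready_states 0)"
    unfolding evolve.simps
  proof (rule prob_bind_ge)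
    fix s' assume "s' \<in> set_pmf (phases k s)" "s' \<in> ready_states L"
    then show "((1 - d) * update_chance) ^ L \<le>
        measure_pmf.prob (evolve phases (Suc k) L s') (ready_states 0)"
      using phases_valid[OF s] reliable d by (intro reaches_equilibrium) auto
  qed (use c in simp)
  finally show ?thesis .
qed

lemma stays_in_equilibrium:
  fixes d :: real
  assumes reliable: "\<And>l. k \<le> l \<Longrightarrow> phase_reliable d (T l)" and d: "0 \<le> d"
    and s: "valid_start G A (snd s)" "s \<in> ready_states 0"
  shows "measure_pmf.prob (evolve phases k m s) (- ready_states 0) \<le> m * d"
  using s reliable
proof (induction m arbitrary: k s)
  case (Suc m)
  have "measure_pmf.prob (evolve phases k (Suc m) s) (- ready_states 0) \<le>
      measure_pmf.prob (phases k s) {s'. baseline (snd s') \<noteq> baseline (snd s)} + m * d"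
    unfolding evolve.simps
  proof (rule prob_bind_le)
    fix s' assume "s' \<in> set_pmf (phases k s)" "s' \<notin> {s'. baseline (snd s') \<noteq> baseline (snd s)}"
    then show "measure_pmf.prob (evolve phases (Suc k) m s') (- ready_states 0) \<le> m * d"
      using phases_valid[OF Suc.prems(1)] Suc.prems(2,3)
      by (intro Suc.IH) (auto simp: ready_states_0)
  qed (use d in simp)
  also have "measure_pmf.prob (phases k s) {s'. baseline (snd s') \<noteq> baseline (snd s)} \<le> d"
    using equilibrium_persists[OF Suc.prems(1) Suc.prems(3)[OF order_refl], of R "fst s"] Suc.prems(2)
    by (simp add: phases_def ready_states_0)
  finally show ?case
    by (simp add: algebra_simps)
qed simp

definition miss :: "nat \<Rightarrow> real" where
  "miss k = measure_pmf.prob (law k) (- ready_states 0)"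

text \<open>
  The contraction factor must not depend on \<open>d\<close>, which is to be chosen small compared with it; this
  is why \<open>d\<close> is bounded by \<open>1/2\<close> and the success probability of a phase by half of \<open>update_chance\<close>.
\<close>

lemma miss_drift:
  fixes d :: real
  assumes reliable: "\<And>l. k \<le> l \<Longrightarrow> phase_reliable d (T l)" and d: "0 \<le> d" "d \<le> 1/2"
    and L: "joint_det_policies G \<subseteq> near_equilibrium L"
  shows "miss (k + Suc L) \<le> (1 - (update_chance / 2) ^ Suc L) * miss k + Suc L * d"
proof -
  let ?p = "(update_chance / 2) ^ Suc L"
  have c: "update_chance / 2 \<le> (1 - d) * update_chance"
    using d(2) update_chance(1) by (simp add: field_simps)
  have "?p \<le> 1"
    using update_chance by (intro power_le_one) auto
  have "miss (k + Suc L) \<le> measure_pmf.prob (law k) (- ready_states 0) * (1 - ?p) + Suc L * d"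
    unfolding miss_def marginal_add
  proof (rule prob_bind_affine)
    fix s assume s: "s \<in> set_pmf (law k)"
    show "measure_pmf.prob (evolve phases k (Suc L) s) (- ready_states 0) \<le> 1 - ?p"
    proof -
      have "?p \<le> ((1 - d) * update_chance) ^ Suc L"
        using c update_chance by (intro power_mono) auto
      also have "\<dots> \<le> measure_pmf.prob (evolve phases k (Suc L) s) (ready_states 0)"
        using reliable d L by (intro reaches_equilibrium_from_anywhere law_valid[OF s]) auto
      finally show ?thesis
        using measure_pmf.prob_compl[of "ready_states 0" "evolve phases k (Suc L) s"]
        by (simp add: Compl_eq_Diff_UNIV)
    qed
    show "measure_pmf.prob (evolve phases k (Suc L) s) (- ready_states 0) \<le> Suc L * d"
      if "s \<notin> - ready_states 0"
      using reliable d that by (intro stays_in_equilibrium law_valid[OF s]) auto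
  qed (use \<open>?p \<le> 1\<close> d in auto)
  then show ?thesis
    by (simp add: miss_def mult.commute)
qed

lemma miss_bound:
  fixes d :: real
  assumes reliable: "\<And>l. k \<le> l \<Longrightarrow> phase_reliable d (T l)" and d: "0 \<le> d" "d \<le> 1/2"
    and L: "joint_det_policies G \<subseteq> near_equilibrium L"
  shows "miss (k + j * Suc L) \<le>
    (1 - (update_chance / 2) ^ Suc L) ^ j + Suc L * d / (update_chance / 2) ^ Suc L"
proof (induction j)
  case 0
  have "miss k \<le> 1"
    by (simp add: miss_def)
  moreover have "0 \<le> Suc L * d / (update_chance / 2) ^ Suc L"
    using d update_chance by simp
  ultimately show ?case by simp
next
  case (Suc j)
  let ?p = "(update_chance / 2) ^ Suc L" and ?e = "Suc L * d"
  have p: "0 < ?p" "?p \<le> 1"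
    using update_chance by (auto intro!: power_le_one simp del: power_Suc)
  have "miss (k + j * Suc L + Suc L) \<le> (1 - ?p) * miss (k + j * Suc L) + ?e"
    using reliable d L by (intro miss_drift) auto
  also have "\<dots> \<le> (1 - ?p) * ((1 - ?p) ^ j + ?e / ?p) + ?e"
    using Suc.IH p by (intro add_right_mono mult_left_mono) auto
  also have "\<dots> = (1 - ?p) ^ Suc j + ?e / ?p"
  proof -
    have "(1 - p) * ((1 - p) ^ j + e / p) + e = (1 - p) ^ Suc j + e / p" if "0 < p" for p e :: real
      using that by (simp add: field_simps)
    then show ?thesis
      using p(1) by blast
  qed
  finally show ?case
    by (simp add: add_ac)
qed

lemma prob_equilibrium:
  "measure (run_measure G A \<pi>\<^sub>0 \<pi>\<^sub>0' R T) {\<omega> \<in> space (run_measure G A \<pi>\<^sub>0 \<pi>\<^sub>0' R T).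
     baseline_at \<omega> k \<in> det_equilibria G} = 1 - miss k"
proof -
  have "{\<omega> \<in> space (run_measure G A \<pi>\<^sub>0 \<pi>\<^sub>0' R T). baseline_at \<omega> k \<in> det_equilibria G} =
      {\<omega>. \<omega> k \<in> ready_states 0}"
    by (auto simp: run_measure_eq ready_states_0 baseline_at_def)
  then show ?thesis
    using measure_pmf.prob_compl[of "ready_states 0" "law k"]
    by (simp add: run_measure_eq prob_chain_component miss_def Compl_eq_Diff_UNIV)
qed

end

context learning_game
begin

text \<open>
  Both the claim for uniformly long phases and the claim for phases of growing length are instances:
  phases need to be reliable only from some index \<open>k\<close> on, and the waiting time after \<open>k\<close> does not
  depend on the run.
\<close>

lemma equilibrium_eventually_likely:
  assumes "0 < \<epsilon>"
  shows "\<exists>d>0. \<exists>k\<^sub>m. \<forall>\<pi>\<^sub>0 \<pi>\<^sub>0' R T k k'.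
    valid_run G A \<pi>\<^sub>0 \<pi>\<^sub>0' R T \<and> (\<forall>l\<ge>k. phase_reliable d (T l)) \<and> k + k\<^sub>m \<le> k' \<longrightarrow>
    1 - \<epsilon> \<le> \<P>(\<omega> in run_measure G A \<pi>\<^sub>0 \<pi>\<^sub>0' R T. baseline_at \<omega> k' \<in> det_equilibria G)"
proof -
  obtain L where L: "joint_det_policies G \<subseteq> near_equilibrium L"
    using all_near_equilibrium by blast
  define p where "p = (update_chance / 2) ^ Suc L"
  define d where "d = min (1/2) (\<epsilon> / 2 * p / Suc L)"
  have "0 < (update_chance / 2) ^ Suc L" "(update_chance / 2) ^ Suc L \<le> 1"
    using update_chance by (auto intro!: power_le_one simp del: power_Suc)
  then have p: "0 < p" "p \<le> 1"
    by (simp_all add: p_def)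
  then have "0 < \<epsilon> / 2 * p / Suc L"
    using assms by simp
  then have d: "0 < d" "d \<le> 1/2"
    unfolding d_def by (simp, intro min.cobounded1)
  have "d \<le> \<epsilon> / 2 * p / Suc L"
    by (simp add: d_def)
  then have drift: "Suc L * d / p \<le> \<epsilon> / 2"
    using p by (simp add: field_simps)
  have "(\<lambda>j. (1 - p) ^ j) \<longlonglongrightarrow> 0"
    using p by (intro LIMSEQ_power_zero) auto
  then have "\<forall>\<^sub>F j in sequentially. (1 - p) ^ j < \<epsilon> / 2"
    using assms by (intro order_tendstoD(2)) auto
  then obtain J where J: "\<And>j. J \<le> j \<Longrightarrow> (1 - p) ^ j < \<epsilon> / 2"
    unfolding eventually_sequentially by blast
  show ?thesis
  proof (intro exI[of _ d] conjI d exI[of _ "J * Suc L"] allI impI, elim conjE)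
    fix \<pi>\<^sub>0 \<pi>\<^sub>0' :: "'i \<Rightarrow> 'x \<Rightarrow> 'u" and R T k k'
    assume run: "valid_run G A \<pi>\<^sub>0 \<pi>\<^sub>0' R T" and reliable: "\<forall>l\<ge>k. phase_reliable d (T l)"
      and k': "k + J * Suc L \<le> k'"
    interpret learning_run G A \<rho>\<^sub>c \<pi>\<^sub>0 \<pi>\<^sub>0' R T
      by unfold_locales (rule run)
    define j r where "j = (k' - k) div Suc L" and "r = (k' - k) mod Suc L"
    have "k' = (k + r) + j * Suc L"
      using k' div_mult_mod_eq[of "k' - k" "Suc L"] unfolding j_def r_def by linarith
    moreover have "J \<le> j"
    proof -
      have "J = J * Suc L div Suc L"
        by (rule nonzero_mult_div_cancel_right[symmetric]) simp
      also have "\<dots> \<le> j"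
        using k' unfolding j_def by (intro div_le_mono) simp
      finally show ?thesis .
    qed
    moreover have "miss (k + r + j * Suc L) \<le> (1 - p) ^ j + Suc L * d / p"
      unfolding p_def using reliable d L by (intro miss_bound) auto
    ultimately have "miss k' \<le> (1 - p) ^ j + Suc L * d / p" and "(1 - p) ^ j < \<epsilon> / 2"
      using J by auto
    then have "miss k' \<le> \<epsilon>"
      using drift by linarith
    then show "1 - \<epsilon> \<le> \<P>(\<omega> in run_measure G A \<pi>\<^sub>0 \<pi>\<^sub>0' R T. baseline_at \<omega> k' \<in> det_equilibria G)"
      unfolding prob_equilibrium by simp
  qed
qed

lemma equilibrium_likely_uniformly:
  assumes "0 < \<epsilon>"
  shows "\<exists>T\<^sub>m k\<^sub>m :: nat. \<forall>\<pi>\<^sub>0 \<pi>\<^sub>0' R T. valid_run G A \<pi>\<^sub>0 \<pi>\<^sub>0' R T \<and> (\<forall>l. T\<^sub>m \<le> T l) \<longrightarrow>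
    (\<forall>k\<ge>k\<^sub>m. \<P>(\<omega> in run_measure G A \<pi>\<^sub>0 \<pi>\<^sub>0' R T. baseline_at \<omega> k \<in> det_equilibria G) \<ge> 1 - \<epsilon>)"
proof -
  obtain d k\<^sub>m where d: "0 < d" and likely: "\<forall>\<pi>\<^sub>0 \<pi>\<^sub>0' R T k k'.
      valid_run G A \<pi>\<^sub>0 \<pi>\<^sub>0' R T \<and> (\<forall>l\<ge>k. phase_reliable d (T l)) \<and> k + k\<^sub>m \<le> k' \<longrightarrow>
      1 - \<epsilon> \<le> \<P>(\<omega> in run_measure G A \<pi>\<^sub>0 \<pi>\<^sub>0' R T. baseline_at \<omega> k' \<in> det_equilibria G)"
    using equilibrium_eventually_likely[OF assms] by blast
  obtain T\<^sub>m where "\<And>n. T\<^sub>m \<le> n \<Longrightarrow> phase_reliable d n"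
    using long_phases_reliable[OF d] by blast
  then have "1 - \<epsilon> \<le> \<P>(\<omega> in run_measure G A \<pi>\<^sub>0 \<pi>\<^sub>0' R T. baseline_at \<omega> k \<in> det_equilibria G)"
    if "valid_run G A \<pi>\<^sub>0 \<pi>\<^sub>0' R T" "\<forall>l. T\<^sub>m \<le> T l" "k\<^sub>m \<le> k" for \<pi>\<^sub>0 \<pi>\<^sub>0' R T k
    using that by (intro likely[rule_format, of \<pi>\<^sub>0 \<pi>\<^sub>0' R T 0]) auto
  then show ?thesis by blast
qed

lemma equilibrium_probability_tendsto:
  assumes run: "valid_run G A \<pi>\<^sub>0 \<pi>\<^sub>0' R T" and T: "filterlim T at_top sequentially"
  shows "(\<lambda>k. \<P>(\<omega> in run_measure G A \<pi>\<^sub>0 \<pi>\<^sub>0' R T. baseline_at \<omega> k \<in> det_equilibria G)) \<longlonglongrightarrow> 1"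
    (is "?P \<longlonglongrightarrow> 1")
proof (rule LIMSEQ_I)
  fix \<epsilon> :: real assume \<epsilon>: "0 < \<epsilon>"
  interpret learning_run G A \<rho>\<^sub>c \<pi>\<^sub>0 \<pi>\<^sub>0' R T
    by unfold_locales (rule run)
  obtain d k\<^sub>m where d: "0 < d" and likely: "\<forall>\<pi>\<^sub>0 \<pi>\<^sub>0' R T k k'.
      valid_run G A \<pi>\<^sub>0 \<pi>\<^sub>0' R T \<and> (\<forall>l\<ge>k. phase_reliable d (T l)) \<and> k + k\<^sub>m \<le> k' \<longrightarrow>
      1 - \<epsilon> / 2 \<le> \<P>(\<omega> in run_measure G A \<pi>\<^sub>0 \<pi>\<^sub>0' R T. baseline_at \<omega> k' \<in> det_equilibria G)"
    using equilibrium_eventually_likely[OF half_gt_zero[OF \<epsilon>]] by blast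
  obtain N where N: "\<And>n. N \<le> n \<Longrightarrow> phase_reliable d n"
    using long_phases_reliable[OF d] by blast
  have "\<forall>\<^sub>F k in sequentially. N \<le> T k"
    using T by (simp add: filterlim_at_top)
  then obtain k where k: "\<And>l. k \<le> l \<Longrightarrow> N \<le> T l"
    unfolding eventually_sequentially by blast
  have "norm (?P k' - 1) < \<epsilon>" if "k + k\<^sub>m \<le> k'" for k'
  proof -
    have "1 - \<epsilon> / 2 \<le> ?P k'"
      using that N k run by (intro likely[rule_format, of \<pi>\<^sub>0 \<pi>\<^sub>0' R T k]) auto
    moreover have "?P k' \<le> 1"
      unfolding prob_equilibrium by (simp add: miss_def)
    ultimately show ?thesis
      using \<epsilon> by simp
  qed
  then show "\<exists>k. \<forall>k'\<ge>k. norm (?P k' - 1) < \<epsilon>"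
    by blast
qed

text \<open>
  With summable error probabilities of the phases, a run that is in equilibrium at a late phase
  never leaves it again except on an event of small probability.
\<close>

lemma almost_sure_convergence:
  assumes run: "valid_run G A \<pi>\<^sub>0 \<pi>\<^sub>0' R T" and T: "filterlim T at_top sequentially"
    and reliable: "\<And>l. phase_reliable ((1/2) ^ l) (T l)"
  shows "\<P>(\<omega> in run_measure G A \<pi>\<^sub>0 \<pi>\<^sub>0' R T.
    \<exists>\<pi>\<in>det_equilibria G. \<forall>\<^sub>F k in sequentially. baseline_at \<omega> k = \<pi>) = 1"
proof -
  interpret learning_run G A \<rho>\<^sub>c \<pi>\<^sub>0 \<pi>\<^sub>0' R T
    by unfold_locales (rule run)
  define M where "M = run_measure G A \<pi>\<^sub>0 \<pi>\<^sub>0' R T"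
  interpret M: prob_space M
    unfolding M_def run_measure_def by (rule prob_space_chain_measure)
  let ?E = "det_equilibria G"
  have finE: "finite ?E"
    using finite_joint_det_policies[OF game] by (rule finite_subset[rotated]) (auto simp: det_equilibria_def)
  have space: "space M = UNIV"
    by (simp add: M_def run_measure_eq)
  have meas: "{\<omega>. Q (\<omega> k)} \<in> sets M" for Q k
  proof -
    have "(\<lambda>\<omega>. \<omega> k) \<in> measurable M (count_space UNIV)"
      by (simp add: M_def run_measure_eq)
    from measurable_sets[OF this, of "{s. Q s}"] show ?thesis
      by (simp add: vimage_def space)
  qed
  let ?at = "\<lambda>k \<pi>. {\<omega>. baseline_at \<omega> k = \<pi>}"
  have at: "?at k \<pi> \<in> sets M" for k \<pi>
    unfolding baseline_at_def by (rule meas)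
  define F where "F = {\<omega>. \<exists>\<pi>\<in>?E. \<forall>\<^sub>F k in sequentially. baseline_at \<omega> k = \<pi>}"
  have "F = (\<Union>\<pi>\<in>?E. \<Union>n. \<Inter>k\<in>{n..}. ?at k \<pi>)"
    by (auto simp: F_def eventually_sequentially)
  then have F: "F \<in> sets M"
    using finE at by (auto intro!: sets.finite_UN sets.countable_UN sets.countable_INT')
  define In where "In k = {\<omega>. baseline_at \<omega> k \<in> ?E}" for k
  have In: "In k \<in> sets M" for k
    unfolding In_def baseline_at_def by (rule meas)
  \<comment> \<open>Written as a union of rectangles over the finitely many equilibria, to be measurable.\<close>
  define Leave where "Leave l = (\<Union>\<pi>\<in>?E. {\<omega>. baseline_at \<omega> l = \<pi> \<and> baseline_at \<omega> (Suc l) \<noteq> \<pi>})" for l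
  have leave_sets: "{\<omega>. baseline_at \<omega> l = \<pi> \<and> baseline_at \<omega> (Suc l) \<noteq> \<pi>} \<in> sets M" for l \<pi>
  proof -
    have "{\<omega>. baseline_at \<omega> l = \<pi> \<and> baseline_at \<omega> (Suc l) \<noteq> \<pi>} = ?at l \<pi> - ?at (Suc l) \<pi>"
      by auto
    then show ?thesis
      using at by auto
  qed
  then have Leave: "Leave l \<in> sets M" for l
    unfolding Leave_def using finE by (intro sets.finite_UN) auto
  have leave_one: "measure M {\<omega>. baseline_at \<omega> l = \<pi> \<and> baseline_at \<omega> (Suc l) \<noteq> \<pi>} \<le> (1/2) ^ l"
    if \<pi>: "\<pi> \<in> ?E" for l \<pi>
  proof -
    have "measure (chain_measure start phases) {\<omega>. \<omega> l \<in> {s. baseline (snd s) = \<pi>} \<and>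
        \<omega> (Suc l) \<in> {s. baseline (snd s) \<noteq> \<pi>}} \<le> (1/2) ^ l"
    proof (rule prob_chain_two_le)
      fix s assume s: "s \<in> set_pmf (law l)" "s \<in> {s. baseline (snd s) = \<pi>}"
      then show "measure_pmf.prob (phases l s) {s. baseline (snd s) \<noteq> \<pi>} \<le> (1/2) ^ l"
        using equilibrium_persists[OF law_valid[OF s(1)] reliable[of l], of R "fst s"] \<pi>
        by (simp add: phases_def)
    qed simp
    then show ?thesis
      by (simp add: M_def run_measure_eq baseline_at_def)
  qed
  have leave_prob: "measure M (Leave l) \<le> card ?E * (1/2) ^ l" for l
  proof -
    have "measure M (Leave l) \<le>
        (\<Sum>\<pi>\<in>?E. measure M {\<omega>. baseline_at \<omega> l = \<pi> \<and> baseline_at \<omega> (Suc l) \<noteq> \<pi>})"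
      unfolding Leave_def using finE leave_sets by (intro M.finite_measure_subadditive_finite) auto
    also have "\<dots> \<le> (\<Sum>\<pi>\<in>?E. (1/2) ^ l)"
      by (intro sum_mono leave_one)
    finally show ?thesis by simp
  qed
  have geo: "(\<lambda>l. card ?E * (1/2) ^ k * (1/2::real) ^ l) sums (card ?E * (1/2) ^ k * (1 / (1 - 1/2)))" for k
    by (intro sums_mult geometric_sums) simp
  have lower: "measure M (In k) - card ?E * (1/2) ^ k * 2 \<le> measure M F" for k
  proof -
    have le: "measure M (Leave (k + l)) \<le> card ?E * (1/2) ^ k * (1/2) ^ l" for l
      using leave_prob[of "k + l"] by (simp add: power_add mult.assoc)
    have summ: "summable (\<lambda>l. measure M (Leave (k + l)))"
      using le by (intro summable_comparison_test'[OF sums_summable[OF geo[of k]], of 0]) simp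
    have "In k \<subseteq> F \<union> (\<Union>l. Leave (k + l))"
    proof
      fix \<omega> assume \<omega>: "\<omega> \<in> In k"
      show "\<omega> \<in> F \<union> (\<Union>l. Leave (k + l))"
      proof (rule ccontr)
        assume out: "\<omega> \<notin> F \<union> (\<Union>l. Leave (k + l))"
        let ?\<pi> = "baseline_at \<omega> k"
        have "baseline_at \<omega> (k + l) = ?\<pi>" for l
        proof (induction l)
          case (Suc l)
          have "\<omega> \<notin> Leave (k + l)"
            using out by blast
          then show ?case
            using Suc \<omega> by (auto simp: Leave_def In_def)
        qed simp
        then have "\<forall>k'\<ge>k. baseline_at \<omega> k' = ?\<pi>"
          by (metis le_iff_add)
        then have "\<forall>\<^sub>F k' in sequentially. baseline_at \<omega> k' = ?\<pi>"
          unfolding eventually_sequentially by blast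
        then have "\<omega> \<in> F"
          using \<omega> unfolding F_def In_def by blast
        then show False
          using out by blast
      qed
    qed
    then have "measure M (In k) \<le> measure M (F \<union> (\<Union>l. Leave (k + l)))"
      using F Leave by (intro M.finite_measure_mono) auto
    also have "\<dots> \<le> measure M F + measure M (\<Union>l. Leave (k + l))"
      using F Leave by (intro measure_Un_le) auto
    also have "measure M (\<Union>l. Leave (k + l)) \<le> (\<Sum>l. measure M (Leave (k + l)))"
      using Leave summ by (intro M.finite_measure_subadditive_countably) auto
    also have "\<dots> \<le> (\<Sum>l. card ?E * (1/2) ^ k * (1/2) ^ l)"
      using le summ sums_summable[OF geo[of k]] by (intro suminf_le) auto
    also have "\<dots> = card ?E * (1/2) ^ k * 2"
      using sums_unique[OF geo[of k]] by simp
    finally show ?thesis by simp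
  qed
  have "(\<lambda>k. measure M (In k)) \<longlonglongrightarrow> 1"
    using equilibrium_probability_tendsto[OF run T] by (simp add: M_def[symmetric] In_def space)
  moreover have "(\<lambda>k. card ?E * (1/2::real) ^ k * 2) \<longlonglongrightarrow> real (card ?E) * 0 * 2"
    by (intro tendsto_mult tendsto_const LIMSEQ_power_zero) simp
  ultimately have "(\<lambda>k. measure M (In k) - card ?E * (1/2) ^ k * 2) \<longlonglongrightarrow> 1 - real (card ?E) * 0 * 2"
    by (rule tendsto_diff)
  then have "1 \<le> measure M F"
    using lower by (intro LIMSEQ_le_const2[of _ 1]) auto
  then have "measure M F = 1"
    using M.prob_le_1[of F] by simp
  then show ?thesis
    by (simp add: M_def[symmetric] F_def space)
qed

lemma almost_sure_convergence_uniformly: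
  "\<exists>T\<^sub>m :: nat \<Rightarrow> nat. \<forall>\<pi>\<^sub>0 \<pi>\<^sub>0' R T. valid_run G A \<pi>\<^sub>0 \<pi>\<^sub>0' R T \<and> (\<forall>k. T\<^sub>m k \<le> T k) \<longrightarrow>
    \<P>(\<omega> in run_measure G A \<pi>\<^sub>0 \<pi>\<^sub>0' R T.
      \<exists>\<pi>\<in>det_equilibria G. \<forall>\<^sub>F k in sequentially. baseline_at \<omega> k = \<pi>) = 1"
proof -
  have "\<forall>l. \<exists>N. \<forall>n\<ge>N. phase_reliable ((1/2) ^ l) n"
    using long_phases_reliable by simp
  from choice[OF this] obtain N where N: "\<And>l n. N l \<le> n \<Longrightarrow> phase_reliable ((1/2) ^ l) n"
    by blast
  have "\<P>(\<omega> in run_measure G A \<pi>\<^sub>0 \<pi>\<^sub>0' R T.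
      \<exists>\<pi>\<in>det_equilibria G. \<forall>\<^sub>F k in sequentially. baseline_at \<omega> k = \<pi>) = 1"
    if run: "valid_run G A \<pi>\<^sub>0 \<pi>\<^sub>0' R T" and T: "\<forall>k. max k (N k) \<le> T k" for \<pi>\<^sub>0 \<pi>\<^sub>0' R T
  proof (rule almost_sure_convergence[OF run])
    show "filterlim T at_top sequentially"
      by (rule filterlim_at_top_mono[OF filterlim_ident]) (use T in auto)
  qed (use N T in auto)
  then show ?thesis
    by (intro exI[of _ "\<lambda>k. max k (N k)"]) blast
qed

end

theorem theorem2:
  fixes G :: "('i::finite, 'x::finite, 'u) game"
    and A :: "('i, 'x, 'u) algorithm"
    and \<rho>\<^sub>c :: real
  assumes "discounted_game G"
    and "weakly_acyclic G"
    and "valid_algorithm G A"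
    and "value_gaps G \<noteq> {}"
    and "all_states_reachable G"
    and "\<forall>i. 0 < tolerance A i \<and> tolerance A i < delta_check G"
    and "rho_check_bound G (tolerance A) \<rho>\<^sub>c"
    and "\<forall>i. 0 < experiment_prob A i \<and> experiment_prob A i < \<rho>\<^sub>c"
  shows "(\<forall>\<epsilon>>0. \<exists>T\<^sub>m k\<^sub>m :: nat. \<forall>\<pi>\<^sub>0 \<pi>\<^sub>0' R T.
            valid_run G A \<pi>\<^sub>0 \<pi>\<^sub>0' R T \<and> (\<forall>l. T\<^sub>m \<le> T l) \<longrightarrow>
            (\<forall>k\<ge>k\<^sub>m. \<P>(\<omega> in run_measure G A \<pi>\<^sub>0 \<pi>\<^sub>0' R T. baseline_at \<omega> k \<in> det_equilibria G) \<ge> 1 - \<epsilon>))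
       \<and> (\<forall>\<pi>\<^sub>0 \<pi>\<^sub>0' R T.
            valid_run G A \<pi>\<^sub>0 \<pi>\<^sub>0' R T \<and> filterlim T at_top sequentially \<longrightarrow>
            (\<lambda>k. \<P>(\<omega> in run_measure G A \<pi>\<^sub>0 \<pi>\<^sub>0' R T. baseline_at \<omega> k \<in> det_equilibria G))
              \<longlonglongrightarrow> 1)
       \<and> (\<exists>T\<^sub>m :: nat \<Rightarrow> nat. \<forall>\<pi>\<^sub>0 \<pi>\<^sub>0' R T.
            valid_run G A \<pi>\<^sub>0 \<pi>\<^sub>0' R T \<and> (\<forall>k. T\<^sub>m k \<le> T k) \<longrightarrow>
            \<P>(\<omega> in run_measure G A \<pi>\<^sub>0 \<pi>\<^sub>0' R T.
               \<exists>\<pi>\<in>det_equilibria G. \<forall>\<^sub>F k in sequentially. baseline_at \<omega> k = \<pi>) = 1)"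
proof -
  interpret learning_game G A \<rho>\<^sub>c
    using assms by unfold_locales auto
  show ?thesis
    using equilibrium_likely_uniformly equilibrium_probability_tendsto
      almost_sure_convergence_uniformly by blast
qed

end
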